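(* Let $a_2,a_3,a_{23}\in\mathbb{R}$ and $b\in\mathbb{R}$ with $b\neq 0$. Let $0<\tau_2\le\tau_3$ and $D>\tau_2+\tau_3$ be real numbers. Let $N:[0,\tau_2+\tau_3]\to\mathbb{R}$ and $\tilde M:[0,D]\to\mathbb{R}$ be piecewise continuous functions. Assume that for every $s\in\mathbb{C}$, $$\operatorname{rank}\big(F_0(s),F_1(s)\big)=1,\quad\text{i.e. } (F_0(s),F_1(s))\neq(0,0),$$ where $$F_0(s)=1-a_3e^{-\tau_3 s}-a_2e^{-\tau_2 s}-a_{23}e^{-(\tau_2+\tau_3)s}-\int_0^{\tau_2+\tau_3}N(\nu)e^{-\nu s}\,d\nu,\qquad F_1(s)=be^{-Ds}+\int_0^{D}\tilde M(\nu)e^{-\nu s}\,d\nu .$$ Let $X=L^2(0,D)\times L^2(0,\tau_2)\times L^2(\tau_2,\tau_3)\times L^2(\tau_3,\tau_2+\tau_3)$. For $(g,f_2,f_3,f_{23})\in X$ put $f=\mathbb{1}_{[0,\tau_2)}f_2+\mathbb{1}_{[\tau_2,\tau_3)}f_3+\mathbb{1}_{[\tau_3,\tau_2+\tau_3]}f_{23}$ on $[0,\tau_2+\tau_3]$, write $a_{\tau_2}=a_2$, $a_{\tau_3}=a_3$, $a_{\tau_2+\tau_3}=a_{23}$, and define the linear operator $\mathcal{T}:X\to X$, $\mathcal{T}(g,f_2,f_3,f_{23})=(I_1,I_2,I_3,I_{23})$, by $$I_1(\nu)=g(\nu)-\sum_{\delta\in\{\tau_2,\tau_3,\tau_2+\tau_3\}}a_\delta\,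 g(\nu-\delta)\mathbb{1}_{(\delta,D]}(\nu)+\mathbb{1}_{[0,\tau_2+\tau_3]}(\nu)\int_0^\nu\big(f(\eta)\tilde M(\nu-\eta)-g(\eta)N(\nu-\eta)\big)d\eta$$ $$\qquad+\mathbb{1}_{(\tau_2+\tau_3,D]}(\nu)\Big(\int_0^{\tau_2+\tau_3}f(\eta)\tilde M(\nu-\eta)\,d\eta-\int_{\nu-\tau_2-\tau_3}^{\nu}g(\eta)N(\nu-\eta)\,d\eta\Big),\quad \nu\in(0,D);$$ and, with the common tail term $R(\nu)=\int_\nu^{\tau_2+\tau_3}f(\eta)\tilde M(\nu+D-\eta)\,d\eta-\int_{\nu+D-\tau_2-\tau_3}^{D}g(\eta)N(\nu+D-\eta)\,d\eta$, $$I_2(\nu)=bf_2(\nu)-\sum_{\delta\in\{\tau_2,\tau_3,\tau_2+\tau_3\}}a_\delta\, g(\nu+D-\delta)+R(\nu),\quad \nu\in(0,\tau_2),$$ $$I_3(\nu)=bf_3(\nu)-\sum_{\delta\in\{\tau_3,\tau_2+\tau_3\}}a_\delta\, g(\nu+D-\delta)+R(\nu),\quad \nu\in(\tau_2,\tau_3),$$ $$I_{23}(\nu)=bf_{23}(\nu)-a_{23}\, g(\nu+D-\tau_2-\tau_3)+R(\nu),\quad \nu\in(\tau_3,\tau_2+\tau_3).$$ Then $\mathcal{T}$ is invertible on $X$. Consequently there exists a unique $(g,f_2,f_3,f_{23})\in X$ such that $\mathcal{T}(g,f_2,f_3,f_{23})=\big(-N\mathbb{1}_{[0,\tau_2+\tau_3]},0,0,0\big)$,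 where $-N\mathbb{1}_{[0,\tau_2+\tau_3]}$ denotes $-N$ extended by zero to $(0,D)$.
   Context: This operator arises in designing controller gains $g,f$ for the integral difference equation $x(t)=a_3x(t-\tau_3)+a_2x(t-\tau_2)+a_{23}x(t-\tau_2-\tau_3)+b\bar U(t-D)+\int_0^D\tilde M(\nu)\bar U(t-\nu)d\nu+\int_0^{\tau_2+\tau_3}N(\nu)x(t-\nu)d\nu$ under the dynamic control law $\bar U(t)=\int_0^D g(\nu)\bar U(t-\nu)d\nu+\int_0^{\tau_2+\tau_3}f(\nu)x(t-\nu)d\nu$. In the paper, $D=\tau_1+1/\lambda_2$, $b=q_{32}q_{21}q_{11}$ is nonzero because the boundary coupling coefficients $q_{11},q_{21},q_{32}$ are assumed nonzero, and $N,\tilde M$ are specific piecewise continuous kernels obtained from a backstepping transformation of a chain of three $2\times2$ hyperbolic PDE systems; the rank condition is the paper's controllability-type assumption. *)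

theory Defs
  imports "HOL-Analysis.Analysis"
begin

type_synonym rfun = "real \<Rightarrow> real"
type_synonym Xelt = "rfun \<times> rfun \<times> rfun \<times> rfun"

definition piecewise_continuous_on :: "real \<Rightarrow> real \<Rightarrow> rfun \<Rightarrow> bool" where
  "piecewise_continuous_on a b h \<longleftrightarrow>
     (\<exists>S. finite S \<and>
        (\<forall>x\<in>{a..b} - S. continuous (at x within {a..b}) h) \<and>
        (\<forall>x\<in>S \<inter> {a<..b}. \<exists>l. (h \<longlongrightarrow> l) (at_left x)) \<and>
        (\<forall>x\<in>S \<inter> {a..<b}. \<exists>l. (h \<longlongrightarrow> l) (at_right x)))"

definition L2_on :: "real set \<Rightarrow> rfun \<Rightarrow> bool" where
  "L2_on S h \<longleftrightarrow> set_borel_measurable lborel S h \<and> set_integrable lborel S (\<lambda>x. (h x)\<^sup>2)"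

definition L2_norm_on :: "real set \<Rightarrow> rfun \<Rightarrow> real" where
  "L2_norm_on S h = sqrt (LINT x:S|lborel. (h x)\<^sup>2)"

definition ae_eq_on :: "real set \<Rightarrow> rfun \<Rightarrow> rfun \<Rightarrow> bool" where
  "ae_eq_on S h k \<longleftrightarrow> (AE x in lborel. x \<in> S \<longrightarrow> h x = k x)"

definition inX :: "real \<Rightarrow> real \<Rightarrow> real \<Rightarrow> Xelt \<Rightarrow> bool" where
  "inX t2 t3 D x = (case x of (g, f2, f3, f23) \<Rightarrow>
     L2_on {0<..<D} g \<and> L2_on {0<..<t2} f2 \<and> L2_on {t2<..<t3} f3 \<and> L2_on {t3<..<t2+t3} f23)"

definition eqX :: "real \<Rightarrow> real \<Rightarrow> real \<Rightarrow> Xelt \<Rightarrow> Xelt \<Rightarrow> bool" where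
  "eqX t2 t3 D x y = (case x of (g, f2, f3, f23) \<Rightarrow> case y of (g', f2', f3', f23') \<Rightarrow>
     ae_eq_on {0<..<D} g g' \<and> ae_eq_on {0<..<t2} f2 f2' \<and>
     ae_eq_on {t2<..<t3} f3 f3' \<and> ae_eq_on {t3<..<t2+t3} f23 f23')"

definition normX :: "real \<Rightarrow> real \<Rightarrow> real \<Rightarrow> Xelt \<Rightarrow> real" where
  "normX t2 t3 D x = (case x of (g, f2, f3, f23) \<Rightarrow>
     sqrt ((L2_norm_on {0<..<D} g)\<^sup>2 + (L2_norm_on {0<..<t2} f2)\<^sup>2 +
           (L2_norm_on {t2<..<t3} f3)\<^sup>2 + (L2_norm_on {t3<..<t2+t3} f23)\<^sup>2))"

definition glue_f :: "real \<Rightarrow> real \<Rightarrow> rfun \<Rightarrow> rfun \<Rightarrow> rfun \<Rightarrow> rfun" where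
  "glue_f t2 t3 f2 f3 f23 \<eta> =
     indicator {0..<t2} \<eta> * f2 \<eta> + indicator {t2..<t3} \<eta> * f3 \<eta> +
     indicator {t3..t2+t3} \<eta> * f23 \<eta>"

definition opT :: "real \<Rightarrow> real \<Rightarrow> real \<Rightarrow> real \<Rightarrow> real \<Rightarrow> real \<Rightarrow> real \<Rightarrow> rfun \<Rightarrow> rfun \<Rightarrow>
    Xelt \<Rightarrow> Xelt" where
  "opT a2 a3 a23 b t2 t3 D N M x = (case x of (g, f2, f3, f23) \<Rightarrow>
     (let f = glue_f t2 t3 f2 f3 f23;
          t = t2 + t3;
          R = (\<lambda>\<nu>. (LINT \<eta>:{\<nu>..t}|lborel. f \<eta> * M (\<nu> + D - \<eta>))
                   - (LINT \<eta>:{\<nu> + D - t..D}|lborel. g \<eta> * N (\<nu> + D - \<eta>)));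
          I1 = (\<lambda>\<nu>. g \<nu>
                  - (a2 * g (\<nu> - t2) * indicator {t2<..D} \<nu>
                     + a3 * g (\<nu> - t3) * indicator {t3<..D} \<nu>
                     + a23 * g (\<nu> - t) * indicator {t<..D} \<nu>)
                  + indicator {0..t} \<nu> *
                      (LINT \<eta>:{0..\<nu>}|lborel. f \<eta> * M (\<nu> - \<eta>) - g \<eta> * N (\<nu> - \<eta>))
                  + indicator {t<..D} \<nu> *
                      ((LINT \<eta>:{0..t}|lborel. f \<eta> * M (\<nu> - \<eta>))
                       - (LINT \<eta>:{\<nu> - t..\<nu>}|lborel. g \<eta> * N (\<nu> - \<eta>))));
          I2 = (\<lambda>\<nu>. b * f2 \<nu>
                  - (a2 * g (\<nu> + D - t2) + a3 * g (\<nu> + D - t3) + a23 * g (\<nu> + D - t))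
                  + R \<nu>);
          I3 = (\<lambda>\<nu>. b * f3 \<nu> - (a3 * g (\<nu> + D - t3) + a23 * g (\<nu> + D - t)) + R \<nu>);
          I23 = (\<lambda>\<nu>. b * f23 \<nu> - a23 * g (\<nu> + D - t) + R \<nu>)
      in (I1, I2, I3, I23)))"

definition invertible_on_X :: "real \<Rightarrow> real \<Rightarrow> real \<Rightarrow> (Xelt \<Rightarrow> Xelt) \<Rightarrow> bool" where
  "invertible_on_X t2 t3 D T \<longleftrightarrow>
     (\<forall>x. inX t2 t3 D x \<longrightarrow> inX t2 t3 D (T x)) \<and>
     (\<forall>y. inX t2 t3 D y \<longrightarrow> (\<exists>x. inX t2 t3 D x \<and> eqX t2 t3 D (T x) y)) \<and>
     (\<forall>x1 x2. inX t2 t3 D x1 \<longrightarrow> inX t2 t3 D x2 \<longrightarrow>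
         eqX t2 t3 D (T x1) (T x2) \<longrightarrow> eqX t2 t3 D x1 x2) \<and>
     (\<exists>C. \<forall>x. inX t2 t3 D x \<longrightarrow> normX t2 t3 D x \<le> C * normX t2 t3 D (T x))"

definition F0 :: "real \<Rightarrow> real \<Rightarrow> real \<Rightarrow> real \<Rightarrow> real \<Rightarrow> rfun \<Rightarrow> complex \<Rightarrow> complex" where
  "F0 a2 a3 a23 t2 t3 N s = 1 - of_real a3 * exp (- of_real t3 * s) - of_real a2 * exp (- of_real t2 * s)
     - of_real a23 * exp (- of_real (t2 + t3) * s)
     - (LINT \<nu>:{0..t2+t3}|lborel. of_real (N \<nu>) * exp (- of_real \<nu> * s))"

definition F1 :: "real \<Rightarrow> real \<Rightarrow> rfun \<Rightarrow> complex \<Rightarrow> complex" where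
  "F1 b D M s = of_real b * exp (- of_real D * s)
     + (LINT \<nu>:{0..D}|lborel. of_real (M \<nu>) * exp (- of_real \<nu> * s))"

end

theory Submission
  imports Defs "HOL-Computational_Algebra.Fundamental_Theorem_Algebra"
begin

text \<open>Concatenating \<open>(g, f)\<close> to one function on \<open>[0, D + t)\<close>, \<open>t = t2 + t3\<close>, turns the operator into
  \<open>(g, f) \<mapsto> g * \<mu>0 + f * \<mu>1\<close>, where \<open>\<mu>0\<close>, \<open>\<mu>1\<close> are the measures with Laplace transforms \<open>F0\<close>, \<open>F1\<close>.
  Its delay part \<open>A\<close> is invertible because the shifts are nilpotent on a bounded interval, and its
  integral part \<open>K\<close> maps \<open>L1\<close> into bounded functions with a uniform modulus of continuity.
  Hence \<open>A\<inverse> K\<close> is, on bounded functions with the sup norm, a strict contraction plus a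
  finite-rank operator, and injectivity implies bijectivity with a bounded inverse.

  For injectivity let \<open>g * \<mu>0 + f * \<mu>1 = 0\<close>. Since \<open>F0 0\<close> and \<open>F1 0\<close> do not both vanish, there is \<open>c\<close> such that
  the transforms of \<open>g - c \<mu>1\<close> and \<open>f + c \<mu>0\<close> vanish at 0; the primitives of these measures are again
  supported in the right intervals and again lie in the kernel. This defines a linear operator \<open>R\<close> on the
  finite-dimensional kernel. An eigenvector of \<open>R\<close> with eigenvalue \<open>l \<noteq> 0\<close> satisfies
  \<open>c F0 (1/l) = c F1 (1/l) = 0\<close>, so \<open>c = 0\<close> and it solves a homogeneous Volterra equation; for \<open>l = 0\<close> evaluation
  at 0 gives \<open>c = 0\<close>. So \<open>R\<close> has no eigenvector and the kernel is trivial.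

  The passage to \<open>L2\<close> uses \<open>u = A\<inverse> y + z\<close> with \<open>z\<close> bounded, so completeness of \<open>L2\<close> is never needed.\<close>

section \<open>Convolution on the real line\<close>

text \<open>Complex values are needed because the kernel argument looks for an eigenvalue; for real
  data the real part of a complex solution is again a solution. The correction by \<open>c\<close>
  preserves the equation because convolution commutes: the pair (-\<mu>1, \<mu>0) solves it
  formally. That pair has atoms, but its primitives are bounded functions, so the kernel can be
  studied among bounded functions with pointwise equations. Finite dimension of the kernel is used
  in the form that finitely many functionals, the samples behind the finite-rank part, separate its
  elements: where they all vanish, only the strict contraction remains. Then \<open>u\<close>,
  \<open>R u\<close>, \<open>R (R u)\<close>, ... satisfy a polynomial relation, and a complex root
  of the polynomial leads to an eigenvector without choosing a basis. Smallness of the remainder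
  rests on continuity of translation in L1, which the piecewise continuity of the kernels
  supplies.\<close>

definition conv :: "(real \<Rightarrow> complex) \<Rightarrow> (real \<Rightarrow> complex) \<Rightarrow> real \<Rightarrow> complex" where
  "conv f g x = (LINT y|lborel. f y * g (x - y))"

text \<open>The bound holds at every point, so sup-norm estimates and identities between
  convolutions concern functions themselves, without exceptional null sets.\<close>

definition bdd_meas :: "(real \<Rightarrow> complex) \<Rightarrow> bool" where
  "bdd_meas f \<longleftrightarrow> f \<in> borel_measurable borel \<and> (\<exists>B. \<forall>x. norm (f x) \<le> B)"

lemma bdd_measI: "f \<in> borel_measurable borel \<Longrightarrow> (\<And>x. norm (f x) \<le> B) \<Longrightarrow> bdd_meas f"
  unfolding bdd_meas_def by blast

lemma bdd_meas_measurable [measurable_dest]: "bdd_meas f \<Longrightarrow> f \<in> borel_measurable borel"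
  by (simp add: bdd_meas_def)

lemma bdd_measE:
  assumes "bdd_meas f" obtains B where "B \<ge> 0" "\<And>x. norm (f x) \<le> B"
proof -
  from assms obtain B where "\<And>x. norm (f x) \<le> B" unfolding bdd_meas_def by blast
  moreover have "0 \<le> B" using order_trans[OF norm_ge_zero calculation[of 0]] .
  ultimately show thesis using that by blast
qed

lemma conv_commute: "conv f g = conv g f"
proof
  fix x
  show "conv f g x = conv g f x"
    unfolding conv_def
    by (subst lborel_integral_real_affine[of "-1" _ x]) (simp_all add: mult.commute)
qed

lemma integral_shift_lborel:
  fixes f :: "real \<Rightarrow> 'a::{banach,second_countable_topology}"
  shows "(LINT y|lborel. f (y - x)) = (LINT y|lborel. f y)"
  by (subst lborel_integral_real_affine[of 1 _ "x"]) simp_all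

lemma integrable_shift_lborel:
  fixes f :: "real \<Rightarrow> 'a::{banach,second_countable_topology}"
  assumes "integrable lborel f"
  shows "integrable lborel (\<lambda>y. f (y - x))"
  using lborel_integrable_real_affine[OF assms, of 1 "-x"] by simp

lemma integrable_reflect_lborel:
  fixes f :: "real \<Rightarrow> 'a::{banach,second_countable_topology}"
  assumes "integrable lborel f"
  shows "integrable lborel (\<lambda>y. f (x - y))"
  using lborel_integrable_real_affine[OF assms, of "-1" x] by simp

lemma measurable_conv [measurable]:
  assumes [measurable]: "f \<in> borel_measurable borel" "g \<in> borel_measurable borel"
  shows "conv f g \<in> borel_measurable borel"
proof -
  have "(\<lambda>x. LINT y|lborel. f y * g (x - y)) \<in> borel_measurable borel"
    by measurable
  then show ?thesis by (simp add: conv_def[abs_def])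
qed

lemma integrable_mult_bounded:
  fixes f g :: "'m \<Rightarrow> complex"
  assumes "integrable M f" "g \<in> borel_measurable M" "\<And>x. norm (g x) \<le> B"
  shows "integrable M (\<lambda>x. f x * g x)"
proof (rule Bochner_Integration.integrable_bound)
  show "integrable M (\<lambda>x. B * norm (f x))" using assms(1) by simp
  show "(\<lambda>x. f x * g x) \<in> borel_measurable M" using assms by auto
  show "AE x in M. norm (f x * g x) \<le> norm (B * norm (f x))"
  proof (rule AE_I2)
    fix x
    have "0 \<le> B" using order_trans[OF norm_ge_zero assms(3)[of x]] .
    then show "norm (f x * g x) \<le> norm (B * norm (f x))"
      using mult_right_mono[OF assms(3)[of x], of "norm (f x)"]
      by (simp add: norm_mult mult.commute)
  qed
qed

lemma conv_integrable_bdd: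
  assumes "integrable lborel f" "bdd_meas g"
  shows "integrable lborel (\<lambda>y. f y * g (x - y))"
proof -
  obtain B where B: "\<And>x. norm (g x) \<le> B" using assms(2) bdd_measE by metis
  have [measurable]: "g \<in> borel_measurable borel" using assms(2) by (simp add: bdd_meas_def)
  show ?thesis by (rule integrable_mult_bounded[OF assms(1), of _ B]) (auto simp: B)
qed

lemma integrable_conv_pair:
  fixes f g :: "real \<Rightarrow> complex"
  assumes f: "integrable lborel f" and g: "integrable lborel g"
  shows "integrable (lborel \<Otimes>\<^sub>M lborel) (\<lambda>(x, y). f x * g (y - x))"
proof (rule lborel_pair.Fubini_integrable)
  have [measurable]: "f \<in> borel_measurable borel" "g \<in> borel_measurable borel"
    using f g by (auto dest: borel_measurable_integrable)
  show "(\<lambda>(x, y). f x * g (y - x)) \<in> borel_measurable (lborel \<Otimes>\<^sub>M lborel)" by measurable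
  show "integrable lborel (\<lambda>x. LINT y|lborel. norm (case (x, y) of (x, y) \<Rightarrow> f x * g (y - x)))"
    using f by (simp add: norm_mult integral_shift_lborel[of "\<lambda>y. norm (g y)"])
  show "AE x in lborel. integrable lborel (\<lambda>y. case (x, y) of (x, y) \<Rightarrow> f x * g (y - x))"
    using integrable_shift_lborel[OF g] by simp
qed

lemma integrable_conv:
  assumes f: "integrable lborel f" and g: "integrable lborel g"
  shows "integrable lborel (conv f g)"
  using lborel_pair.integrable_snd[OF integrable_conv_pair[OF assms]]
  by (simp add: conv_def[abs_def])

text \<open>Fubini for the triple product. The last factor is bounded instead of integrable because
  it will be the Heaviside function, which lets primitives move through convolutions.\<close>

lemma conv_assoc:
  assumes f: "integrable lborel f" and g: "integrable lborel g" and l: "bdd_meas l"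
  shows "conv (conv f g) l = conv f (conv g l)"
proof
  fix x
  obtain B where B: "\<And>x. norm (l x) \<le> B" using l bdd_measE by metis
  have [measurable]: "f \<in> borel_measurable borel" "g \<in> borel_measurable borel" "l \<in> borel_measurable borel"
    using f g l by (auto dest: borel_measurable_integrable simp: bdd_meas_def)
  have *: "integrable (lborel \<Otimes>\<^sub>M lborel) (\<lambda>(z, y). f z * g (y - z) * l (x - y))"
  proof -
    have "integrable (lborel \<Otimes>\<^sub>M lborel) (\<lambda>p. (case p of (z, y) \<Rightarrow> f z * g (y - z)) * l (x - snd p))"
      by (rule integrable_mult_bounded[OF integrable_conv_pair[OF f g], of _ B]) (auto simp: B)
    then show ?thesis by (simp add: case_prod_beta')
  qed
  have "conv (conv f g) l x = (LINT y|lborel. LINT z|lborel. f z * g (y - z) * l (x - y))"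
    by (simp add: conv_def)
  also have "\<dots> = (LINT z|lborel. LINT y|lborel. f z * g (y - z) * l (x - y))"
    by (rule lborel_pair.Fubini_integral[OF *])
  also have "\<dots> = (LINT z|lborel. f z * (LINT y|lborel. g (y - z) * l (x - y)))"
    by (simp add: mult.assoc)
  also have "\<dots> = (LINT z|lborel. f z * (LINT y|lborel. g y * l (x - z - y)))"
  proof -
    have "(LINT y|lborel. g (y - z) * l (x - y)) = (LINT y|lborel. g y * l (x - z - y))" for z
      using integral_shift_lborel[of "\<lambda>y. g y * l (x - z - y)" z] by (simp add: algebra_simps)
    then show ?thesis by simp
  qed
  finally show "conv (conv f g) l x = conv f (conv g l) x" by (simp add: conv_def)
qed

lemma conv_bound:
  assumes f: "integrable lborel f" and g: "bdd_meas g" and B: "\<And>x. norm (g x) \<le> B"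
  shows "norm (conv f g x) \<le> (LINT y|lborel. norm (f y)) * B"
proof -
  have "norm (conv f g x) \<le> (LINT y|lborel. norm (f y * g (x - y)))"
    unfolding conv_def by (rule integral_norm_bound)
  also have "\<dots> \<le> (LINT y|lborel. norm (f y) * B)"
    using integrable_norm[OF conv_integrable_bdd[OF f g]] f
    by (intro integral_mono) (auto simp: norm_mult B intro!: mult_left_mono)
  finally show ?thesis by simp
qed

lemma bdd_meas_conv:
  assumes f: "integrable lborel f" and g: "bdd_meas g"
  shows "bdd_meas (conv f g)"
proof -
  obtain B where B: "\<And>x. norm (g x) \<le> B" using g bdd_measE by metis
  show ?thesis
    using conv_bound[OF f g B] f g
    by (intro bdd_measI[of _ "(LINT y|lborel. norm (f y)) * B"])
       (auto dest: borel_measurable_integrable bdd_meas_measurable)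
qed

lemma conv_shift: "conv f (\<lambda>y. g (y - d)) x = conv f g (x - d)"
  by (simp add: conv_def algebra_simps)

lemma conv_shift_left: "conv (\<lambda>y. g (y - d)) f x = conv g f (x - d)"
  by (subst (1 2) conv_commute) (rule conv_shift)

lemma conv_add:
  assumes "integrable lborel f" "bdd_meas g" "bdd_meas h"
  shows "conv f (\<lambda>y. g y + h y) x = conv f g x + conv f h x"
  unfolding conv_def
  using conv_integrable_bdd[OF assms(1,2)] conv_integrable_bdd[OF assms(1,3)]
  by (simp add: distrib_left)

lemma conv_diff:
  assumes "integrable lborel f" "bdd_meas g" "bdd_meas h"
  shows "conv f (\<lambda>y. g y - h y) x = conv f g x - conv f h x"
  unfolding conv_def
  using conv_integrable_bdd[OF assms(1,2)] conv_integrable_bdd[OF assms(1,3)]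
  by (simp add: right_diff_distrib)

lemma conv_scale: "conv f (\<lambda>y. c * g y) x = c * conv f g x"
  unfolding conv_def by (simp flip: integral_mult_right_zero add: mult.left_commute)

lemma conv_scale_left: "conv (\<lambda>y. c * f y) g x = c * conv f g x"
  unfolding conv_def by (simp flip: integral_mult_right_zero add: mult.assoc)

lemma bdd_meas_add:
  assumes "bdd_meas f" "bdd_meas g" shows "bdd_meas (\<lambda>x. f x + g x)"
proof -
  obtain B C where "\<And>x. norm (f x) \<le> B" "\<And>x. norm (g x) \<le> C" using assms bdd_measE by metis
  then show ?thesis using assms
    by (intro bdd_measI[of _ "B + C"]) (auto intro: norm_triangle_mono dest: bdd_meas_measurable)
qed

lemma bdd_meas_scale:
  assumes "bdd_meas f" shows "bdd_meas (\<lambda>x. c * f x)"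
proof -
  obtain B where "\<And>x. norm (f x) \<le> B" using assms bdd_measE by metis
  then show ?thesis using assms
    by (intro bdd_measI[of _ "norm c * B"]) (auto simp: norm_mult intro: mult_left_mono dest: bdd_meas_measurable)
qed

lemma bdd_meas_diff:
  assumes "bdd_meas f" "bdd_meas g" shows "bdd_meas (\<lambda>x. f x - g x)"
  using bdd_meas_add[OF assms(1) bdd_meas_scale[OF assms(2), of "-1"]] by simp

lemma bdd_meas_shift:
  assumes "bdd_meas f" shows "bdd_meas (\<lambda>x. f (x - d))"
proof -
  obtain B where "\<And>x. norm (f x) \<le> B" using assms bdd_measE by metis
  moreover have [measurable]: "f \<in> borel_measurable borel" using assms by (rule bdd_meas_measurable)
  ultimately show ?thesis by (intro bdd_measI[of _ B]) auto
qed

lemma bdd_meas_sum: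
  assumes "\<And>i. i \<in> A \<Longrightarrow> bdd_meas (f i)" shows "bdd_meas (\<lambda>x. \<Sum>i\<in>A. f i x)"
proof (cases "finite A")
  case True
  then show ?thesis using assms
    by (induction A) (auto intro: bdd_meas_add bdd_measI[of "\<lambda>_. 0" 0])
qed (auto intro: bdd_measI[of "\<lambda>_. 0" 0])

lemma integrable_compact_support:
  assumes f: "bdd_meas f" and supp: "\<And>x. x \<notin> {a..b} \<Longrightarrow> f x = 0"
  shows "integrable lborel f"
proof -
  obtain B where B: "\<And>x. norm (f x) \<le> B" using f bdd_measE by metis
  have "integrable lborel (\<lambda>x. complex_of_real (indicator {a..b} x))"
    by (intro integrable_of_real) (simp add: integrable_indicator_iff emeasure_lborel_Icc_eq)
  then have 1: "integrable lborel (indicator {a..b} :: real \<Rightarrow> complex)"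
    by (simp add: of_real_indicator)
  have "integrable lborel (\<lambda>x. indicator {a..b} x * f x)"
    by (rule integrable_mult_bounded[OF 1, of _ B]) (use f B in \<open>auto dest: bdd_meas_measurable\<close>)
  moreover have "(\<lambda>x. indicator {a..b} x * f x) = f"
    using supp by (force simp: indicator_def)
  ultimately show ?thesis by simp
qed

section \<open>Finite-rank perturbations of contractions\<close>

text \<open>Gaussian elimination on the last coordinate, with \<open>v k0\<close> as pivot. The
  index set is an arbitrary finite set, so the pivot can be removed without renumbering.\<close>

lemma nontrivial_relation:
  fixes v :: "'k \<Rightarrow> nat \<Rightarrow> 'f::field"
  assumes "finite A" "card A > n"
  shows "\<exists>p. (\<exists>k\<in>A. p k \<noteq> 0) \<and> (\<forall>i<n. (\<Sum>k\<in>A. p k * v k i) = 0)"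
  using assms
proof (induction n arbitrary: A v)
  case 0
  then obtain k where "k \<in> A" by fastforce
  then show ?case by (intro exI[of _ "\<lambda>_. 1"]) auto
next
  case (Suc n)
  show ?case
  proof (cases "\<exists>k\<in>A. v k n \<noteq> 0")
    case False
    obtain p where "\<exists>k\<in>A. p k \<noteq> 0" "\<forall>i<n. (\<Sum>k\<in>A. p k * v k i) = 0"
      using Suc.IH[of A v] Suc.prems by auto
    moreover have "(\<Sum>k\<in>A. p k * v k n) = 0" using False by simp
    ultimately show ?thesis by (intro exI[of _ p]) (auto simp: less_Suc_eq)
  next
    case True
    then obtain k0 where k0: "k0 \<in> A" "v k0 n \<noteq> 0" by blast
    let ?B = "A - {k0}" and ?w = "\<lambda>k i. v k i - v k n / v k0 n * v k0 i"
    have "card ?B > n" "finite ?B" using Suc.prems k0 by auto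
    from Suc.IH[OF this(2,1), of ?w] obtain p where
      p: "\<exists>k\<in>?B. p k \<noteq> 0" "\<And>i. i < n \<Longrightarrow> (\<Sum>k\<in>?B. p k * ?w k i) = 0" by blast
    \<comment> \<open>The pivot takes over the multiples of \<open>v k0\<close> that were subtracted
      from the other vectors.\<close>
    define s where "s = (\<Sum>k\<in>?B. p k * (v k n / v k0 n))"
    define q where "q = p(k0 := - s)"
    have sum: "(\<Sum>k\<in>A. q k * v k i) = (\<Sum>k\<in>?B. p k * ?w k i)" for i
    proof -
      have "(\<Sum>k\<in>A. q k * v k i) = q k0 * v k0 i + (\<Sum>k\<in>?B. q k * v k i)"
        using Suc.prems k0 by (intro sum.remove) auto
      also have "(\<Sum>k\<in>?B. q k * v k i) = (\<Sum>k\<in>?B. p k * v k i)"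
        by (intro sum.cong) (auto simp: q_def)
      also have "q k0 * v k0 i = - (\<Sum>k\<in>?B. p k * (v k n / v k0 n * v k0 i))"
        by (simp add: q_def s_def sum_distrib_right mult.assoc)
      finally show ?thesis by (simp add: sum_subtractf right_diff_distrib)
    qed
    have "(\<Sum>k\<in>A. q k * v k n) = 0" unfolding sum using k0 by simp
    moreover have "(\<Sum>k\<in>A. q k * v k i) = 0" if "i < n" for i unfolding sum using p that by blast
    moreover have "\<exists>k\<in>A. q k \<noteq> 0" using p(1) by (auto simp: q_def)
    ultimately show ?thesis by (intro exI[of _ q]) (auto simp: less_Suc_eq)
  qed
qed

text \<open>The \<open>n\<close> columns and the \<open>k\<close>-th unit vector are
  \<open>n + 1\<close> vectors with \<open>n\<close> coordinates, hence dependent. Injectivity keeps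
  the coefficient of the unit vector from vanishing, and dividing by it gives the
  \<open>k\<close>-th column of the inverse.\<close>

lemma injective_matrix_right_inverse:
  fixes m :: "nat \<Rightarrow> nat \<Rightarrow> 'f::field"
  assumes inj: "\<And>c. (\<And>i. i < n \<Longrightarrow> (\<Sum>j<n. m i j * c j) = 0) \<Longrightarrow> (\<And>j. j < n \<Longrightarrow> c j = 0)"
  shows "\<exists>W. \<forall>d. \<forall>i<n. (\<Sum>j<n. m i j * (\<Sum>k<n. W j k * d k)) = d i"
proof -
  have "\<exists>w. \<forall>i<n. (\<Sum>j<n. m i j * w j) = (if i = k then 1 else 0)" if "k < n" for k
  proof -
    define v where "v j i = (if j < n then m i j else if i = k then 1 else 0)" for j i
    from nontrivial_relation[of "{..n}" n v] obtain p where
      p: "\<exists>k\<in>{..n}. p k \<noteq> 0" "\<And>i. i < n \<Longrightarrow> (\<Sum>j\<le>n. p j * v j i) = 0" by auto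
    have eq: "(\<Sum>j<n. m i j * p j) + p n * (if i = k then 1 else 0) = 0" if "i < n" for i
      using p(2)[OF that] by (simp add: lessThan_Suc_atMost[symmetric] v_def mult.commute)
    have "p n \<noteq> 0"
    proof
      assume "p n = 0"
      have "p j = 0" if "j < n" for j
        by (rule inj[OF _ that]) (use eq \<open>p n = 0\<close> in simp)
      with p(1) \<open>p n = 0\<close> show False by (auto simp: le_less)
    qed
    have "(\<Sum>j<n. m i j * (- p j / p n)) = (if i = k then 1 else 0)" if "i < n" for i
    proof -
      have "(\<Sum>j<n. m i j * (- p j / p n)) = - (\<Sum>j<n. m i j * p j) / p n"
        by (simp add: sum_divide_distrib sum_negf)
      moreover have "(\<Sum>j<n. m i j * p j) = - (p n * (if i = k then 1 else 0))"
        using eq[OF that] by (simp add: eq_neg_iff_add_eq_0)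
      ultimately show ?thesis using \<open>p n \<noteq> 0\<close> by simp
    qed
    then show ?thesis by (intro exI[of _ "\<lambda>j. - p j / p n"]) blast
  qed
  then obtain W where W: "\<And>k i. k < n \<Longrightarrow> i < n \<Longrightarrow> (\<Sum>j<n. m i j * W k j) = (if i = k then 1 else 0)"
    by metis
  show ?thesis
  proof (intro exI[of _ "\<lambda>j k. W k j"] allI impI)
    fix d :: "nat \<Rightarrow> 'f" and i assume i: "i < n"
    have "(\<Sum>j<n. m i j * (\<Sum>k<n. W k j * d k)) = (\<Sum>j<n. \<Sum>k<n. m i j * W k j * d k)"
      by (simp add: sum_distrib_left mult.assoc)
    also have "\<dots> = (\<Sum>k<n. \<Sum>j<n. m i j * W k j * d k)" by (rule sum.swap)
    also have "\<dots> = (\<Sum>k<n. (if i = k then 1 else 0) * d k)"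
      by (intro sum.cong refl) (simp add: W i flip: sum_distrib_right)
    also have "\<dots> = (\<Sum>k<n. if i = k then d k else 0)" by (intro sum.cong) auto
    also have "\<dots> = d i" using i by simp
    finally show "(\<Sum>j<n. m i j * (\<Sum>k<n. W k j * d k)) = d i" .
  qed
qed

definition bdd_on :: "real set \<Rightarrow> (real \<Rightarrow> complex) set" where
  "bdd_on Z = {u. bdd_meas u \<and> (\<forall>x. x \<notin> Z \<longrightarrow> u x = 0)}"

lemma bdd_on_lincomb: "u \<in> bdd_on Z \<Longrightarrow> v \<in> bdd_on Z \<Longrightarrow> (\<lambda>x. a * u x + v x) \<in> bdd_on Z"
  by (auto simp: bdd_on_def intro: bdd_meas_add bdd_meas_scale)

lemma bdd_on_add: "u \<in> bdd_on Z \<Longrightarrow> v \<in> bdd_on Z \<Longrightarrow> (\<lambda>x. u x + v x) \<in> bdd_on Z"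
  by (auto simp: bdd_on_def intro: bdd_meas_add)

lemma bdd_on_diff: "u \<in> bdd_on Z \<Longrightarrow> v \<in> bdd_on Z \<Longrightarrow> (\<lambda>x. u x - v x) \<in> bdd_on Z"
  by (auto simp: bdd_on_def intro: bdd_meas_diff)

lemma bdd_on_scale: "u \<in> bdd_on Z \<Longrightarrow> (\<lambda>x. a * u x) \<in> bdd_on Z"
  by (auto simp: bdd_on_def intro: bdd_meas_scale)

lemma bdd_on_zero: "(\<lambda>_. 0) \<in> bdd_on Z"
  by (auto simp: bdd_on_def intro: bdd_measI[of _ 0])

lemma bdd_on_sum: "(\<And>i. i \<in> A \<Longrightarrow> f i \<in> bdd_on Z) \<Longrightarrow> (\<lambda>x. \<Sum>i\<in>A. f i x) \<in> bdd_on Z"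
  by (auto simp: bdd_on_def intro: bdd_meas_sum)

text \<open>Iteration of \<open>u \<mapsto> w - S u\<close>. The limit is a pointwise telescoping
  series with geometric majorant, and pointwise limits preserve measurability and support.\<close>

lemma neumann_series:
  assumes S: "\<And>u. u \<in> bdd_on Z \<Longrightarrow> S u \<in> bdd_on Z"
    and S_diff: "\<And>u v x. u \<in> bdd_on Z \<Longrightarrow> v \<in> bdd_on Z \<Longrightarrow> S (\<lambda>x. u x - v x) x = S u x - S v x"
    and half: "\<And>u c. u \<in> bdd_on Z \<Longrightarrow> (\<And>x. norm (u x) \<le> c) \<Longrightarrow> (\<And>x. norm (S u x) \<le> c / 2)"
    and w: "w \<in> bdd_on Z" and c: "\<And>x. norm (w x) \<le> c"
  shows "\<exists>u\<in>bdd_on Z. (\<forall>x. u x + S u x = w x) \<and> (\<forall>x. norm (u x) \<le> 2 * c)"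
proof -
  define X where "X = rec_nat w (\<lambda>_ u x. w x - S u x)"
  have X0: "X 0 = w" and XS: "X (Suc k) = (\<lambda>x. w x - S (X k) x)" for k by (simp_all add: X_def)
  have Xin: "X k \<in> bdd_on Z" for k
    by (induction k) (auto simp: X0 XS w intro: bdd_on_diff S)
  define d where "d k x = X (Suc k) x - X k x" for k x
  have din: "d k \<in> bdd_on Z" for k
    using bdd_on_diff[OF Xin[of "Suc k"] Xin[of k]] by (simp add: d_def[abs_def])
  have dS: "d (Suc k) x = - S (d k) x" for k x
    using S_diff[OF Xin[of "Suc k"] Xin[of k], of x] by (simp add: d_def[abs_def] XS)
  have d: "norm (d k x) \<le> c * (1/2) ^ Suc k" for k x
  proof (induction k arbitrary: x)
    case 0
    show ?case using half[OF w c, of x] by (simp add: d_def X0 XS)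
  next
    case (Suc k)
    show ?case using half[OF din Suc, of x] by (simp add: dS)
  qed
  have geo: "(\<lambda>k. c * (1/2) ^ Suc k) sums c"
    using sums_mult[OF power_half_series, of c] by simp
  have summ: "summable (\<lambda>k. d k x)" for x
    using d by (intro summable_comparison_test'[OF sums_summable[OF geo]]) auto
  define u where "u x = w x + (\<Sum>k. d k x)" for x
  have part: "X k x = w x + (\<Sum>i<k. d i x)" for k x
    by (induction k) (auto simp: X0 d_def)
  have tail: "norm (u x - X k x) \<le> c * (1/2) ^ k" for k x
  proof -
    have "u x - X k x = (\<Sum>i. d (i + k) x)"
      using suminf_split_initial_segment[OF summ, of x k] by (simp add: u_def part)
    also have "norm \<dots> \<le> (\<Sum>i. c * (1/2) ^ Suc i * (1/2) ^ k)"
    proof (rule norm_suminf_le)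
      show "norm (d (i + k) x) \<le> c * (1/2) ^ Suc i * (1/2) ^ k" for i
        using d[of "i + k" x] by (simp add: power_add)
      show "summable (\<lambda>i. c * (1/2) ^ Suc i * (1/2) ^ k)"
        by (intro summable_mult2 sums_summable[OF geo])
    qed
    also have "\<dots> = c * (1/2) ^ k"
      using sums_unique[OF sums_mult2[OF geo, of "(1/2)^k"]] by simp
    finally show ?thesis .
  qed
  have bound: "norm (u x) \<le> 2 * c" for x
    using norm_triangle_ineq[of "u x - X 0 x" "X 0 x"] tail[of x 0] c[of x] by (simp add: X0)
  have lim: "(\<lambda>k. X k x) \<longlonglongrightarrow> u x" for x
    unfolding part u_def using summable_LIMSEQ[OF summ] by (intro tendsto_intros)
  have "u \<in> borel_measurable borel"
    by (rule borel_measurable_LIMSEQ_metric[OF _ lim]) (use Xin in \<open>auto simp: bdd_on_def bdd_meas_def\<close>)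
  moreover have "u x = 0" if "x \<notin> Z" for x
  proof -
    have "X k x = 0" for k using Xin[of k] that by (auto simp: bdd_on_def)
    with lim[of x] have "(\<lambda>k. 0) \<longlonglongrightarrow> u x" by simp
    then show ?thesis by (simp add: LIMSEQ_const_iff)
  qed
  ultimately have uin: "u \<in> bdd_on Z" using bound by (auto simp: bdd_on_def intro: bdd_measI)
  have "u x + S u x = w x" for x
  proof -
    have "norm (u x + S u x - w x) \<le> c * (1/2) ^ k" for k
    proof -
      have "S (\<lambda>x. u x - X k x) x = S u x - S (X k) x" by (rule S_diff[OF uin Xin])
      \<comment> \<open>Since \<open>X (Suc k) = w - S (X k)\<close>, the residual is a sum of two
        approximation errors, each at most half of \<open>c * (1/2) ^ k\<close>.\<close>
      then have "u x + S u x - w x = (u x - X (Suc k) x) + S (\<lambda>x. u x - X k x) x"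
        by (simp add: XS)
      also have "norm \<dots> \<le> c * (1/2) ^ Suc k + c * (1/2) ^ k / 2"
        by (intro norm_triangle_mono tail half[OF bdd_on_diff[OF uin Xin]])
      finally show ?thesis by simp
    qed
    moreover have "(\<lambda>k. c * (1/2) ^ k) \<longlonglongrightarrow> c * 0"
      by (intro tendsto_intros) auto
    ultimately have "norm (u x + S u x - w x) \<le> 0"
      by (intro LIMSEQ_le_const[of "\<lambda>k. c * (1/2) ^ k"]) auto
    then show ?thesis by simp
  qed
  then show ?thesis using uin bound by blast
qed

lemma linear_on_sum:
  assumes lin: "\<And>a u v. u \<in> bdd_on Z \<Longrightarrow> v \<in> bdd_on Z \<Longrightarrow> F (\<lambda>x. a * u x + v x) = a * F u + F v"
    and f: "\<And>i. i \<in> A \<Longrightarrow> f i \<in> bdd_on Z" and "finite A"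
  shows "F (\<lambda>x. \<Sum>i\<in>A. c i * f i x) = (\<Sum>i\<in>A. c i * (F (f i) :: complex))"
  using assms(3) f
proof (induction A)
  case empty
  show ?case using lin[OF bdd_on_zero bdd_on_zero, of 1] by simp
next
  case (insert a A)
  have "(\<lambda>x. \<Sum>i\<in>A. c i * f i x) \<in> bdd_on Z" using insert by (intro bdd_on_sum bdd_on_scale) auto
  from lin[of "f a", OF _ this, of "c a"] insert show ?case by simp
qed

text \<open>Inverting the contraction part turns the equation into an \<open>n\<close> by
  \<open>n\<close> linear system for the values \<open>\<phi> j u\<close>. Injectivity of the
  operator gives injectivity of the matrix, and its right inverse yields solutions with an explicit
  bound.\<close>

lemma fredholm_alternative:
  fixes \<phi> :: "nat \<Rightarrow> (real \<Rightarrow> complex) \<Rightarrow> complex" and n :: nat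
  assumes S: "\<And>u. u \<in> bdd_on Z \<Longrightarrow> S u \<in> bdd_on Z"
    and S_lin: "\<And>a u v x. u \<in> bdd_on Z \<Longrightarrow> v \<in> bdd_on Z \<Longrightarrow> S (\<lambda>x. a * u x + v x) x = a * S u x + S v x"
    and half: "\<And>u c. u \<in> bdd_on Z \<Longrightarrow> (\<And>x. norm (u x) \<le> c) \<Longrightarrow> (\<And>x. norm (S u x) \<le> c / 2)"
    and \<phi>_lin: "\<And>a u v i. u \<in> bdd_on Z \<Longrightarrow> v \<in> bdd_on Z \<Longrightarrow> \<phi> i (\<lambda>x. a * u x + v x) = a * \<phi> i u + \<phi> i v"
    and \<phi>_bdd: "\<And>u c i. u \<in> bdd_on Z \<Longrightarrow> (\<And>x. norm (u x) \<le> c) \<Longrightarrow> norm (\<phi> i u) \<le> C i * c"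
    and h: "\<And>i. h i \<in> bdd_on Z"
    and inj: "\<And>u. u \<in> bdd_on Z \<Longrightarrow> (\<And>x. u x + S u x + (\<Sum>j<n. \<phi> j u * h j x) = 0) \<Longrightarrow> u = (\<lambda>_. 0)"
  shows "\<exists>C'. \<forall>w\<in>bdd_on Z. \<forall>c. (\<forall>x. norm (w x) \<le> c) \<longrightarrow>
    (\<exists>u\<in>bdd_on Z. (\<forall>x. u x + S u x + (\<Sum>j<n. \<phi> j u * h j x) = w x) \<and> (\<forall>x. norm (u x) \<le> C' * c))"
proof -
  have S_diff: "S (\<lambda>x. u x - v x) x = S u x - S v x" if "u \<in> bdd_on Z" "v \<in> bdd_on Z" for u v x
    using S_lin[OF that(2,1), of "-1" x] by simp
  have \<phi>_diff: "\<phi> i (\<lambda>x. u x - v x) = \<phi> i u - \<phi> i v" if "u \<in> bdd_on Z" "v \<in> bdd_on Z" for u v i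
    using \<phi>_lin[OF that(2,1), of i "-1"] by simp
  have neumann: "\<exists>u\<in>bdd_on Z. (\<forall>x. u x + S u x = w x) \<and> (\<forall>x. norm (u x) \<le> 2 * c)"
    if "w \<in> bdd_on Z" "\<And>x. norm (w x) \<le> c" for w c
    using neumann_series[of Z S w c] S S_diff half that by blast
  have "\<exists>e\<in>bdd_on Z. \<forall>x. e x + S e x = h j x" for j
  proof -
    obtain B where B: "\<And>x. norm (h j x) \<le> B" using h[of j] by (auto simp: bdd_on_def bdd_meas_def)
    show ?thesis using neumann[OF h B] by blast
  qed
  then obtain e where e: "\<And>j. e j \<in> bdd_on Z" "\<And>j x. e j x + S (e j) x = h j x" by metis
  have "\<exists>E. \<forall>x. norm (e j x) \<le> E" for j using e(1)[of j] by (auto simp: bdd_on_def bdd_meas_def)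
  then obtain E where E: "\<And>j x. norm (e j x) \<le> E j" by metis
  have comb: "(\<lambda>x. \<Sum>j<n. c j * e j x) \<in> bdd_on Z" for c
    by (intro bdd_on_sum bdd_on_scale e)
  have S_comb: "S (\<lambda>x. \<Sum>j<n. c j * e j x) x = (\<Sum>j<n. c j * S (e j) x)" for c x
    by (rule linear_on_sum[where F="\<lambda>u. S u x" and Z=Z]) (auto simp: S_lin e)
  have \<phi>_comb: "\<phi> i (\<lambda>x. \<Sum>j<n. c j * e j x) = (\<Sum>j<n. c j * \<phi> i (e j))" for c i
    by (rule linear_on_sum[where F="\<phi> i" and Z=Z]) (auto simp: \<phi>_lin e)
  \<comment> \<open>For \<open>u = w' - (\<Sum>j<n. c j * e j)\<close> the consistency requirement
    \<open>\<phi> i u = c i\<close> is the system with this matrix and right-hand side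
    \<open>\<phi> i w'\<close>.\<close>
  define m where "m i j = (if i = j then 1 else 0) + \<phi> i (e j)" for i j
  have m_sum: "(\<Sum>j<n. m i j * c j) = c i + (\<Sum>j<n. c j * \<phi> i (e j))" if "i < n" for i c
  proof -
    have "(\<Sum>j<n. m i j * c j) = (\<Sum>j<n. (if i = j then c j else 0) + c j * \<phi> i (e j))"
      by (intro sum.cong) (auto simp: m_def algebra_simps)
    then show ?thesis using that by (simp add: sum.distrib)
  qed
  have solve: "(\<lambda>x. w' x - (\<Sum>j<n. c j * e j x)) \<in> bdd_on Z"
      "\<And>i. i < n \<Longrightarrow> \<phi> i (\<lambda>x. w' x - (\<Sum>j<n. c j * e j x)) = c i"
      "\<And>x. (w' x - (\<Sum>j<n. c j * e j x)) + S (\<lambda>x. w' x - (\<Sum>j<n. c j * e j x)) x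
          + (\<Sum>j<n. \<phi> j (\<lambda>x. w' x - (\<Sum>j<n. c j * e j x)) * h j x) = w' x + S w' x"
    if w': "w' \<in> bdd_on Z" and c: "\<And>i. i < n \<Longrightarrow> (\<Sum>j<n. m i j * c j) = \<phi> i w'" for w' c
  proof -
    show "(\<lambda>x. w' x - (\<Sum>j<n. c j * e j x)) \<in> bdd_on Z" by (intro bdd_on_diff w' comb)
    show *: "\<phi> i (\<lambda>x. w' x - (\<Sum>j<n. c j * e j x)) = c i" if "i < n" for i
      using c[OF that] that by (simp add: \<phi>_diff[OF w' comb] \<phi>_comb m_sum flip: eq_diff_eq)
    fix x
    have "(\<Sum>j<n. \<phi> j (\<lambda>x. w' x - (\<Sum>j<n. c j * e j x)) * h j x)
        = (\<Sum>j<n. c j * h j x)"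
      by (intro sum.cong refl) (simp add: *)
    also have "\<dots> = (\<Sum>j<n. c j * e j x) + (\<Sum>j<n. c j * S (e j) x)"
      unfolding e(2)[symmetric] by (simp add: sum.distrib distrib_left)
    finally have "(\<Sum>j<n. \<phi> j (\<lambda>x. w' x - (\<Sum>j<n. c j * e j x)) * h j x)
        = (\<Sum>j<n. c j * e j x) + (\<Sum>j<n. c j * S (e j) x)" .
    then show "(w' x - (\<Sum>j<n. c j * e j x)) + S (\<lambda>x. w' x - (\<Sum>j<n. c j * e j x)) x
          + (\<Sum>j<n. \<phi> j (\<lambda>x. w' x - (\<Sum>j<n. c j * e j x)) * h j x) = w' x + S w' x"
      by (simp add: S_diff[OF w' comb] S_comb)
  qed
  have zero: "\<phi> i (\<lambda>_. 0) = 0" "S (\<lambda>_. 0) x = 0" for i x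
    using \<phi>_diff[OF bdd_on_zero bdd_on_zero] S_diff[OF bdd_on_zero bdd_on_zero] by auto
  \<comment> \<open>A kernel vector of \<open>m\<close> produces a solution of the homogeneous
    equation. That function is zero by \<open>inj\<close>, and \<open>c j\<close> is its value under
    \<open>\<phi> j\<close>.\<close>
  have "c j = 0" if ker: "\<And>i. i < n \<Longrightarrow> (\<Sum>j<n. m i j * c j) = 0" and "j < n" for c j
  proof -
    have c: "(\<Sum>j<n. m i j * c j) = \<phi> i (\<lambda>_. 0)" if "i < n" for i
      using ker[OF that] by (simp add: zero)
    have "(\<lambda>x. 0 - (\<Sum>j<n. c j * e j x)) = (\<lambda>_. 0)"
      using solve(1,3)[OF bdd_on_zero c] by (intro inj) (auto simp: zero)
    then show "c j = 0" using solve(2)[OF bdd_on_zero c \<open>j < n\<close>] zero by simp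
  qed
  then have "\<exists>W. \<forall>d. \<forall>i<n. (\<Sum>j<n. m i j * (\<Sum>k<n. W j k * d k)) = d i"
    by (rule injective_matrix_right_inverse)
  then obtain W where
    W: "\<And>d i. i < n \<Longrightarrow> (\<Sum>j<n. m i j * (\<Sum>k<n. W j k * d k)) = d i" by blast
  \<comment> \<open>The summand 2 bounds \<open>w'\<close>; the sum bounds the correction by the
    \<open>e j\<close>, with \<open>C k * 2\<close> because \<open>w'\<close> is at most
    \<open>2 * c\<close>.\<close>
  define C' where "C' = 2 + (\<Sum>j<n. (\<Sum>k<n. norm (W j k) * (C k * 2)) * E j)"
  show ?thesis
  proof (intro exI[of _ C'] ballI allI impI)
    fix w c assume w: "w \<in> bdd_on Z" and c: "\<forall>x. norm (w x) \<le> c"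
    from neumann[OF w] c obtain w' where
      w': "w' \<in> bdd_on Z" "\<And>x. w' x + S w' x = w x" "\<And>x. norm (w' x) \<le> 2 * c" by blast
    define d where "d j = (\<Sum>k<n. W j k * \<phi> k w')" for j
    have d: "norm (d j) \<le> (\<Sum>k<n. norm (W j k) * (C k * 2)) * c" for j
    proof -
      have "norm (d j) \<le> (\<Sum>k<n. norm (W j k) * (C k * (2 * c)))"
        unfolding d_def
        by (intro sum_norm_le) (auto simp: norm_mult intro!: mult_left_mono \<phi>_bdd w')
      then show ?thesis by (simp add: sum_distrib_right mult.assoc)
    qed
    let ?u = "\<lambda>x. w' x - (\<Sum>j<n. d j * e j x)"
    have dm: "(\<Sum>j<n. m i j * d j) = \<phi> i w'" if "i < n" for i
      using W[OF that] by (simp add: d_def)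
    note solve[OF w'(1) dm]
    moreover have "norm (?u x) \<le> C' * c" for x
    proof -
      have "norm (?u x) \<le> norm (w' x) + norm (\<Sum>j<n. d j * e j x)" by (rule norm_triangle_ineq4)
      also have "norm (\<Sum>j<n. d j * e j x) \<le> (\<Sum>j<n. ((\<Sum>k<n. norm (W j k) * (C k * 2)) * c) * E j)"
      proof (intro sum_norm_le)
        fix j
        have "norm (d j * e j x) = norm (d j) * norm (e j x)" by (rule norm_mult)
        also have "\<dots> \<le> ((\<Sum>k<n. norm (W j k) * (C k * 2)) * c) * E j"
          by (intro mult_mono d E) (auto intro: order_trans[OF norm_ge_zero d])
        finally show "norm (d j * e j x) \<le> ((\<Sum>k<n. norm (W j k) * (C k * 2)) * c) * E j" .
      qed
      also have "\<dots> = (\<Sum>j<n. (\<Sum>k<n. norm (W j k) * (C k * 2)) * E j) * c"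
        unfolding sum_distrib_right[of "\<lambda>j. (\<Sum>k<n. norm (W j k) * (C k * 2)) * E j"]
          by (intro sum.cong refl) (simp only: mult_ac)
      finally show ?thesis using w'(3)[of x] by (simp add: C'_def distrib_right)
    qed
    ultimately show "\<exists>u\<in>bdd_on Z. (\<forall>x. u x + S u x + (\<Sum>j<n. \<phi> j u * h j x) = w x) \<and> (\<forall>x. norm (u x) \<le> C' * c)"
      using w'(2) by (intro bexI[of _ ?u]) auto
  qed
qed

text \<open>The \<open>n\<close> functionals separate \<open>V\<close>, so \<open>u\<close> and its
  first \<open>n\<close> iterates under \<open>R\<close> are dependent, that is,
  \<open>q(R) u = 0\<close> for some nonzero polynomial \<open>q\<close>. Over the complex numbers
  \<open>q\<close> splits, and every factor \<open>R - l\<close> is injective if there is no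
  eigenvector.\<close>

lemma no_eigenvector_imp_trivial:
  fixes V :: "(real \<Rightarrow> complex) set" and \<phi> :: "nat \<Rightarrow> (real \<Rightarrow> complex) \<Rightarrow> complex" and n :: nat
  assumes V: "V \<subseteq> bdd_on Z" "\<And>a u v. u \<in> V \<Longrightarrow> v \<in> V \<Longrightarrow> (\<lambda>x. a * u x + v x) \<in> V"
    and R: "\<And>u. u \<in> V \<Longrightarrow> R u \<in> V"
    and R_lin: "\<And>a u v x. u \<in> V \<Longrightarrow> v \<in> V \<Longrightarrow> R (\<lambda>x. a * u x + v x) = (\<lambda>x. a * R u x + R v x)"
    and \<phi>_lin: "\<And>a u v i. u \<in> bdd_on Z \<Longrightarrow> v \<in> bdd_on Z \<Longrightarrow> \<phi> i (\<lambda>x. a * u x + v x) = a * \<phi> i u + \<phi> i v"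
    and \<phi>_inj: "\<And>u. u \<in> V \<Longrightarrow> (\<And>i. i < n \<Longrightarrow> \<phi> i u = 0) \<Longrightarrow> u = (\<lambda>_. 0)"
    and no_eig: "\<And>u l. u \<in> V \<Longrightarrow> (\<And>x. R u x = l * u x) \<Longrightarrow> u = (\<lambda>_. 0)"
    and u: "u \<in> V"
  shows "u = (\<lambda>_. 0)"
proof -
  have poly: "u = (\<lambda>_. 0)" if "u \<in> V" "q \<noteq> 0" "degree q \<le> d"
      "\<And>x. (\<Sum>k\<le>d. coeff q k * (R ^^ k) u x) = 0" for d u and q :: "complex poly"
    using that
  proof (induction d arbitrary: u q)
    case 0
    then have "coeff q 0 \<noteq> 0" by (metis bot_nat_0.extremum_uniqueI leading_coeff_0_iff)
    then show ?case using 0(4) by auto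
  next
    case (Suc d)
    have Rk: "(R ^^ k) v \<in> V" if "v \<in> V" for k v
      by (induction k) (auto simp: R that)
    show ?case
    proof (cases "degree q = 0")
      case True
      then have c0: "coeff q 0 \<noteq> 0" and cS: "\<And>k. k > 0 \<Longrightarrow> coeff q k = 0"
        using \<open>q \<noteq> 0\<close> by (metis leading_coeff_0_iff, simp add: coeff_eq_0)
      have "u x = 0" for x
      proof -
        have "(\<Sum>k\<le>Suc d. coeff q k * (R ^^ k) u x) = (\<Sum>k\<le>Suc d. if k = 0 then coeff q 0 * u x else 0)"
          by (intro sum.cong) (auto simp: cS)
        then show ?thesis using Suc.prems(4)[of x] c0 by (simp del: sum.atMost_Suc)
      qed
      then show ?thesis by blast
    next
      case False
      then obtain l where "poly q l = 0"
        using fundamental_theorem_of_algebra[of q] constant_degree[of q] by auto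
      then obtain r where r: "q = [:- l, 1:] * r" by (auto simp: poly_eq_0_iff_dvd)
      with \<open>q \<noteq> 0\<close> have r0: "r \<noteq> 0" by auto
      have deg: "degree r \<le> d" using r0 Suc.prems(3) unfolding r by (subst (asm) degree_mult_eq) auto
      \<comment> \<open>\<open>v\<close> is \<open>(R - l) u\<close>, so
        \<open>q(R) u = r(R) v\<close>. The induction hypothesis for \<open>r\<close> makes
        \<open>v\<close> vanish, which leaves \<open>R u = l u\<close>.\<close>
      define v where "v x = (- l) * u x + R u x" for x
      have vV: "v \<in> V" unfolding v_def[abs_def] by (intro V R Suc.prems)
      have Rv: "(R ^^ k) v x = - l * (R ^^ k) u x + (R ^^ Suc k) u x" for k x
      proof -
        have "(R ^^ k) v = (\<lambda>x. - l * (R ^^ k) u x + (R ^^ Suc k) u x)"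
        proof (induction k)
          case 0 show ?case by (simp add: v_def[abs_def])
        next
          case (Suc k)
          show ?case using R_lin[OF Rk[OF \<open>u \<in> V\<close>, of k] Rk[OF \<open>u \<in> V\<close>, of "Suc k"], of "-l"] Suc
            by simp
        qed
        then show ?thesis by simp
      qed
      have cq: "coeff q k = - l * coeff r k + (case k of 0 \<Rightarrow> 0 | Suc j \<Rightarrow> coeff r j)" for k
        unfolding r by (cases k) (auto simp: coeff_pCons)
      have "(\<Sum>k\<le>d. coeff r k * (R ^^ k) v x) = 0" for x
      proof -
        have "(\<Sum>k\<le>d. coeff r k * (R ^^ k) v x)
            = (\<Sum>k\<le>d. - l * coeff r k * (R ^^ k) u x) + (\<Sum>k\<le>d. coeff r k * (R ^^ Suc k) u x)"
          unfolding Rv sum.distrib[symmetric] by (intro sum.cong) (auto simp: algebra_simps)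
        also have "(\<Sum>k\<le>d. - l * coeff r k * (R ^^ k) u x) = (\<Sum>k\<le>Suc d. - l * coeff r k * (R ^^ k) u x)"
          using deg by (simp add: coeff_eq_0)
        also have "(\<Sum>k\<le>d. coeff r k * (R ^^ Suc k) u x)
            = (\<Sum>k\<le>Suc d. (case k of 0 \<Rightarrow> 0 | Suc j \<Rightarrow> coeff r j) * (R ^^ k) u x)"
          unfolding sum.atMost_Suc_shift by simp
        also have "(\<Sum>k\<le>Suc d. - l * coeff r k * (R ^^ k) u x) + \<dots> = (\<Sum>k\<le>Suc d. coeff q k * (R ^^ k) u x)"
          unfolding cq sum.distrib[symmetric] by (intro sum.cong) (auto simp: algebra_simps)
        also have "\<dots> = 0" by (rule Suc.prems(4))
        finally show ?thesis .
      qed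
      from Suc.IH[OF vV r0 deg this] have "R u x = l * u x" for x
        by (simp add: v_def fun_eq_iff)
      then show ?thesis using no_eig Suc.prems(1) by blast
    qed
  qed
  have Rk: "(R ^^ k) u \<in> V" for k
    by (induction k) (auto simp: R u)
  \<comment> \<open>The coordinates of an iterate are its values under the \<open>\<phi> i\<close>;
    by \<open>\<phi>_inj\<close> a relation between coordinates is a relation between
    functions.\<close>
  from nontrivial_relation[of "{..n}" n "\<lambda>k i. \<phi> i ((R ^^ k) u)"] obtain p where
    p: "\<exists>k\<in>{..n}. p k \<noteq> 0" "\<And>i. i < n \<Longrightarrow> (\<Sum>k\<le>n. p k * \<phi> i ((R ^^ k) u)) = 0" by auto
  have V_sum: "(\<lambda>x. \<Sum>k\<in>A. p k * (R ^^ k) u x) \<in> V" if "finite A" for A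
    using that
  proof (induction A)
    case empty
    show ?case using V(2)[OF u u, of "-1"] by simp
  next
    case (insert a A)
    then show ?case using V(2)[OF Rk insert.IH] by simp
  qed
  have "\<phi> i (\<lambda>x. \<Sum>k\<le>n. p k * (R ^^ k) u x) = (\<Sum>k\<le>n. p k * \<phi> i ((R ^^ k) u))" for i
    by (rule linear_on_sum[where F="\<phi> i" and Z=Z]) (use \<phi>_lin Rk V(1) in auto)
  then have rel: "(\<lambda>x. \<Sum>k\<le>n. p k * (R ^^ k) u x) = (\<lambda>_. 0)"
    using \<phi>_inj[OF V_sum] p by auto
  define q where "q = (\<Sum>k\<le>n. monom (p k) k)"
  have cq: "coeff q k = (if k \<le> n then p k else 0)" for k
    by (auto simp: q_def coeff_sum)
  have "q \<noteq> 0" using p(1) cq by (metis atMost_iff coeff_0)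
  moreover have "degree q \<le> n" using cq by (intro degree_le) auto
  ultimately show ?thesis
    using fun_cong[OF rel] by (intro poly[OF u]) (auto simp: cq)
qed

section \<open>Delay systems with complex data\<close>

text \<open>The kernels vanish outside their intervals, so truncated integrals become convolutions
  on the line. Continuity of translation in L1 stands in for piecewise continuity; it is the source
  of the modulus of continuity of the integral part.\<close>

locale delay_system =
  fixes a2 a3 a23 b :: complex and t2 t3 D :: real and N M :: "real \<Rightarrow> complex"
  assumes b: "b \<noteq> 0" and t2: "0 < t2" and t23: "t2 \<le> t3" and D: "t2 + t3 < D"
    and N: "bdd_meas N" and M: "bdd_meas M"
    and N_supp: "\<And>x. x \<notin> {0..t2 + t3} \<Longrightarrow> N x = 0" and M_supp: "\<And>x. x \<notin> {0..D} \<Longrightarrow> M x = 0"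
    and N_trans: "((\<lambda>h. LINT x|lborel. norm (N (x + h) - N x)) \<longlongrightarrow> 0) (at 0)"
    and M_trans: "((\<lambda>h. LINT x|lborel. norm (M (x + h) - M x)) \<longlongrightarrow> 0) (at 0)"
begin

section \<open>The delay part and its inverse\<close>

definition L :: real where "L = D + t2 + t3"

text \<open>A pair \<open>(g, f)\<close> supported in \<open>[0, D) \<times> [0, t2 + t3)\<close> is stored as the single function
  \<open>g + f(\<cdot> - D)\<close> on \<open>[0, L)\<close>.\<close>

definition lo :: "(real \<Rightarrow> complex) \<Rightarrow> real \<Rightarrow> complex" where
  "lo u x = (if 0 \<le> x \<and> x < D then u x else 0)"

definition hi :: "(real \<Rightarrow> complex) \<Rightarrow> real \<Rightarrow> complex" where
  "hi u x = (if 0 \<le> x \<and> x < t2 + t3 then u (x + D) else 0)"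

definition sh :: "(real \<Rightarrow> complex) \<Rightarrow> real \<Rightarrow> complex" where
  "sh u x = a2 * u (x - t2) + a3 * u (x - t3) + a23 * u (x - (t2 + t3))"

definition K :: "(real \<Rightarrow> complex) \<Rightarrow> real \<Rightarrow> complex" where
  "K u x = conv M (hi u) x - conv N (lo u) x"

definition A :: "(real \<Rightarrow> complex) \<Rightarrow> real \<Rightarrow> complex" where
  "A u x = lo u x - sh (lo u) x + b * hi u (x - D)"

text \<open>Inverse of the diagonal part of \<open>A\<close>, which multiplies by 1 on
  \<open>[0, D)\<close> and by \<open>b\<close> on \<open>[D, L)\<close>. With \<open>Q\<close>
  below, \<open>A u = w\<close> on \<open>[0, L)\<close> becomes the fixed-point equation
  \<open>u = rw w + Q u\<close>.\<close>

definition rw :: "(real \<Rightarrow> complex) \<Rightarrow> real \<Rightarrow> complex" where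
  "rw w x = (if 0 \<le> x \<and> x < D then w x else if D \<le> x \<and> x < L then w x / b else 0)"

definition Q :: "(real \<Rightarrow> complex) \<Rightarrow> real \<Rightarrow> complex" where
  "Q u = rw (sh (lo u))"

definition nit :: nat where "nit = nat \<lceil>L / t2\<rceil>"

text \<open>The Neumann series of \<open>Q\<close> stops after \<open>nit\<close> terms since every delay is at least \<open>t2\<close>.\<close>

definition J :: "(real \<Rightarrow> complex) \<Rightarrow> real \<Rightarrow> complex" where
  "J w x = (\<Sum>i<nit. (Q ^^ i) (rw w) x)"

lemma lo_lin: "lo (\<lambda>x. a * u x + v x) = (\<lambda>x. a * lo u x + lo v x)"
  by (auto simp: lo_def)

lemma hi_lin: "hi (\<lambda>x. a * u x + v x) = (\<lambda>x. a * hi u x + hi v x)"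
  by (auto simp: hi_def)

lemma sh_lin: "sh (\<lambda>x. a * u x + v x) = (\<lambda>x. a * sh u x + sh v x)"
  by (auto simp: sh_def algebra_simps)

lemma rw_lin: "rw (\<lambda>x. a * u x + v x) = (\<lambda>x. a * rw u x + rw v x)"
  by (auto simp: rw_def add_divide_distrib)

lemma Q_lin: "Q (\<lambda>x. a * u x + v x) = (\<lambda>x. a * Q u x + Q v x)"
  by (simp add: Q_def rw_lin sh_lin lo_lin)

lemma Qpow_lin: "(Q ^^ i) (\<lambda>x. a * u x + v x) = (\<lambda>x. a * (Q ^^ i) u x + (Q ^^ i) v x)"
  by (induction i) (simp_all add: Q_lin)

lemma J_lin: "J (\<lambda>x. a * u x + v x) = (\<lambda>x. a * J u x + J v x)"
  by (simp add: fun_eq_iff J_def rw_lin Qpow_lin sum.distrib sum_distrib_left)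

lemma A_lin: "A (\<lambda>x. a * u x + v x) = (\<lambda>x. a * A u x + A v x)"
  unfolding fun_eq_iff A_def lo_lin sh_lin hi_lin by (simp add: algebra_simps)

lemma Q_zero: "Q (\<lambda>_. 0) = (\<lambda>_. 0)"
  using Q_lin[of 0 "\<lambda>_. 0" "\<lambda>_. 0"] by (auto simp: Q_def rw_def sh_def lo_def)

lemma J_zero: "J (\<lambda>_. 0) = (\<lambda>_. 0)"
  using J_lin[of "-1" "\<lambda>_. 0" "\<lambda>_. 0"] by simp

lemma J_scale: "J (\<lambda>x. a * u x) = (\<lambda>x. a * J u x)"
  using J_lin[of a u "\<lambda>_. 0"] by (simp add: J_zero)

lemma J_diff: "J (\<lambda>x. u x - v x) = (\<lambda>x. J u x - J v x)"
  using J_lin[of "-1" v u] by simp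

lemma J_sum: "finite I \<Longrightarrow> J (\<lambda>x. \<Sum>i\<in>I. c i * f i x) = (\<lambda>x. \<Sum>i\<in>I. c i * J (f i) x)"
proof (induction I rule: finite_induct)
  case (insert i I)
  then show ?case using J_lin[of "c i" "f i" "\<lambda>x. \<Sum>i\<in>I. c i * f i x"] by simp
qed (simp add: J_zero)

lemma Q_sum: "finite I \<Longrightarrow> Q (\<lambda>x. \<Sum>i\<in>I. f i x) = (\<lambda>x. \<Sum>i\<in>I. Q (f i) x)"
proof (induction I rule: finite_induct)
  case (insert i I)
  then show ?case using Q_lin[of 1 "f i" "\<lambda>x. \<Sum>i\<in>I. f i x"] by simp
qed (simp add: Q_zero)

lemma rw_supp: "x \<notin> {0..<L} \<Longrightarrow> rw w x = 0"
  using t2 t23 D by (auto simp: rw_def L_def)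

lemma rw_cong: "(\<And>x. x \<in> {0..<L} \<Longrightarrow> w x = w' x) \<Longrightarrow> rw w = rw w'"
  using t2 t23 D by (auto simp: rw_def L_def)

lemma J_cong: "(\<And>x. x \<in> {0..<L} \<Longrightarrow> w x = w' x) \<Longrightarrow> J w = J w'"
  using rw_cong[of w w'] by (auto simp: J_def)

lemma Q_supp: "x \<notin> {0..<L} \<Longrightarrow> Q w x = 0"
  by (simp add: Q_def rw_supp)

lemma Qpow_supp: "(\<And>x. x \<notin> {0..<L} \<Longrightarrow> w x = 0) \<Longrightarrow> x \<notin> {0..<L} \<Longrightarrow> (Q ^^ i) w x = 0"
  by (induction i) (simp_all add: Q_supp)

lemma J_supp: "x \<notin> {0..<L} \<Longrightarrow> J w x = 0"
  unfolding J_def by (intro sum.neutral ballI Qpow_supp rw_supp)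

text \<open>\<open>lo\<close> and \<open>rw\<close> only cut off or rescale, while every term of
  \<open>sh\<close> delays by at least \<open>t2\<close>; hence each application of \<open>Q\<close>
  moves the start of the support to the right by at least \<open>t2\<close>.\<close>

lemma Qpow_nilpotent_aux:
  assumes "\<And>x. x \<notin> {0..<L} \<Longrightarrow> w x = 0"
  shows "x < real i * t2 \<Longrightarrow> (Q ^^ i) w x = 0"
proof (induction i arbitrary: x)
  case 0
  then show ?case using assms by simp
next
  case (Suc i)
  have *: "lo ((Q ^^ i) w) (x - d) = 0" if "t2 \<le> d" for d
    using Suc.IH[of "x - d"] Suc.prems that by (auto simp: lo_def algebra_simps)
  have "sh (lo ((Q ^^ i) w)) x = 0"
    unfolding sh_def using * t2 t23 by simp
  then have "Q ((Q ^^ i) w) x = 0" unfolding Q_def by (simp add: rw_def)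
  then show ?case by simp
qed

lemma Qpow_nilpotent:
  assumes "\<And>x. x \<notin> {0..<L} \<Longrightarrow> w x = 0"
  shows "(Q ^^ nit) w = (\<lambda>_. 0)"
proof
  fix x
  have "L / t2 \<le> real nit" unfolding nit_def by (rule real_nat_ceiling_ge)
  then have "L \<le> real nit * t2" using t2 by (simp add: field_simps)
  then show "(Q ^^ nit) w x = 0"
    using Qpow_nilpotent_aux[of w x nit] Qpow_supp[of w x nit] assms
    by (cases "x < L") (auto simp del: funpow.simps)
qed

lemma J_solves: "J w x = rw w x + Q (J w) x"
proof -
  have "Q (J w) x = (\<Sum>i<nit. (Q ^^ Suc i) (rw w) x)"
    unfolding J_def[abs_def] by (simp add: Q_sum)
  then have "rw w x + Q (J w) x = (\<Sum>i<Suc nit. (Q ^^ i) (rw w) x)"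
    unfolding sum.lessThan_Suc_shift by simp
  also have "\<dots> = J w x" using Qpow_nilpotent[OF rw_supp] by (simp add: J_def)
  finally show ?thesis by simp
qed

text \<open>The difference of two solutions is fixed by \<open>Q\<close>, hence by the vanishing
  power of \<open>Q\<close>.\<close>

lemma J_unique:
  assumes supp: "\<And>x. x \<notin> {0..<L} \<Longrightarrow> u x = 0" and u: "\<And>x. u x = rw w x + Q u x"
  shows "u = J w"
proof -
  define d where "d x = (-1) * J w x + u x" for x
  have d_supp: "d x = 0" if "x \<notin> {0..<L}" for x using supp[OF that] J_supp[OF that] by (simp add: d_def)
  have "Q d = d"
  proof
    fix x
    have "Q d x = - Q (J w) x + Q u x"
      using Q_lin[of "-1" "J w" u] by (simp add: d_def[abs_def])
    moreover have "d x = - (rw w x + Q (J w) x) + (rw w x + Q u x)"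
      unfolding d_def by (subst J_solves, subst u) simp
    ultimately show "Q d x = d x" by simp
  qed
  then have "(Q ^^ i) d = d" for i by (induction i) auto
  moreover have "(Q ^^ nit) d = (\<lambda>_. 0)" by (rule Qpow_nilpotent) (rule d_supp)
  ultimately have "d = (\<lambda>_. 0)" by simp
  then show ?thesis by (auto simp: d_def fun_eq_iff)
qed

text \<open>Below \<open>D\<close> the \<open>hi\<close> term is absent and \<open>u x\<close> has
  coefficient 1. From \<open>D\<close> on, \<open>lo u x\<close> is absent and the coefficient is
  \<open>b\<close>, where \<open>b \<noteq> 0\<close> permits the division.\<close>

lemma A_eq_iff:
  assumes "x \<in> {0..<L}"
  shows "A u x = w x \<longleftrightarrow> u x = rw w x + Q u x"
proof (cases "x < D")
  case True
  with assms have "A u x = u x - sh (lo u) x"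
    by (simp add: A_def lo_def[of u x] hi_def)
  moreover have "rw w x + Q u x = w x + sh (lo u) x"
    using True assms by (simp add: Q_def rw_def)
  ultimately show ?thesis by (auto simp: diff_eq_eq)
next
  case False
  with assms have "A u x = b * u x - sh (lo u) x"
    using t2 t23 by (simp add: A_def lo_def[of u x] hi_def L_def)
  moreover have "rw w x + Q u x = (w x + sh (lo u) x) / b"
    using False assms by (simp add: Q_def rw_def add_divide_distrib)
  moreover have "b * u x - sh (lo u) x = w x \<longleftrightarrow> u x = (w x + sh (lo u) x) / b"
    using b by (auto simp: field_simps)
  ultimately show ?thesis by simp
qed

lemma A_J: "x \<in> {0..<L} \<Longrightarrow> A (J w) x = w x"
  using A_eq_iff[of x "J w" w] J_solves[of w x] by blast

lemma J_A:
  assumes "\<And>x. x \<notin> {0..<L} \<Longrightarrow> u x = 0" "\<And>x. x \<in> {0..<L} \<Longrightarrow> A u x = w x"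
  shows "u = J w"
proof (rule J_unique[OF assms(1)])
  show "u x = rw w x + Q u x" for x
  proof (cases "x \<in> {0..<L}")
    case True
    then show ?thesis using A_eq_iff[OF True, of u w] assms(2)[OF True] by blast
  next
    case False
    show ?thesis unfolding rw_supp[OF False] Q_supp[OF False] assms(1)[OF False] by simp
  qed
qed

lemma A_supp: "x \<notin> {0..<L} \<Longrightarrow> A u x = 0"
  using t2 t23 D by (auto simp: A_def sh_def lo_def hi_def L_def)

text \<open>Supports add under convolution: a closed interval for the kernel and a half-open one for
  the function give the half-open \<open>[0, L)\<close>.\<close>

lemma K_supp:
  assumes "x \<notin> {0..<L}"
  shows "K u x = 0"
proof -
  have "M y * hi u (x - y) = 0" for y
    using assms M_supp[of y] by (cases "y \<in> {0..D}") (auto simp: hi_def L_def)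
  then have "conv M (hi u) x = 0" unfolding conv_def by (simp only: integral_zero)
  have "N y * lo u (x - y) = 0" for y
    using assms N_supp[of y] by (cases "y \<in> {0..t2 + t3}") (auto simp: lo_def L_def)
  then have "conv N (lo u) x = 0" unfolding conv_def by (simp only: integral_zero)
  with \<open>conv M (hi u) x = 0\<close> show ?thesis by (simp add: K_def)
qed

section \<open>Measurability and sup-norm bounds for the delay part\<close>

lemma measurable_parts [measurable (raw)]:
  assumes [measurable]: "u \<in> borel_measurable borel"
  shows "lo u \<in> borel_measurable borel" "hi u \<in> borel_measurable borel"
    "sh u \<in> borel_measurable borel" "rw u \<in> borel_measurable borel"
proof -
  show "lo u \<in> borel_measurable borel" unfolding lo_def[abs_def] by measurable
  show "hi u \<in> borel_measurable borel" unfolding hi_def[abs_def] by measurable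
  show "sh u \<in> borel_measurable borel" unfolding sh_def[abs_def] by measurable
  show "rw u \<in> borel_measurable borel" unfolding rw_def[abs_def] by measurable
qed

lemma measurable_Q: "u \<in> borel_measurable borel \<Longrightarrow> Q u \<in> borel_measurable borel"
  by (simp add: Q_def measurable_parts)

lemma measurable_Qpow: "u \<in> borel_measurable borel \<Longrightarrow> (Q ^^ i) u \<in> borel_measurable borel"
  by (induction i) (simp_all add: measurable_Q)

lemma measurable_J: "w \<in> borel_measurable borel \<Longrightarrow> J w \<in> borel_measurable borel"
  unfolding J_def[abs_def]
  by (intro borel_measurable_sum measurable_Qpow measurable_parts)

text \<open>\<open>rc\<close>, \<open>qc\<close> and \<open>jc\<close> are sup-norm bounds for
  \<open>rw\<close>, \<open>Q\<close> and \<open>J\<close>; 1 and \<open>1 / norm b\<close> are the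
  two factors that \<open>rw\<close> applies.\<close>

definition rc :: real where "rc = max 1 (1 / norm b)"

definition qc :: real where "qc = rc * (norm a2 + norm a3 + norm a23)"

definition jc :: real where "jc = (\<Sum>i<nit. qc ^ i * rc)"

lemma rc: "rc \<ge> 1" and qc: "qc \<ge> 0"
  by (auto simp: rc_def qc_def)

lemma jc: "jc \<ge> 0"
  using rc qc unfolding jc_def by (intro sum_nonneg mult_nonneg_nonneg) auto

lemma norm_rw_le: "norm (rw w x) \<le> rc * norm (w x)"
proof -
  have "norm (w x) / norm b \<le> rc * norm (w x)" "norm (w x) \<le> rc * norm (w x)" "0 \<le> rc * norm (w x)"
    using mult_right_mono[of "1 / norm b" rc "norm (w x)"] mult_right_mono[of 1 rc "norm (w x)"] rc
    by (auto simp: rc_def)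
  then show ?thesis by (auto simp: rw_def norm_divide)
qed

lemma rw_bound: "norm (w x) \<le> c \<Longrightarrow> norm (rw w x) \<le> rc * c"
  using norm_rw_le[of w x] rc by (meson mult_left_mono order_trans zero_le_one)

lemma Q_bound:
  assumes "\<And>x. norm (u x) \<le> c"
  shows "norm (Q u x) \<le> qc * c"
proof -
  have c: "0 \<le> c" using order_trans[OF norm_ge_zero assms[of 0]] .
  have lo: "norm (lo u y) \<le> c" for y using assms c by (simp add: lo_def)
  have "norm (sh (lo u) x) \<le> norm a2 * c + norm a3 * c + norm a23 * c"
    unfolding sh_def by (intro norm_triangle_mono order_trans[OF norm_mult_ineq] mult_left_mono lo) auto
  from rw_bound[of "sh (lo u)" x, OF this] show ?thesis by (simp add: Q_def qc_def algebra_simps)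
qed

lemma Qpow_bound:
  assumes "\<And>x. norm (u x) \<le> c"
  shows "norm ((Q ^^ i) u x) \<le> qc ^ i * c"
proof (induction i arbitrary: x)
  case (Suc i)
  have "norm (Q ((Q ^^ i) u) x) \<le> qc * (qc ^ i * c)" by (rule Q_bound) (rule Suc)
  then show ?case by simp
qed (simp add: assms)

lemma J_bound:
  assumes "\<And>x. norm (w x) \<le> c"
  shows "norm (J w x) \<le> jc * c"
proof -
  have "norm (J w x) \<le> (\<Sum>i<nit. qc ^ i * (rc * c))"
    unfolding J_def by (intro sum_norm_le Qpow_bound rw_bound assms)
  then show ?thesis by (simp add: jc_def sum_distrib_right mult.assoc)
qed

lemma J_bdd_on:
  assumes "bdd_meas w"
  shows "J w \<in> bdd_on {0..<L}"
proof -
  obtain B where "\<And>x. norm (w x) \<le> B" using assms bdd_measE by metis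
  then have "\<And>x. norm (J w x) \<le> jc * B" by (rule J_bound)
  then show ?thesis using measurable_J[of w] assms J_supp
    by (auto simp: bdd_on_def bdd_meas_def)
qed

section \<open>The integral part as a smoothing operator\<close>

lemma N_int: "integrable lborel N" and M_int: "integrable lborel M"
  using integrable_compact_support[OF N N_supp] integrable_compact_support[OF M M_supp] by auto

lemma lo_supp: "x \<notin> {0..D} \<Longrightarrow> lo u x = 0" and hi_supp: "x \<notin> {0..t2 + t3} \<Longrightarrow> hi u x = 0"
  by (auto simp: lo_def hi_def)

lemma integrable_lo: assumes "integrable lborel u" shows "integrable lborel (lo u)"
proof (rule Bochner_Integration.integrable_bound[OF assms])
  show "lo u \<in> borel_measurable lborel" using assms measurable_parts by (auto dest: borel_measurable_integrable)
  show "AE x in lborel. norm (lo u x) \<le> norm (u x)" by (auto simp: lo_def)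
qed

lemma integrable_hi: assumes "integrable lborel u" shows "integrable lborel (hi u)"
proof (rule Bochner_Integration.integrable_bound[OF integrable_shift_lborel[OF assms, of "-D"]])
  show "hi u \<in> borel_measurable lborel" using assms measurable_parts by (auto dest: borel_measurable_integrable)
  show "AE x in lborel. norm (hi u x) \<le> norm (u (x - - D))" by (auto simp: hi_def)
qed

lemma bdd_meas_lo: "bdd_meas u \<Longrightarrow> bdd_meas (lo u)"
proof -
  assume u: "bdd_meas u"
  obtain B where "B \<ge> 0" "\<And>x. norm (u x) \<le> B" using u bdd_measE by metis
  then show ?thesis using u by (intro bdd_measI[of _ B]) (auto simp: lo_def measurable_parts bdd_meas_def)
qed

lemma bdd_meas_hi: "bdd_meas u \<Longrightarrow> bdd_meas (hi u)"
proof -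
  assume u: "bdd_meas u"
  obtain B where "B \<ge> 0" "\<And>x. norm (u x) \<le> B" using u bdd_measE by metis
  then show ?thesis using u by (intro bdd_measI[of _ B]) (auto simp: hi_def measurable_parts bdd_meas_def)
qed

lemma bdd_on_integrable: "u \<in> bdd_on {0..<L} \<Longrightarrow> integrable lborel u"
  by (rule integrable_compact_support[of _ 0 L]) (auto simp: bdd_on_def)

text \<open>Integrability instead of boundedness lets \<open>K\<close> act on square-integrable
  functions with support in \<open>[0, L)\<close>.\<close>

lemma K_lin:
  assumes u: "integrable lborel u" and v: "integrable lborel v"
  shows "K (\<lambda>x. a * u x + v x) = (\<lambda>x. a * K u x + K v x)"
proof
  fix x
  have *: "conv k (\<lambda>x. a * f x + g x) x = a * conv k f x + conv k g x"
    if "integrable lborel f" "integrable lborel g" "bdd_meas k" for k f g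
    unfolding conv_commute[of k]
    using conv_integrable_bdd[OF that(1,3), of x] conv_integrable_bdd[OF that(2,3), of x]
    by (simp add: conv_def distrib_right mult.assoc)
  show "K (\<lambda>x. a * u x + v x) x = a * K u x + K v x"
    unfolding K_def hi_lin lo_lin
    using *[OF integrable_hi[OF u] integrable_hi[OF v] M] *[OF integrable_lo[OF u] integrable_lo[OF v] N]
    by (simp add: algebra_simps)
qed

lemma integral_lo_le:
  assumes "integrable lborel u"
  shows "(LINT x|lborel. norm (lo u x)) \<le> (LINT x|lborel. norm (u x))"
  by (intro integral_mono integrable_norm integrable_lo assms) (simp add: lo_def)

lemma integral_hi_le:
  assumes "integrable lborel u"
  shows "(LINT x|lborel. norm (hi u x)) \<le> (LINT x|lborel. norm (u x))"
proof -
  have "(LINT x|lborel. norm (hi u x)) \<le> (LINT x|lborel. norm (u (x - (-D))))"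
    by (intro integral_mono integrable_norm integrable_hi integrable_shift_lborel assms) (simp add: hi_def)
  also have "\<dots> = (LINT x|lborel. norm (u x))"
    by (rule integral_shift_lborel)
  finally show ?thesis .
qed

text \<open>\<open>K\<close> takes L1 to bounded functions because its kernels are bounded. This
  gain later makes the correction to an L2 solution bounded.\<close>

lemma K_bound: "\<exists>kc\<ge>0. \<forall>u. integrable lborel u \<longrightarrow> (\<forall>x. norm (K u x) \<le> kc * (LINT x|lborel. norm (u x)))"
proof -
  obtain BM BN where B: "BM \<ge> 0" "\<And>x. norm (M x) \<le> BM" "BN \<ge> 0" "\<And>x. norm (N x) \<le> BN"
    using M N bdd_measE by metis
  show ?thesis
  proof (intro exI[of _ "BM + BN"] conjI allI impI)
    fix u :: "real \<Rightarrow> complex" and x assume u: "integrable lborel u"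
    let ?I = "LINT x|lborel. norm (u x)"
    have "norm (K u x) \<le> norm (conv (hi u) M x) + norm (conv (lo u) N x)"
      unfolding K_def conv_commute[of M] conv_commute[of N] by (rule norm_triangle_ineq4)
    also have "\<dots> \<le> ?I * BM + ?I * BN"
      using conv_bound[OF integrable_hi[OF u] M B(2), of x] conv_bound[OF integrable_lo[OF u] N B(4), of x]
        mult_right_mono[OF integral_hi_le[OF u] B(1)] mult_right_mono[OF integral_lo_le[OF u] B(3)]
      by linarith
    finally show "norm (K u x) \<le> (BM + BN) * ?I" by (simp add: algebra_simps)
  qed (use B in simp)
qed

lemma K_bdd_meas:
  assumes "integrable lborel u" shows "bdd_meas (K u)"
  unfolding K_def[abs_def] conv_commute[of M] conv_commute[of N]
  by (intro bdd_meas_diff bdd_meas_conv integrable_lo integrable_hi assms M N)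

text \<open>A translation of the convolution can be moved onto the kernel, so the modulus depends on
  \<open>f\<close> only through its sup bound.\<close>

lemma conv_modulus:
  assumes f: "integrable lborel f" and k: "bdd_meas k" "integrable lborel k" and c: "\<And>x. norm (f x) \<le> c"
  shows "norm (conv k f x - conv k f y) \<le> c * (LINT z|lborel. norm (k (z + (x - y)) - k z))"
proof -
  have i: "integrable lborel (\<lambda>z. f z * k (x - z))" "integrable lborel (\<lambda>z. f z * k (y - z))"
    using conv_integrable_bdd[OF f k(1)] by auto
  have "conv k f x - conv k f y = (LINT z|lborel. f z * k (x - z) - f z * k (y - z))"
    unfolding conv_commute[of k] conv_def using i by simp
  also have "norm \<dots> \<le> (LINT z|lborel. norm (f z * k (x - z) - f z * k (y - z)))"
    by (rule integral_norm_bound)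
  also have "\<dots> \<le> (LINT z|lborel. c * norm (k (x - z) - k (y - z)))"
  proof (rule integral_mono)
    show "integrable lborel (\<lambda>z. norm (f z * k (x - z) - f z * k (y - z)))"
      using i by (intro integrable_norm Bochner_Integration.integrable_diff)
    show "integrable lborel (\<lambda>z. c * norm (k (x - z) - k (y - z)))"
      using integrable_reflect_lborel[OF k(2)]
      by (intro integrable_mult_right integrable_norm Bochner_Integration.integrable_diff)
    show "norm (f z * k (x - z) - f z * k (y - z)) \<le> c * norm (k (x - z) - k (y - z))" for z
      unfolding right_diff_distrib[symmetric] norm_mult by (intro mult_right_mono c) auto
  qed
  also have "\<dots> = c * (LINT z|lborel. norm (k (x - z) - k (y - z)))" by simp
  also have "(LINT z|lborel. norm (k (x - z) - k (y - z))) = (LINT z|lborel. norm (k (z + (x - y)) - k z))"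
    by (subst lborel_integral_real_affine[of "-1" _ y]) (simp_all add: add.commute diff_add_eq)
  finally show ?thesis .
qed

lemma K_modulus:
  assumes "\<epsilon> > 0"
  shows "\<exists>h>0. \<forall>u\<in>bdd_on {0..<L}. \<forall>c. (\<forall>x. norm (u x) \<le> c) \<longrightarrow>
    (\<forall>x y. \<bar>x - y\<bar> < h \<longrightarrow> norm (K u x - K u y) \<le> \<epsilon> * c)"
proof -
  let ?w = "\<lambda>k h. LINT z|lborel. norm (k (z + h) - (k z :: complex))"
  have "((\<lambda>h. ?w M h + ?w N h) \<longlongrightarrow> 0 + 0) (at 0)" by (rule tendsto_add[OF M_trans N_trans])
  then have "eventually (\<lambda>h. ?w M h + ?w N h < \<epsilon>) (at 0)" by (rule order_tendstoD(2)) (simp add: assms)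
  then obtain h where h: "h > 0" "\<forall>d\<in>UNIV. d \<noteq> 0 \<and> dist d 0 < h \<longrightarrow> ?w M d + ?w N d < \<epsilon>"
    unfolding eventually_at by blast
  \<comment> \<open>The limit at 0 says nothing about \<open>d = 0\<close> itself, where both
    integrals are zero.\<close>
  have h': "?w M d + ?w N d \<le> \<epsilon>" if "\<bar>d\<bar> < h" for d
  proof (cases "d = 0")
    case True
    then show ?thesis using assms by simp
  next
    case False
    then show ?thesis using h(2)[rule_format, of d] that by (simp add: dist_norm less_imp_le)
  qed
  show ?thesis
  proof (intro exI[of _ h] conjI ballI allI impI)
    fix u c x y assume u: "u \<in> bdd_on {0..<L}" and c: "\<forall>x. norm (u x) \<le> c" and xy: "\<bar>x - y\<bar> < h"
    have c0: "0 \<le> c" using order_trans[OF norm_ge_zero c[rule_format, of 0]] .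
    have lo: "norm (lo u z) \<le> c" and hi: "norm (hi u z) \<le> c" for z
      using c c0 by (auto simp: lo_def hi_def)
    note int = bdd_on_integrable[OF u]
    have "norm (K u x - K u y)
        = norm ((conv M (hi u) x - conv M (hi u) y) - (conv N (lo u) x - conv N (lo u) y))"
      unfolding K_def by (rule arg_cong[where f=norm]) simp
    then have "norm (K u x - K u y)
        \<le> norm (conv M (hi u) x - conv M (hi u) y) + norm (conv N (lo u) x - conv N (lo u) y)"
      using norm_triangle_ineq4[of "conv M (hi u) x - conv M (hi u) y"] by simp
    moreover have "norm (conv M (hi u) x - conv M (hi u) y) \<le> c * ?w M (x - y)"
      by (rule conv_modulus[OF integrable_hi[OF int] M M_int hi])
    moreover have "norm (conv N (lo u) x - conv N (lo u) y) \<le> c * ?w N (x - y)"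
      by (rule conv_modulus[OF integrable_lo[OF int] N N_int lo])
    moreover have "c * ?w M (x - y) + c * ?w N (x - y) \<le> \<epsilon> * c"
      using mult_left_mono[OF h'[OF xy] c0] by (simp only: distrib_left mult.commute)
    ultimately show "norm (K u x - K u y) \<le> \<epsilon> * c" by linarith
  qed (rule h(1))
qed

text \<open>The premises of \<open>fredholm_alternative\<close> together with a decomposition of
  \<open>J K\<close>. They are bundled because the same splitting serves twice: for solvability, and
  to supply functionals that separate the kernel.\<close>

definition splitting :: "((real \<Rightarrow> complex) \<Rightarrow> real \<Rightarrow> complex) \<Rightarrow> (nat \<Rightarrow> (real \<Rightarrow> complex) \<Rightarrow> complex)
    \<Rightarrow> (nat \<Rightarrow> real \<Rightarrow> complex) \<Rightarrow> nat \<Rightarrow> real \<Rightarrow> bool" where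
  "splitting S \<phi> e n C \<longleftrightarrow>
     (\<forall>u\<in>bdd_on {0..<L}. S u \<in> bdd_on {0..<L}) \<and>
     (\<forall>a. \<forall>u\<in>bdd_on {0..<L}. \<forall>v\<in>bdd_on {0..<L}. \<forall>x. S (\<lambda>x. a * u x + v x) x = a * S u x + S v x) \<and>
     (\<forall>u\<in>bdd_on {0..<L}. \<forall>c. (\<forall>x. norm (u x) \<le> c) \<longrightarrow> (\<forall>x. norm (S u x) \<le> c / 2)) \<and>
     (\<forall>a. \<forall>u\<in>bdd_on {0..<L}. \<forall>v\<in>bdd_on {0..<L}. \<forall>i. \<phi> i (\<lambda>x. a * u x + v x) = a * \<phi> i u + \<phi> i v) \<and>
     (\<forall>u\<in>bdd_on {0..<L}. \<forall>c. (\<forall>x. norm (u x) \<le> c) \<longrightarrow> (\<forall>i. norm (\<phi> i u) \<le> C * c)) \<and>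
     (\<forall>i. e i \<in> bdd_on {0..<L}) \<and>
     (\<forall>u\<in>bdd_on {0..<L}. \<forall>x. S u x + (\<Sum>j<n. \<phi> j u * e j x) = J (K u) x)"

lemma splittingD:
  assumes "splitting S \<phi> e n C"
  shows "\<And>u. u \<in> bdd_on {0..<L} \<Longrightarrow> S u \<in> bdd_on {0..<L}"
    and "\<And>a u v x. u \<in> bdd_on {0..<L} \<Longrightarrow> v \<in> bdd_on {0..<L} \<Longrightarrow> S (\<lambda>x. a * u x + v x) x = a * S u x + S v x"
    and "\<And>u c x. u \<in> bdd_on {0..<L} \<Longrightarrow> (\<And>x. norm (u x) \<le> c) \<Longrightarrow> norm (S u x) \<le> c / 2"
    and "\<And>a u v i. u \<in> bdd_on {0..<L} \<Longrightarrow> v \<in> bdd_on {0..<L} \<Longrightarrow> \<phi> i (\<lambda>x. a * u x + v x) = a * \<phi> i u + \<phi> i v"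
    and "\<And>u c i. u \<in> bdd_on {0..<L} \<Longrightarrow> (\<And>x. norm (u x) \<le> c) \<Longrightarrow> norm (\<phi> i u) \<le> C * c"
    and "\<And>i. e i \<in> bdd_on {0..<L}"
    and "\<And>u x. u \<in> bdd_on {0..<L} \<Longrightarrow> S u x + (\<Sum>j<n. \<phi> j u * e j x) = J (K u) x"
  using assms unfolding splitting_def by blast+

text \<open>The finite-rank part samples \<open>K u\<close> on a fine grid; the modulus of continuity of \<open>K\<close> makes the
  remainder a contraction.\<close>

lemma J_K_splitting: "\<exists>S \<phi> e n C. splitting S \<phi> e n C"
proof -
  \<comment> \<open>Applying \<open>J\<close> multiplies the oscillation of \<open>K u\<close> by at
    most \<open>jc\<close>, so this \<epsilon> leaves a factor of at most 1/2. The added 1 keeps the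
    denominator positive.\<close>
  define \<epsilon> where "\<epsilon> = 1 / (2 * (jc + 1))"
  have \<epsilon>: "\<epsilon> > 0" using jc by (simp add: \<epsilon>_def)
  obtain h where h: "h > 0" and mod: "\<And>u c x y. u \<in> bdd_on {0..<L} \<Longrightarrow> (\<And>x. norm (u x) \<le> c) \<Longrightarrow>
      \<bar>x - y\<bar> < h \<Longrightarrow> norm (K u x - K u y) \<le> \<epsilon> * c"
    using K_modulus[OF \<epsilon>] by blast
  obtain kc where kc: "kc \<ge> 0" "\<And>u x. integrable lborel u \<Longrightarrow> norm (K u x) \<le> kc * (LINT x|lborel. norm (u x))"
    using K_bound by blast
  \<comment> \<open>\<open>p\<close> rounds down to the grid of width \<open>h\<close>;
    \<open>S\<close> carries the error of replacing \<open>K u\<close> by its sampled step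
    function.\<close>
  define p where "p x = h * of_int \<lfloor>x / h\<rfloor>" for x
  have p: "\<bar>x - p x\<bar> < h" for x
    using floor_divide_lower[OF h, of x] floor_divide_upper[OF h, of x] unfolding p_def
    by (simp add: abs_if algebra_simps)
  have [measurable]: "p \<in> borel_measurable borel" unfolding p_def[abs_def] by measurable
  define S where "S u = J (\<lambda>x. K u x - K u (p x))" for u
  define \<phi> where "\<phi> j u = K u (h * real j)" for j u
  define c where "c j x = (if \<lfloor>x / h\<rfloor> = int j then 1 else 0 :: complex)" for j x
  define e where "e j = J (c j)" for j
  \<comment> \<open>The cells with index 0 up to \<open>\<lfloor>L / h\<rfloor>\<close> cover
    \<open>[0, L)\<close>. Agreement there suffices, since \<open>J\<close> ignores values
    outside.\<close>
  define n where "n = nat (\<lfloor>L / h\<rfloor> + 1)"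
  have inn: "bdd_meas (\<lambda>x. K u x - K u (p x))" if u: "u \<in> bdd_on {0..<L}" for u
  proof -
    have "bdd_meas (K u)" using K_bdd_meas bdd_on_integrable[OF u] by blast
    moreover have "bdd_meas (\<lambda>x. K u (p x))" using calculation unfolding bdd_meas_def by auto
    ultimately show ?thesis by (rule bdd_meas_diff)
  qed
  have Klin: "K (\<lambda>x. a * u x + v x) = (\<lambda>x. a * K u x + K v x)"
    if "u \<in> bdd_on {0..<L}" "v \<in> bdd_on {0..<L}" for a u v
    by (intro K_lin bdd_on_integrable that)
  have "splitting S \<phi> e n (kc * L)"
    unfolding splitting_def
  proof (intro conjI ballI allI impI)
    show "S u \<in> bdd_on {0..<L}" if "u \<in> bdd_on {0..<L}" for u
      unfolding S_def by (intro J_bdd_on inn that)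
    show "S (\<lambda>x. a * u x + v x) x = a * S u x + S v x"
      if "u \<in> bdd_on {0..<L}" "v \<in> bdd_on {0..<L}" for a u v x
    proof -
      have "(\<lambda>x. K (\<lambda>x. a * u x + v x) x - K (\<lambda>x. a * u x + v x) (p x))
          = (\<lambda>x. a * (K u x - K u (p x)) + (K v x - K v (p x)))"
        unfolding Klin[OF that] by (simp add: algebra_simps)
      then show ?thesis by (simp add: S_def J_lin)
    qed
    show "norm (S u x) \<le> c / 2" if "u \<in> bdd_on {0..<L}" and c: "\<forall>x. norm (u x) \<le> c" for u c x
    proof -
      have "norm (S u x) \<le> jc * (\<epsilon> * c)"
        unfolding S_def by (intro J_bound mod p) (use that in auto)
      also have "\<dots> \<le> (jc + 1) * (\<epsilon> * c)"
        using \<epsilon> order_trans[OF norm_ge_zero c[rule_format, of 0]] by (intro mult_right_mono) auto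
      also have "\<dots> = c / 2" using jc by (simp add: \<epsilon>_def field_simps)
      finally show ?thesis .
    qed
    show "\<phi> i (\<lambda>x. a * u x + v x) = a * \<phi> i u + \<phi> i v"
      if "u \<in> bdd_on {0..<L}" "v \<in> bdd_on {0..<L}" for a u v i
      by (simp add: \<phi>_def Klin[OF that])
    show "norm (\<phi> i u) \<le> (kc * L) * c" if u: "u \<in> bdd_on {0..<L}" and c: "\<forall>x. norm (u x) \<le> c" for u c i
    proof -
      have c0: "0 \<le> c" using order_trans[OF norm_ge_zero c[rule_format, of 0]] .
      have L0: "0 < L" using D t2 t23 by (simp add: L_def)
      have "(LINT x|lborel. norm (u x)) \<le> (LINT x|lborel. indicator {0..L} x * c)"
      proof (rule integral_mono)
        show "integrable lborel (\<lambda>x. norm (u x))" using bdd_on_integrable[OF u] by simp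
        show "integrable lborel (\<lambda>x. indicator {0..L} x * c)"
          by (intro integrable_mult_left) (simp add: integrable_indicator_iff emeasure_lborel_Icc_eq)
        show "norm (u x) \<le> indicator {0..L} x * c" for x
          using u c[rule_format, of x] by (auto simp: bdd_on_def indicator_def)
      qed
      also have "\<dots> = L * c" using L0 by simp
      finally have "kc * (LINT x|lborel. norm (u x)) \<le> kc * (L * c)" using kc(1) by (rule mult_left_mono)
      then show ?thesis using kc(2)[OF bdd_on_integrable[OF u], of "h * real i"] by (simp add: \<phi>_def)
    qed
    show "e i \<in> bdd_on {0..<L}" for i
    proof -
      have "c i \<in> borel_measurable borel" unfolding c_def[abs_def] by measurable
      then show ?thesis unfolding e_def by (intro J_bdd_on bdd_measI[of _ 1]) (auto simp: c_def)
    qed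
    show "S u x + (\<Sum>j<n. \<phi> j u * e j x) = J (K u) x" if "u \<in> bdd_on {0..<L}" for u x
    proof -
      have "S u x + (\<Sum>j<n. \<phi> j u * e j x) = J (\<lambda>x. (\<Sum>j<n. \<phi> j u * c j x)) x + S u x"
        by (simp add: e_def J_sum)
      also have "\<dots> = J (\<lambda>x. 1 * (\<Sum>j<n. \<phi> j u * c j x) + (K u x - K u (p x))) x"
        unfolding J_lin S_def by simp
      also have "J (\<lambda>x. 1 * (\<Sum>j<n. \<phi> j u * c j x) + (K u x - K u (p x))) = J (K u)"
      proof (rule J_cong)
        fix x assume x: "x \<in> {0..<L}"
        define k where "k = nat \<lfloor>x / h\<rfloor>"
        have fl: "\<lfloor>x / h\<rfloor> = int k" using x h by (simp add: k_def)
        have "\<lfloor>x / h\<rfloor> \<le> \<lfloor>L / h\<rfloor>" using x h by (intro floor_mono divide_right_mono) auto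
        then have "k < n" using fl unfolding n_def by linarith
        have "(\<Sum>j<n. \<phi> j u * c j x) = (\<Sum>j<n. if k = j then \<phi> j u else 0)"
          by (intro sum.cong) (auto simp: c_def fl)
        also have "\<dots> = K u (p x)" using \<open>k < n\<close> by (simp add: \<phi>_def p_def fl)
        finally show "1 * (\<Sum>j<n. \<phi> j u * c j x) + (K u x - K u (p x)) = K u x" by simp
      qed
      finally show ?thesis .
    qed
  qed
  then show ?thesis by blast
qed


text \<open>\<open>1 + J K\<close> and \<open>A + K\<close> have the same kernel: \<open>J\<close>
  inverts \<open>A\<close> on \<open>[0, L)\<close>, and outside that interval both
  \<open>A u\<close> and \<open>K u\<close> vanish. So the injectivity assumption feeds
  \<open>fredholm_alternative\<close>.\<close>

lemma bdd_fredholm: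
  assumes inj: "\<And>u. u \<in> bdd_on {0..<L} \<Longrightarrow> (\<And>x. A u x + K u x = 0) \<Longrightarrow> u = (\<lambda>_. 0)"
  shows "\<exists>C. \<forall>w\<in>bdd_on {0..<L}. \<forall>c. (\<forall>x. norm (w x) \<le> c) \<longrightarrow>
    (\<exists>u\<in>bdd_on {0..<L}. (\<forall>x. u x + J (K u) x = w x) \<and> (\<forall>x. norm (u x) \<le> C * c))"
proof -
  obtain S \<phi> e n C where spl: "splitting S \<phi> e n C" using J_K_splitting by blast
  note sp = splittingD[OF spl]
  have "u = (\<lambda>_. 0)" if u: "u \<in> bdd_on {0..<L}"
    and eq: "\<And>x. u x + S u x + (\<Sum>j<n. \<phi> j u * e j x) = 0" for u
  proof (rule inj[OF u])
    have "u = J (\<lambda>x. -1 * K u x)"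
    proof
      fix x
      have "u x + J (K u) x = 0" using eq[of x] sp(7)[OF u, of x] by (simp only: add.assoc)
      then show "u x = J (\<lambda>x. -1 * K u x) x" unfolding J_scale by (simp add: eq_neg_iff_add_eq_0)
    qed
    then have "A u x = - K u x" if "x \<in> {0..<L}" for x
      using A_J[OF that, of "\<lambda>x. -1 * K u x"] by (metis mult_minus1)
    then show "A u x + K u x = 0" for x
      using A_supp[of x u] K_supp[of x u] by (cases "x \<in> {0..<L}") auto
  qed
  from fredholm_alternative[where Z="{0..<L}" and S=S and \<phi>=\<phi> and C="\<lambda>_. C" and h=e and n=n, OF sp(1-6) this]
  obtain C' where C': "\<forall>w\<in>bdd_on {0..<L}. \<forall>c. (\<forall>x. norm (w x) \<le> c) \<longrightarrow>
      (\<exists>u\<in>bdd_on {0..<L}. (\<forall>x. u x + S u x + (\<Sum>j<n. \<phi> j u * e j x) = w x) \<and> (\<forall>x. norm (u x) \<le> C' * c))"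
    by blast
  show ?thesis
  proof (intro exI[of _ C'] ballI allI impI)
    fix w c assume "w \<in> bdd_on {0..<L}" "\<forall>x. norm (w x) \<le> c"
    with C' obtain u where u: "u \<in> bdd_on {0..<L}"
      "\<forall>x. u x + S u x + (\<Sum>j<n. \<phi> j u * e j x) = w x" "\<forall>x. norm (u x) \<le> C' * c" by blast
    then show "\<exists>u\<in>bdd_on {0..<L}. (\<forall>x. u x + J (K u) x = w x) \<and> (\<forall>x. norm (u x) \<le> C' * c)"
      by (intro bexI[of _ u]) (simp_all add: add.assoc sp(7))
  qed
qed

end

section \<open>Triviality of the kernel\<close>

text \<open>The Heaviside function, whose convolution with a function is its primitive and whose
  translates are the primitives of point masses. The value 1 at 0 makes the jump visible at the atom
  itself, which is used for eigenvalue 0.\<close>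

definition Hv :: "real \<Rightarrow> complex" where "Hv x = (if 0 \<le> x then 1 else 0)"

abbreviation prim :: "(real \<Rightarrow> complex) \<Rightarrow> real \<Rightarrow> complex" where "prim h \<equiv> conv h Hv"

lemma bdd_meas_Hv: "bdd_meas Hv"
proof (rule bdd_measI[of _ 1])
  show "Hv \<in> borel_measurable borel" unfolding Hv_def[abs_def] by measurable
qed (simp add: Hv_def)

lemma bdd_meas_prim: "integrable lborel h \<Longrightarrow> bdd_meas (prim h)"
  by (intro bdd_meas_conv bdd_meas_Hv)

lemma prim_at_top:
  assumes "\<And>x. x \<notin> {0..T} \<Longrightarrow> h x = 0" "T \<le> x"
  shows "prim h x = (LINT y|lborel. h y)"
proof -
  have "h y * Hv (x - y) = h y" for y
    using assms(1)[of y] assms(2) by (cases "y \<in> {0..T}") (auto simp: Hv_def)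
  then show ?thesis unfolding conv_def by (rule Bochner_Integration.integral_cong[OF refl])
qed

lemma prim_neg:
  assumes "\<And>x. x \<notin> {0..T} \<Longrightarrow> h x = 0" "x < 0"
  shows "prim h x = 0"
proof -
  have "h y * Hv (x - y) = 0" for y
    using assms(1)[of y] assms(2) by (cases "y \<in> {0..T}") (auto simp: Hv_def)
  then show ?thesis unfolding conv_def by (simp only: integral_zero)
qed

lemma prim_0:
  assumes "\<And>x. x \<notin> {0..T} \<Longrightarrow> h x = 0"
  shows "prim h 0 = 0"
proof -
  have "(LINT y|lborel. h y * Hv (0 - y)) = integral\<^sup>L lborel (\<lambda>_::real. 0)"
  proof (rule integral_discrete_difference[where X="{0}"])
    fix y :: real assume "y \<notin> {0}"
    then show "h y * Hv (0 - y) = 0"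
      using assms[of y] by (cases "y \<in> {0..T}") (auto simp: Hv_def)
  qed auto
  then show ?thesis by (simp add: conv_def)
qed

text \<open>The rays \<open>{..a}\<close> form an intersection-stable generator of the Borel sets,
  and the sets over which \<open>h\<close> integrates to 0 are closed under complements and disjoint
  unions. Complements need the total mass, read off from the primitive at \<open>T\<close>.\<close>

lemma prim_eq_0_imp_AE:
  assumes h: "integrable lborel h" and supp: "\<And>x. x \<notin> {0..T} \<Longrightarrow> h x = 0"
    and zero: "\<And>x. prim h x = 0"
  shows "AE x in lborel. h x = 0"
proof (rule sigma_finite_measure.density_zero[OF sigma_finite_lborel h])
  have tot: "(LINT y|lborel. h y) = 0"
    using prim_at_top[of T h T, OF supp order_refl] zero[of T] by simp
  have int: "set_integrable lborel A h" if "A \<in> sets borel" for A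
    using h that by (simp add: set_integrable_def integrable_mult_indicator)
  have stable: "Int_stable (range (\<lambda>a::real. {..a}))" and closed: "range (\<lambda>a::real. {..a}) \<subseteq> Pow UNIV"
    by (auto simp: Int_stable_def)
  fix A :: "real set" assume "A \<in> sets lborel"
  then have "A \<in> sigma_sets UNIV (range (\<lambda>a::real. {..a}))"
    by (simp add: borel_eq_atMost)
  then show "set_lebesgue_integral lborel A h = 0"
  proof (induction A rule: sigma_sets_induct_disjoint[OF stable closed, consumes 1, case_names basic empty compl union])
    case (basic A)
    then obtain a where A: "A = {..a}" by auto
    have "indicat_real A y *\<^sub>R h y = h y * Hv (a - y)" for y
      by (auto simp: A Hv_def indicator_def)
    then have "set_lebesgue_integral lborel A h = prim h a"
      by (simp add: set_lebesgue_integral_def conv_def)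
    then show ?case by (simp add: zero)
  next
    case empty
    show ?case by (simp add: set_lebesgue_integral_def)
  next
    case (compl A)
    then have [measurable]: "A \<in> sets borel" by (simp add: borel_eq_atMost)
    have "set_lebesgue_integral lborel (UNIV - A) h + set_lebesgue_integral lborel A h
        = (LINT y|lborel. h y)"
    proof -
      have "set_lebesgue_integral lborel (UNIV - A) h + set_lebesgue_integral lborel A h
          = set_lebesgue_integral lborel ((UNIV - A) \<union> A) h"
        by (rule set_integral_Un[symmetric]) (auto intro!: int)
      then show ?thesis by (simp add: set_lebesgue_integral_def)
    qed
    then show ?case using compl tot by simp
  next
    case (union A)
    then have "A i \<in> sets borel" for i by (auto simp: borel_eq_atMost)
    then show ?case using union
      by (subst lebesgue_integral_countable_add) (auto simp: disjoint_family_on_def intro!: int)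
  qed
qed

lemma conv_AE_zero:
  assumes "AE x in lborel. f x = 0" and [measurable]: "f \<in> borel_measurable borel" "g \<in> borel_measurable borel"
  shows "conv f g x = 0"
proof -
  have "conv f g x = integral\<^sup>L lborel (\<lambda>_::real. 0)"
    unfolding conv_def by (rule integral_cong_AE) (use assms(1) in auto)
  then show ?thesis by simp
qed

text \<open>Weighted contraction for a Volterra equation: relative to the weight
  \<open>exp (2 * m * x)\<close> with \<open>m = norm (1 / l)\<close>, integration from 0 followed
  by division by \<open>l\<close> has norm at most 1/2. Each round therefore halves the bound on
  \<open>g\<close>.\<close>

lemma prim_eigenfunction_zero:
  assumes g: "bdd_meas g" and supp: "\<And>x. x \<notin> {0..T} \<Longrightarrow> g x = 0"
    and l: "l \<noteq> 0" and eig: "\<And>x. prim g x = l * g x"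
  shows "g x = 0"
proof -
  define m where "m = norm (1 / l)"
  have m: "m > 0" using l by (simp add: m_def)
  obtain B where B: "B \<ge> 0" "\<And>x. norm (g x) \<le> B" using g bdd_measE by metis
  have gi: "integrable lborel g" using integrable_compact_support[OF g supp] by blast
  have "norm (g x) \<le> (B / 2 ^ k) * exp (2 * m * x)" if "x \<ge> 0" for k x
    using that
  proof (induction k arbitrary: x)
    case 0
    have "B * 1 \<le> B * exp (2 * m * x)" using B m 0 by (intro mult_left_mono) auto
    then show ?case using B(2)[of x] by simp
  next
    case (Suc k)
    let ?f = "\<lambda>y. (B / 2 ^ k) * exp (2 * m * y)"
    have FTC: "(LINT y|lborel. indicator {0..x} y *\<^sub>R ?f y) = (B / 2 ^ k) * exp (2 * m * x) / (2 * m) - (B / 2 ^ k) * exp (2 * m * 0) / (2 * m)"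
      using Suc.prems m
      by (intro integral_FTC_atLeastAtMost)
         (auto intro!: derivative_eq_intros continuous_intros simp flip: has_real_derivative_iff_has_vector_derivative)
    have "norm (prim g x) \<le> (LINT y|lborel. norm (g y * Hv (x - y)))"
      unfolding conv_def by (rule integral_norm_bound)
    also have "\<dots> \<le> (LINT y|lborel. indicator {0..x} y *\<^sub>R ?f y)"
    proof (rule integral_mono)
      show "integrable lborel (\<lambda>y. norm (g y * Hv (x - y)))"
        using conv_integrable_bdd[OF gi bdd_meas_Hv] by (rule integrable_norm)
      show "integrable lborel (\<lambda>y. indicator {0..x} y *\<^sub>R ?f y)"
        using borel_integrable_atLeastAtMost'[of 0 x ?f] by (simp add: set_integrable_def continuous_intros)
      show "norm (g y * Hv (x - y)) \<le> indicator {0..x} y *\<^sub>R ?f y" for y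
      proof (cases "y \<in> {0..x}")
        case True
        then show ?thesis using Suc.IH[of y] by (simp add: Hv_def)
      next
        case False
        then have "g y * Hv (x - y) = 0" using supp[of y] by (cases "y < 0") (auto simp: Hv_def)
        then show ?thesis using False by simp
      qed
    qed
    also have "\<dots> \<le> (B / 2 ^ k) * exp (2 * m * x) / (2 * m)" unfolding FTC using B m by simp
    finally have "m * norm (prim g x) \<le> m * ((B / 2 ^ k) * exp (2 * m * x) / (2 * m))"
      using m by (intro mult_left_mono) auto
    moreover have "m * norm (prim g x) = norm (g x)"
      using l by (simp add: eig m_def norm_mult norm_divide)
    moreover have "m * ((B / 2 ^ k) * exp (2 * m * x) / (2 * m)) = (B / 2 ^ Suc k) * exp (2 * m * x)"
      using m by (simp add: field_simps)
    ultimately show ?case by simp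
  qed
  note bound = this
  show "g x = 0"
  proof (cases "x \<ge> 0")
    case True
    have "(\<lambda>k. (B * exp (2 * m * x)) * (1 / 2) ^ k) \<longlonglongrightarrow> (B * exp (2 * m * x)) * 0"
      by (intro tendsto_intros) auto
    then have "norm (g x) \<le> 0"
      using bound[OF True] by (intro LIMSEQ_le_const[of "\<lambda>k. (B * exp (2 * m * x)) * (1 / 2) ^ k"])
        (auto simp: power_divide field_simps)
    then show ?thesis by simp
  qed (use supp in auto)
qed

text \<open>Convolution with this kernel, evaluated at \<open>T\<close>, is the Laplace transform at \<open>s\<close> for functions
  supported in \<open>[0, T]\<close>.\<close>
definition lap_kernel :: "complex \<Rightarrow> real \<Rightarrow> real \<Rightarrow> complex" where
  "lap_kernel s T x = (if 0 \<le> x \<and> x \<le> T then exp (- s * of_real (T - x)) else 0)"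

lemma bdd_meas_lap_kernel: "bdd_meas (lap_kernel s T)"
proof (rule bdd_measI)
  show "lap_kernel s T \<in> borel_measurable borel" unfolding lap_kernel_def[abs_def] by measurable
  show "norm (lap_kernel s T x) \<le> exp (norm s * \<bar>T\<bar>)" for x
  proof (cases "0 \<le> x \<and> x \<le> T")
    case True
    have "norm (lap_kernel s T x) \<le> exp (norm (- s * of_real (T - x)))"
      using True by (simp only: lap_kernel_def if_True simp_thms) (rule norm_exp)
    also have "norm (- s * of_real (T - x)) \<le> norm s * \<bar>T\<bar>"
      using True by (simp add: norm_mult mult_left_mono del: of_real_diff)
    finally show ?thesis by simp
  qed (auto simp: lap_kernel_def)
qed

lemma integrable_lap_kernel: "integrable lborel (lap_kernel s T)"
  by (rule integrable_compact_support[OF bdd_meas_lap_kernel, of 0 T]) (auto simp: lap_kernel_def)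

lemma lap_kernel_transform:
  assumes "\<And>x. x \<notin> {0..T} \<Longrightarrow> h x = 0"
  shows "conv (lap_kernel s T) h T = (LINT y|lborel. h y * exp (- of_real y * s))"
proof -
  have "h y * lap_kernel s T (T - y) = h y * exp (- of_real y * s)" for y
    using assms[of y] by (cases "y \<in> {0..T}") (auto simp: lap_kernel_def mult.commute)
  then show ?thesis unfolding conv_commute[of "lap_kernel s T"] conv_def
    by (rule Bochner_Integration.integral_cong[OF refl])
qed

lemma lap_kernel_Hv:
  assumes "s \<noteq> 0" "0 \<le> z" "z \<le> T"
  shows "conv (lap_kernel s T) Hv z = (exp (- s * of_real (T - z)) - exp (- s * of_real T)) / s"
proof -
  have "(LINT y|lborel. indicator {0..z} y *\<^sub>R exp (- s * of_real (T - y)))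
      = exp (- s * of_real (T - z)) / s - exp (- s * of_real (T - 0)) / s"
  proof (rule integral_FTC_atLeastAtMost[OF \<open>0 \<le> z\<close>])
    fix x
    have "((\<lambda>w. exp (- s * (of_real T - w)) / s) has_field_derivative exp (- s * (of_real T - of_real x)))
        (at (of_real x))"
      using \<open>s \<noteq> 0\<close> by (auto intro!: derivative_eq_intros)
    from has_vector_derivative_real_field[OF this] show "((\<lambda>x. exp (- s * of_real (T - x)) / s) has_vector_derivative exp (- s * of_real (T - x)))
        (at x within {0..z})"
      by simp
  qed (intro continuous_intros)
  moreover have "lap_kernel s T y * Hv (z - y) = indicator {0..z} y *\<^sub>R exp (- s * of_real (T - y))" for y
    using assms by (auto simp: lap_kernel_def Hv_def indicator_def)
  ultimately show ?thesis by (simp add: conv_def diff_divide_distrib)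
qed

text \<open>Integration by parts on \<open>[0, T]\<close>: the primitive need not vanish at
  \<open>T\<close>, and its end value, the mass of \<open>h\<close>, leaves the boundary term.
  Associativity reduces the claim to the kernel's own primitive, computed in
  \<open>lap_kernel_Hv\<close>.\<close>

lemma lap_kernel_prim:
  assumes "s \<noteq> 0" and h: "integrable lborel h" and supp: "\<And>x. x \<notin> {0..T} \<Longrightarrow> h x = 0"
  shows "conv (lap_kernel s T) (prim h) T
    = ((LINT y|lborel. h y * exp (- of_real y * s)) - exp (- s * of_real T) * (LINT y|lborel. h y)) / s"
proof -
  have "conv (lap_kernel s T) (prim h) T = conv h (conv (lap_kernel s T) Hv) T"
    unfolding conv_assoc[OF integrable_lap_kernel h bdd_meas_Hv, symmetric]
      conv_commute[of "lap_kernel s T" h] conv_assoc[OF h integrable_lap_kernel bdd_meas_Hv] ..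
  also have "\<dots> = (LINT y|lborel. (h y * exp (- of_real y * s) - exp (- s * of_real T) * h y) / s)"
    unfolding conv_def[of h]
  proof (rule Bochner_Integration.integral_cong[OF refl])
    fix y
    show "h y * conv (lap_kernel s T) Hv (T - y) = (h y * exp (- of_real y * s) - exp (- s * of_real T) * h y) / s"
    proof (cases "y \<in> {0..T}")
      case True
      then show ?thesis
        using assms(1) by (subst lap_kernel_Hv) (auto simp: field_simps)
    qed (simp add: supp)
  qed
  also have "\<dots> = ((LINT y|lborel. h y * exp (- of_real y * s)) - exp (- s * of_real T) * (LINT y|lborel. h y)) / s"
  proof -
    have "integrable lborel (\<lambda>y. h y * lap_kernel s T (T - y))"
      by (rule conv_integrable_bdd[OF h bdd_meas_lap_kernel])
    moreover have "(\<lambda>y. h y * lap_kernel s T (T - y)) = (\<lambda>y. h y * exp (- of_real y * s))"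
    proof
      show "h y * lap_kernel s T (T - y) = h y * exp (- of_real y * s)" for y
        using supp[of y] by (cases "y \<in> {0..T}") (auto simp: lap_kernel_def mult.commute)
    qed
    ultimately have "integrable lborel (\<lambda>y. h y * exp (- of_real y * s))" by simp
    then show ?thesis using h by simp
  qed
  finally show ?thesis .
qed


lemma conv_add_left:
  assumes "integrable lborel f" "integrable lborel g" "bdd_meas k"
  shows "conv (\<lambda>y. f y + g y) k x = conv f k x + conv g k x"
  using conv_integrable_bdd[OF assms(1,3), of x] conv_integrable_bdd[OF assms(2,3), of x]
  by (simp add: conv_def distrib_right)

context delay_system
begin

section \<open>The kernel, its masses and the division operator\<close>

definition sym0 :: "complex \<Rightarrow> complex" where
  "sym0 s = 1 - a3 * exp (- of_real t3 * s) - a2 * exp (- of_real t2 * s)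
     - a23 * exp (- of_real (t2 + t3) * s) - (LINT x|lborel. N x * exp (- of_real x * s))"

definition sym1 :: "complex \<Rightarrow> complex" where
  "sym1 s = b * exp (- of_real D * s) + (LINT x|lborel. M x * exp (- of_real x * s))"

definition V :: "(real \<Rightarrow> complex) set" where
  "V = {u \<in> bdd_on {0..<L}. \<forall>x. A u x + K u x = 0}"

lemma VD: "u \<in> V \<Longrightarrow> u \<in> bdd_on {0..<L}" "u \<in> V \<Longrightarrow> A u x + K u x = 0"
  by (auto simp: V_def)

lemma V_lin:
  assumes "u \<in> V" "v \<in> V" shows "(\<lambda>x. a * u x + v x) \<in> V"
proof -
  have "A (\<lambda>x. a * u x + v x) x + K (\<lambda>x. a * u x + v x) x
      = a * (A u x + K u x) + (A v x + K v x)" for x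
    unfolding A_lin K_lin[OF bdd_on_integrable[OF VD(1)[OF assms(1)]] bdd_on_integrable[OF VD(1)[OF assms(2)]]]
    by (simp add: algebra_simps)
  then have "A (\<lambda>x. a * u x + v x) x + K (\<lambda>x. a * u x + v x) x = 0" for x
    using VD(2)[OF assms(1), of x] VD(2)[OF assms(2), of x] by simp
  moreover have "(\<lambda>x. a * u x + v x) \<in> bdd_on {0..<L}"
    by (intro bdd_on_lincomb VD(1) assms)
  ultimately show ?thesis by (simp add: V_def)
qed

lemma V_int:
  assumes "u \<in> V"
  shows "integrable lborel (lo u)" "integrable lborel (hi u)"
  using bdd_on_integrable[OF VD(1)[OF assms]] integrable_lo integrable_hi by auto

lemma integrable_sh: "integrable lborel g \<Longrightarrow> integrable lborel (sh g)"
  unfolding sh_def[abs_def]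
  by (intro Bochner_Integration.integrable_add integrable_mult_right integrable_shift_lborel)

lemma conv_sh_left:
  assumes "integrable lborel g" "bdd_meas k"
  shows "conv (sh g) k x = sh (conv g k) x"
proof -
  note i = integrable_mult_right[OF integrable_shift_lborel[OF assms(1)]]
  show ?thesis
    unfolding sh_def[abs_def]
    by (simp only: conv_add_left[OF Bochner_Integration.integrable_add[OF i i] i assms(2)]
        conv_add_left[OF i i assms(2)] conv_scale_left conv_shift_left)
qed

text \<open>Convolving the kernel equation with \<open>Hv\<close> and using associativity puts
  \<open>Hv\<close> on the two unknowns; delays commute with it.\<close>

lemma primitive_equation:
  assumes u: "u \<in> V"
  shows "prim (lo u) x - sh (prim (lo u)) x + b * prim (hi u) (x - D)
    + conv M (prim (hi u)) x - conv N (prim (lo u)) x = 0"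
proof -
  note g = V_int(1)[OF u] and f = V_int(2)[OF u]
  note bf = integrable_mult_right[OF integrable_shift_lborel[OF f], of b D]
  note Mf = integrable_conv[OF M_int f] and Ng = integrable_conv[OF N_int g]
  note sg = integrable_sh[OF g]
  let ?z = "\<lambda>x. lo u x + ((-1) * sh (lo u) x + (b * hi u (x - D) + (conv M (hi u) x + (-1) * conv N (lo u) x)))"
  have "?z x = A u x + K u x" for x by (simp add: A_def K_def)
  then have "?z = (\<lambda>_. 0)" using VD(2)[OF u] by simp
  then have "conv ?z Hv x = 0" by (simp add: conv_def)
  moreover have "conv ?z Hv x = prim (lo u) x + ((-1) * sh (prim (lo u)) x + (b * prim (hi u) (x - D)
      + (conv M (prim (hi u)) x + (-1) * conv N (prim (lo u)) x)))"
    using g f bf Mf Ng sg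
    by (simp only: conv_add_left[OF _ _ bdd_meas_Hv] integrable_mult_right Bochner_Integration.integrable_add
        conv_scale_left conv_shift_left conv_sh_left[OF g bdd_meas_Hv]
        conv_assoc[OF M_int f bdd_meas_Hv] conv_assoc[OF N_int g bdd_meas_Hv])
  ultimately show ?thesis by (simp add: algebra_simps)
qed

lemma sym_0: "sym0 0 = 1 - a3 - a2 - a23 - (LINT x|lborel. N x)" "sym1 0 = b + (LINT x|lborel. M x)"
  by (simp_all add: sym0_def sym1_def)

text \<open>The transformed equation at \<open>s = 0\<close>, obtained by evaluating the primitive
  equation at \<open>L\<close>: even after the largest delay, every primitive has already reached
  its total mass there.\<close>

lemma mass_balance:
  assumes u: "u \<in> V"
  shows "sym0 0 * (LINT x|lborel. lo u x) + sym1 0 * (LINT x|lborel. hi u x) = 0"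
proof -
  let ?g = "LINT x|lborel. lo u x" and ?f = "LINT x|lborel. hi u x"
  have g: "prim (lo u) y = ?g" if "D \<le> y" for y by (rule prim_at_top[OF lo_supp that])
  have f: "prim (hi u) y = ?f" if "t2 + t3 \<le> y" for y by (rule prim_at_top[OF hi_supp that])
  have "M y * prim (hi u) (L - y) = ?f * M y" for y
    using f[of "L - y"] M_supp[of y] by (cases "y \<in> {0..D}") (auto simp: L_def)
  then have M: "conv M (prim (hi u)) L = ?f * (LINT x|lborel. M x)"
    unfolding conv_def[of M] by (simp only: integral_mult_right_zero)
  have "N y * prim (lo u) (L - y) = ?g * N y" for y
    using g[of "L - y"] N_supp[of y] by (cases "y \<in> {0..t2 + t3}") (auto simp: L_def)
  then have N: "conv N (prim (lo u)) L = ?g * (LINT x|lborel. N x)"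
    unfolding conv_def[of N] by (simp only: integral_mult_right_zero)
  have sh: "sh (prim (lo u)) L = (a2 + a3 + a23) * ?g"
    using t2 t23 by (simp add: sh_def g L_def distrib_right)
  have "prim (lo u) L = ?g" "prim (hi u) (L - D) = ?f"
    using t2 t23 by (auto intro!: g f simp: L_def)
  with primitive_equation[OF u, of L] M N sh show ?thesis
    unfolding sym_0 by (simp add: algebra_simps)
qed

text \<open>The transforms of a kernel element are \<open>h F1\<close> and \<open>- h F0\<close> for an entire function \<open>h\<close>;
  this is \<open>h 0\<close>.\<close>

definition cc :: "(real \<Rightarrow> complex) \<Rightarrow> complex" where
  "cc u = (if sym1 0 \<noteq> 0 then (LINT x|lborel. lo u x) / sym1 0 else - (LINT x|lborel. hi u x) / sym0 0)"

text \<open>By the mass balance the pair of masses is a multiple of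
  \<open>(sym1 0, - sym0 0)\<close>, since this pair is not zero.\<close>

lemma cc:
  assumes u: "u \<in> V" and nz: "sym0 0 \<noteq> 0 \<or> sym1 0 \<noteq> 0"
  shows "(LINT x|lborel. lo u x) = cc u * sym1 0" "(LINT x|lborel. hi u x) = - cc u * sym0 0"
  using mass_balance[OF u] nz by (auto simp: cc_def field_simps add_eq_0_iff)

text \<open>In terms of transforms, \<open>R\<close> replaces \<open>h s\<close> by \<open>(h s - h 0) / s\<close>.\<close>

definition RG :: "(real \<Rightarrow> complex) \<Rightarrow> real \<Rightarrow> complex" where
  "RG u x = prim (lo u) x - cc u * (prim M x + b * Hv (x - D))"

text \<open>\<open>Hv - sh Hv - prim N\<close> is the distribution function of \<mu>0, just as
  \<open>prim M\<close> plus \<open>b\<close> times the step at \<open>D\<close> in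
  \<open>RG\<close> is that of \<mu>1.\<close>

definition RF :: "(real \<Rightarrow> complex) \<Rightarrow> real \<Rightarrow> complex" where
  "RF u x = prim (hi u) x + cc u * (Hv x - sh Hv x - prim N x)"

definition R :: "(real \<Rightarrow> complex) \<Rightarrow> real \<Rightarrow> complex" where
  "R u x = RG u x + RF u (x - D)"

text \<open>From \<open>D\<close> on both primitives are constant, equal to the total masses, and
  \<open>cc\<close> was chosen to make these cancel.\<close>

lemma RG_supp:
  assumes u: "u \<in> V" and nz: "sym0 0 \<noteq> 0 \<or> sym1 0 \<noteq> 0" and "x < 0 \<or> D \<le> x"
  shows "RG u x = 0"
proof (cases "x < 0")
  case True
  have "prim (lo u) x = 0" "prim M x = 0"
    using prim_neg[OF lo_supp True] prim_neg[OF M_supp True] by auto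
  then show ?thesis using True D t2 t23 by (simp add: RG_def Hv_def)
next
  case False
  then have x: "D \<le> x" using assms by simp
  have "prim (lo u) x = (LINT y|lborel. lo u y)" by (rule prim_at_top[OF lo_supp x])
  moreover have "prim M x = (LINT y|lborel. M y)" by (rule prim_at_top[OF M_supp x])
  moreover have "Hv (x - D) = 1" using x by (simp add: Hv_def)
  ultimately show ?thesis
    unfolding RG_def cc(1)[OF u nz] sym_0 by (simp add: algebra_simps)
qed

lemma RF_supp:
  assumes u: "u \<in> V" and nz: "sym0 0 \<noteq> 0 \<or> sym1 0 \<noteq> 0" and "x < 0 \<or> t2 + t3 \<le> x"
  shows "RF u x = 0"
proof (cases "x < 0")
  case True
  have "prim (hi u) x = 0" "prim N x = 0"
    using prim_neg[OF hi_supp True] prim_neg[OF N_supp True] by auto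
  then show ?thesis using True t2 t23 by (simp add: RF_def Hv_def sh_def)
next
  case False
  then have x: "t2 + t3 \<le> x" using assms by simp
  have "prim (hi u) x = (LINT y|lborel. hi u y)" by (rule prim_at_top[OF hi_supp x])
  moreover have "prim N x = (LINT y|lborel. N y)" by (rule prim_at_top[OF N_supp x])
  moreover have "sh Hv x = a2 + a3 + a23" "Hv x = 1" using x t2 t23 by (simp_all add: Hv_def sh_def)
  ultimately show ?thesis
    unfolding RF_def cc(2)[OF u nz] sym_0 by (simp add: algebra_simps)
qed

lemma lo_R:
  assumes "u \<in> V" "sym0 0 \<noteq> 0 \<or> sym1 0 \<noteq> 0"
  shows "lo (R u) = RG u"
  using RG_supp[OF assms] RF_supp[OF assms] by (auto simp: lo_def R_def fun_eq_iff not_less)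

lemma hi_R:
  assumes "u \<in> V" "sym0 0 \<noteq> 0 \<or> sym1 0 \<noteq> 0"
  shows "hi (R u) = RF u"
  using RG_supp[OF assms] RF_supp[OF assms] by (auto simp: hi_def R_def fun_eq_iff not_less)

lemma bdd_meas_sh: "bdd_meas h \<Longrightarrow> bdd_meas (sh h)"
  unfolding sh_def[abs_def] by (intro bdd_meas_add bdd_meas_scale bdd_meas_shift)

text \<open>The integrated equation holds for the primitives of the old pair, and the correction
  contributes \<open>cc u\<close> times \<mu>0 * \<mu>1 - \<mu>1 * \<mu>0, integrated once, which is
  0.\<close>

lemma R_V:
  assumes u: "u \<in> V" and nz: "sym0 0 \<noteq> 0 \<or> sym1 0 \<noteq> 0"
  shows "R u \<in> V"
proof -
  note g = V_int(1)[OF u] and f = V_int(2)[OF u]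
  note bm = bdd_meas_prim[OF g] bdd_meas_prim[OF f] bdd_meas_prim[OF M_int] bdd_meas_prim[OF N_int]
    bdd_meas_Hv bdd_meas_sh[OF bdd_meas_Hv]
  have "bdd_meas (RG u)" "bdd_meas (RF u)"
    unfolding RG_def[abs_def] RF_def[abs_def]
    by (intro bdd_meas_diff bdd_meas_add bdd_meas_scale bdd_meas_shift[of Hv] bm)+
  then have "bdd_meas (R u)" unfolding R_def[abs_def] by (intro bdd_meas_add bdd_meas_shift[of "RF u"])
  moreover have "R u x = 0" if "x \<notin> {0..<L}" for x
    using RG_supp[OF u nz, of x] RF_supp[OF u nz, of "x - D"] that D t2 t23
    by (cases "x < 0") (auto simp: R_def L_def)
  ultimately have "R u \<in> bdd_on {0..<L}" by (simp add: bdd_on_def)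
  moreover have "A (R u) x + K (R u) x = 0" for x
  proof -
    let ?c = "cc u"
    \<comment> \<open>The commutator of the two integral parts, the one cancellation that goes
      beyond algebra with delays.\<close>
    have NM: "conv N (prim M) = conv M (prim N)"
      unfolding conv_assoc[OF N_int M_int bdd_meas_Hv, symmetric] conv_commute[of N M]
        conv_assoc[OF M_int N_int bdd_meas_Hv] ..
    have F: "conv M (RF u) x = conv M (prim (hi u)) x + ?c * (prim M x - sh (prim M) x - conv M (prim N) x)"
    proof -
      have sh: "conv M (sh Hv) x = sh (prim M) x"
        using conv_sh_left[OF M_int bdd_meas_Hv] 
        by (simp add: sh_def[abs_def] conv_add[OF M_int] conv_scale conv_shift bdd_meas_add bdd_meas_scale
            bdd_meas_shift bdd_meas_Hv)
      have "conv M (\<lambda>x. Hv x - sh Hv x - prim N x) x = prim M x - sh (prim M) x - conv M (prim N) x"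
        by (simp only: conv_diff[OF M_int bdd_meas_diff[OF bm(5,6)] bm(4)] conv_diff[OF M_int bm(5,6)] sh)
      moreover have "bdd_meas (\<lambda>x. Hv x - sh Hv x - prim N x)" by (intro bdd_meas_diff bm)
      ultimately show ?thesis
        unfolding RF_def[abs_def] by (subst conv_add[OF M_int bm(2) bdd_meas_scale]) (simp_all add: conv_scale)
    qed
    have G: "conv N (RG u) x = conv N (prim (lo u)) x - ?c * (conv M (prim N) x + b * prim N (x - D))"
    proof -
      have "conv N (\<lambda>x. prim M x + b * Hv (x - D)) x = conv M (prim N) x + b * prim N (x - D)"
        by (subst conv_add[OF N_int bm(3) bdd_meas_scale[OF bdd_meas_shift[OF bm(5)]]])
           (simp add: conv_scale conv_shift NM)
      moreover have "bdd_meas (\<lambda>x. prim M x + b * Hv (x - D))"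
        by (intro bdd_meas_add bdd_meas_scale bdd_meas_shift[of Hv] bm)
      ultimately show ?thesis
        unfolding RG_def[abs_def] by (subst conv_diff[OF N_int bm(1) bdd_meas_scale]) (simp_all add: conv_scale)
    qed
    have shG: "sh (RG u) x = sh (prim (lo u)) x - ?c * (sh (prim M) x + b * sh Hv (x - D))"
      by (simp add: sh_def RG_def algebra_simps)
    have "A (R u) x + K (R u) x = RG u x - sh (RG u) x + b * RF u (x - D) + conv M (RF u) x - conv N (RG u) x"
      by (simp add: A_def K_def lo_R[OF u nz] hi_R[OF u nz])
    also have "\<dots> = prim (lo u) x - sh (prim (lo u)) x + b * prim (hi u) (x - D)
        + conv M (prim (hi u)) x - conv N (prim (lo u)) x"
      unfolding F G shG RG_def[of u x] RF_def[of u "x - D"] by (simp add: algebra_simps)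
    finally show ?thesis using primitive_equation[OF u] by simp
  qed
  ultimately show ?thesis by (simp add: V_def)
qed

lemma R_lin:
  assumes u: "u \<in> V" and v: "v \<in> V"
  shows "R (\<lambda>x. a * u x + v x) = (\<lambda>x. a * R u x + R v x)"
proof -
  note i = V_int[OF u] V_int[OF v]
  have c: "cc (\<lambda>x. a * u x + v x) = a * cc u + cc v"
    using i by (simp add: cc_def lo_lin hi_lin add_divide_distrib diff_divide_distrib)
  have p: "prim (\<lambda>x. a * g x + h x) x = a * prim g x + prim h x"
    if "integrable lborel g" "integrable lborel h" for g h x
    by (simp only: conv_add_left[OF integrable_mult_right[OF that(1)] that(2) bdd_meas_Hv] conv_scale_left)
  show ?thesis
    unfolding fun_eq_iff R_def RG_def RF_def c lo_lin hi_lin p[OF i(1,3)] p[OF i(2,4)]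
    by (simp add: algebra_simps)
qed

text \<open>The step with coefficient \<open>a23\<close> starts at the right end of the window and
  contributes nothing. Its exponential returns in \<open>eigen_cc_zero\<close> through the mass
  term.\<close>

lemma Laplace_sh_Hv:
  assumes "s \<noteq> 0"
  shows "conv (lap_kernel s (t2 + t3)) (\<lambda>x. Hv x - sh Hv x) (t2 + t3)
    = (1 - exp (- s * of_real (t2 + t3))
       - a2 * (exp (- s * of_real t2) - exp (- s * of_real (t2 + t3)))
       - a3 * (exp (- s * of_real t3) - exp (- s * of_real (t2 + t3)))) / s"
proof -
  let ?T = "t2 + t3"
  let ?k = "lap_kernel s ?T"
  note k = integrable_lap_kernel[of s ?T]
  note bs = bdd_meas_scale[OF bdd_meas_shift[OF bdd_meas_Hv]]
  have H: "conv ?k Hv (?T - d) = (exp (- s * of_real d) - exp (- s * of_real ?T)) / s" if "0 \<le> d" "d \<le> ?T" for d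
    using that t2 t23 by (subst lap_kernel_Hv[OF assms]) auto
  have "conv ?k (sh Hv) ?T = a2 * conv ?k Hv (?T - t2) + a3 * conv ?k Hv (?T - t3) + a23 * conv ?k Hv (?T - ?T)"
    unfolding sh_def[abs_def]
    by (simp only: conv_add[OF k bdd_meas_add[OF bs bs] bs] conv_add[OF k bs bs] conv_scale conv_shift)
  also have "\<dots> = (a2 * (exp (- s * of_real t2) - exp (- s * of_real ?T))
       + a3 * (exp (- s * of_real t3) - exp (- s * of_real ?T))) / s"
  proof -
    have "conv ?k Hv (?T - ?T) = 0" using H[of ?T] t2 t23 by simp
    then show ?thesis using H[of t2] H[of t3] t2 t23 by (simp add: add_divide_distrib)
  qed
  finally have "conv ?k (sh Hv) ?T = \<dots>" .
  moreover have "conv ?k Hv ?T = (1 - exp (- s * of_real ?T)) / s"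
    using H[of 0] t2 t23 by simp
  ultimately show ?thesis
    by (simp only: conv_diff[OF k bdd_meas_Hv bdd_meas_sh[OF bdd_meas_Hv]]) (simp add: diff_divide_distrib add_divide_distrib)
qed

lemma RG_eigen:
  assumes u: "u \<in> V" and nz: "sym0 0 \<noteq> 0 \<or> sym1 0 \<noteq> 0" and eig: "\<And>x. R u x = l * u x"
  shows "RG u = (\<lambda>x. l * lo u x)"
  unfolding lo_R[OF u nz, symmetric] by (simp add: lo_def eig fun_eq_iff)

lemma RF_eigen:
  assumes u: "u \<in> V" and nz: "sym0 0 \<noteq> 0 \<or> sym1 0 \<noteq> 0" and eig: "\<And>x. R u x = l * u x"
  shows "RF u = (\<lambda>x. l * hi u x)"
  unfolding hi_R[OF u nz, symmetric] by (simp add: hi_def eig fun_eq_iff)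

text \<open>The transform of \<open>RG u\<close> at \<open>s\<close> is that of \<open>lo u\<close>
  minus \<open>cc u * sym1 s\<close>, divided by \<open>s\<close>, and similarly for
  \<open>RF u\<close>. For an eigenvector it also equals \<open>l\<close> times the old transform;
  at \<open>s = 1 / l\<close> only the correction survives.\<close>

lemma eigen_cc_zero:
  assumes u: "u \<in> V" and nz: "\<And>s. sym0 s \<noteq> 0 \<or> sym1 s \<noteq> 0" and eig: "\<And>x. R u x = l * u x"
  shows "cc u = 0"
proof -
  note G = RG_eigen[OF u nz eig] and F = RF_eigen[OF u nz eig]
  show ?thesis
  proof (cases "l = 0")
    case True
    \<comment> \<open>At 0 all primitives of functions vanish and the delayed steps have not begun,
      so only the atom of \<mu>0 at 0 contributes.\<close>
    have "prim (hi u) 0 = 0" "prim N 0 = 0" using prim_0[OF hi_supp] prim_0[OF N_supp] by auto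
    then have "RF u 0 = cc u" using t2 t23 by (simp add: RF_def Hv_def sh_def)
    then show ?thesis using F True by simp
  next
    case False
    define s where "s = 1 / l"
    have s: "s \<noteq> 0" "l = 1 / s" using False by (auto simp: s_def)
    note g = V_int(1)[OF u] and f = V_int(2)[OF u]
    let ?c = "cc u"
    let ?E = "exp (- s * of_real D)" and ?T = "t2 + t3"
    let ?e = "exp (- s * of_real ?T)"
    let ?lap = "\<lambda>h. LINT y|lborel. h y * exp (- of_real y * s)"
    let ?m = "\<lambda>h :: real \<Rightarrow> complex. LINT y|lborel. h y"
    \<comment> \<open>\<open>P\<close> is the unknown transform. It occurs as \<open>P / s\<close>
      on both sides because \<open>l = 1 / s\<close>.\<close>
    have cancel: "- e + c * Y = 0" if "(P - e) / s + c * (Y / s) = l * P" for P e c Y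
    proof -
      have "(P - e + c * Y) / s = P / s" using that s by (simp add: add_divide_distrib diff_divide_distrib)
      then show ?thesis using s by simp
    qed
    have lap: "conv (lap_kernel s D) (prim (lo u)) D = (?lap (lo u) - ?E * ?m (lo u)) / s"
      "conv (lap_kernel s D) (prim M) D = (?lap M - ?E * ?m M) / s"
      "conv (lap_kernel s ?T) (prim (hi u)) ?T = (?lap (hi u) - ?e * ?m (hi u)) / s"
      "conv (lap_kernel s ?T) (prim N) ?T = (?lap N - ?e * ?m N) / s"
      "conv (lap_kernel s D) (lo u) D = ?lap (lo u)" "conv (lap_kernel s ?T) (hi u) ?T = ?lap (hi u)"
      using lap_kernel_prim[OF s(1) g, of D] lap_kernel_prim[OF s(1) f, of ?T]
        lap_kernel_prim[OF s(1) M_int M_supp] lap_kernel_prim[OF s(1) N_int N_supp]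
        lap_kernel_transform[of D "lo u"] lap_kernel_transform[of ?T "hi u"] lo_supp hi_supp by blast+
    have "conv (lap_kernel s D) (RG u) D = (?lap (lo u) - ?E * ?m (lo u)) / s - ?c * ((?lap M - ?E * ?m M) / s)"
    proof -
      note k = integrable_lap_kernel[of s D]
      have "conv (lap_kernel s D) Hv (D - D) = 0"
        using lap_kernel_Hv[OF s(1), of 0 D] D t2 t23 by simp
      then have "conv (lap_kernel s D) (\<lambda>x. prim M x + b * Hv (x - D)) D = conv (lap_kernel s D) (prim M) D"
        by (simp only: conv_add[OF k bdd_meas_prim[OF M_int] bdd_meas_scale[OF bdd_meas_shift[OF bdd_meas_Hv]]] conv_scale conv_shift) simp
      then show ?thesis
        unfolding RG_def[abs_def]
        by (subst conv_diff[OF k bdd_meas_prim[OF g] bdd_meas_scale[OF bdd_meas_add[OF bdd_meas_prim[OF M_int] bdd_meas_scale[OF bdd_meas_shift[OF bdd_meas_Hv]]]]])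
           (simp only: conv_scale lap)
    qed
    moreover have "conv (lap_kernel s D) (RG u) D = l * ?lap (lo u)"
      unfolding G conv_scale lap ..
    ultimately have "- (?E * ?m (lo u)) + (- ?c) * (?lap M - ?E * ?m M) = 0"
      by (intro cancel[of "?lap (lo u)"]) simp
    \<comment> \<open>Replacing the mass of \<open>lo u\<close> by \<open>cc u * sym1 0\<close>
      makes the boundary terms at \<open>D\<close> combine to the missing term
      \<open>b * exp (- D * s)\<close>.\<close>
    moreover have "?c * sym1 s = - (- (?E * ?m (lo u)) + (- ?c) * (?lap M - ?E * ?m M))"
      unfolding cc(1)[OF u nz] sym_0 sym1_def by (simp add: algebra_simps)
    ultimately have "?c * sym1 s = 0" by simp
    moreover have "?c * sym0 s = 0"
    proof -
      note k = integrable_lap_kernel[of s ?T]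
      have bH: "bdd_meas (\<lambda>x. Hv x - sh Hv x)" by (intro bdd_meas_diff bdd_meas_Hv bdd_meas_sh)
      have "conv (lap_kernel s ?T) (RF u) ?T = (?lap (hi u) - ?e * ?m (hi u)) / s
        + ?c * ((1 - ?e - a2 * (exp (- s * of_real t2) - ?e) - a3 * (exp (- s * of_real t3) - ?e)) / s
          - (?lap N - ?e * ?m N) / s)"
        unfolding RF_def[abs_def]
        by (subst conv_add[OF k bdd_meas_prim[OF f] bdd_meas_scale[OF bdd_meas_diff[OF bH bdd_meas_prim[OF N_int]]]])
           (simp only: conv_scale conv_diff[OF k bH bdd_meas_prim[OF N_int]] Laplace_sh_Hv[OF s(1)] lap)
      moreover have "conv (lap_kernel s ?T) (RF u) ?T = l * ?lap (hi u)"
        unfolding F conv_scale lap ..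
      ultimately have "- (?e * ?m (hi u)) + ?c * ((1 - ?e - a2 * (exp (- s * of_real t2) - ?e)
          - a3 * (exp (- s * of_real t3) - ?e)) - (?lap N - ?e * ?m N)) = 0"
        by (intro cancel[of "?lap (hi u)"]) (simp only: diff_divide_distrib)
      moreover have "?c * sym0 s = - (?e * ?m (hi u)) + ?c * ((1 - ?e - a2 * (exp (- s * of_real t2) - ?e)
          - a3 * (exp (- s * of_real t3) - ?e)) - (?lap N - ?e * ?m N))"
        unfolding cc(2)[OF u nz] sym_0 sym0_def by (simp add: algebra_simps)
      ultimately show ?thesis by simp
    qed
    ultimately show ?thesis using nz[of s] by auto
  qed
qed

text \<open>An identity at every point: it upgrades vanishing almost everywhere to vanishing
  everywhere, and identifies the kernel with solutions of \<open>u + J (K u) = 0\<close>.\<close>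

lemma V_fixed: 
  assumes u: "u \<in> V"
  shows "u x = - J (K u) x"
proof -
  have "u = J (\<lambda>x. - 1 * K u x)"
  proof (rule J_A)
    show "u x = 0" if "x \<notin> {0..<L}" for x using VD(1)[OF u] that by (auto simp: bdd_on_def)
    show "A u x = - 1 * K u x" for x using VD(2)[OF u, of x] by (simp add: eq_neg_iff_add_eq_0)
  qed
  from fun_cong[OF this, of x] show ?thesis unfolding J_scale by simp
qed

lemma no_eigenvector:
  assumes u: "u \<in> V" and nz: "\<And>s. sym0 s \<noteq> 0 \<or> sym1 s \<noteq> 0" and eig: "\<And>x. R u x = l * u x"
  shows "u = (\<lambda>_. 0)"
proof -
  have c: "cc u = 0" by (rule eigen_cc_zero[OF assms])
  have g: "prim (lo u) x = l * lo u x" for x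
    using fun_cong[OF RG_eigen[OF u nz eig], of x] by (simp add: RG_def c)
  have f: "prim (hi u) x = l * hi u x" for x
    using fun_cong[OF RF_eigen[OF u nz eig], of x] by (simp add: RF_def c)
  have bu: "bdd_meas u" using VD(1)[OF u] by (simp add: bdd_on_def)
  have m: "lo u \<in> borel_measurable borel" "hi u \<in> borel_measurable borel"
    using bu by (auto intro!: measurable_parts bdd_meas_measurable)
  have ae: "AE x in lborel. lo u x = 0" "AE x in lborel. hi u x = 0"
  proof -
    show "AE x in lborel. lo u x = 0"
    proof (cases "l = 0")
      case True
      show ?thesis by (rule prim_eq_0_imp_AE[of "lo u" D]) (simp_all add: V_int[OF u] lo_supp g True)
    next
      case False
      show ?thesis using prim_eigenfunction_zero[of "lo u" D l] bdd_meas_lo[OF bu] lo_supp False g by simp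
    qed
    show "AE x in lborel. hi u x = 0"
    proof (cases "l = 0")
      case True
      show ?thesis by (rule prim_eq_0_imp_AE[of "hi u" "t2 + t3"]) (simp_all add: V_int[OF u] hi_supp f True)
    next
      case False
      show ?thesis using prim_eigenfunction_zero[of "hi u" "t2 + t3" l] bdd_meas_hi[OF bu] hi_supp False f by simp
    qed
  qed
  \<comment> \<open>Integrals do not see the null sets left over so far; through
    \<open>V_fixed\<close> the vanishing of \<open>K u\<close> then forces \<open>u\<close> to be
    zero at every point.\<close>
  have "K u x = 0" for x
    unfolding K_def conv_commute[of M] conv_commute[of N]
    using conv_AE_zero[OF ae(2) m(2) bdd_meas_measurable[OF M]] conv_AE_zero[OF ae(1) m(1) bdd_meas_measurable[OF N]]
    by simp
  then have K0: "K u = (\<lambda>_. 0)" by blast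
  have "u x = 0" for x using V_fixed[OF u, of x] unfolding K0 J_zero by simp
  then show ?thesis by blast
qed

lemma kernel_trivial:
  assumes nz: "\<And>s. sym0 s \<noteq> 0 \<or> sym1 s \<noteq> 0"
    and u: "u \<in> bdd_on {0..<L}" "\<And>x. A u x + K u x = 0"
  shows "u = (\<lambda>_. 0)"
proof -
  obtain S \<phi> e n C where spl: "splitting S \<phi> e n C" using J_K_splitting by blast
  note sp = splittingD[OF spl]
  have uV: "u \<in> V" using u by (simp add: V_def)
  show ?thesis
  proof (rule no_eigenvector_imp_trivial[where V=V and Z="{0..<L}" and R=R and \<phi>=\<phi> and n=n])
    show "V \<subseteq> bdd_on {0..<L}" using VD(1) by blast
    show "(\<lambda>x. a * u x + v x) \<in> V" if "u \<in> V" "v \<in> V" for a u v using that by (rule V_lin)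
    show "R u \<in> V" if "u \<in> V" for u using that nz by (rule R_V)
    show "R (\<lambda>x. a * u x + v x) = (\<lambda>x. a * R u x + R v x)" if "u \<in> V" "v \<in> V" for a u v
      using that by (rule R_lin)
    show "\<phi> i (\<lambda>x. a * u x + v x) = a * \<phi> i u + \<phi> i v"
      if "u \<in> bdd_on {0..<L}" "v \<in> bdd_on {0..<L}" for a u v i using that by (rule sp(4))
    show "u = (\<lambda>_. 0)" if u: "u \<in> V" and \<phi>: "\<And>i. i < n \<Longrightarrow> \<phi> i u = 0" for u
    proof -
      \<comment> \<open>Without the functionals \<open>J K\<close> reduces to \<open>S\<close>, so
        \<open>u = - S u\<close>, and repeated halving gives \<open>u = 0\<close>.\<close>
      have uS: "norm (u x) = norm (S u x)" for x
      proof -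
        have "S u x = J (K u) x" using sp(7)[OF VD(1)[OF u], of x] \<phi> by simp
        then show ?thesis using V_fixed[OF u, of x] by simp
      qed
      obtain B where B: "\<And>x. norm (u x) \<le> B" using VD(1)[OF u] by (auto simp: bdd_on_def bdd_meas_def)
      have bk: "norm (u x) \<le> B / 2 ^ k" for k x
      proof (induction k arbitrary: x)
        case 0
        show ?case using B by simp
      next
        case (Suc k)
        show ?case using sp(3)[OF VD(1)[OF u] Suc, of x] unfolding uS[of x] by simp
      qed
      have "u x = 0" for x
      proof -
        have "(\<lambda>k. B * (1 / 2) ^ k) \<longlonglongrightarrow> B * 0" by (intro tendsto_intros) auto
        then have "norm (u x) \<le> 0"
          using bk[of x] by (intro LIMSEQ_le_const[of "\<lambda>k. B * (1 / 2) ^ k"]) (auto simp: power_divide)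
        then show ?thesis by simp
      qed
      then show ?thesis by blast
    qed
    show "u = (\<lambda>_. 0)" if "u \<in> V" "\<And>x. R u x = l * u x" for u l
      using that(1) nz that(2) by (rule no_eigenvector)
    show "u \<in> V" by (rule uV)
  qed
qed

end

section \<open>Square-integrable data\<close>

definition sq_int :: "(real \<Rightarrow> complex) \<Rightarrow> bool" where
  "sq_int u \<longleftrightarrow> u \<in> borel_measurable borel \<and> integrable lborel (\<lambda>x. (norm (u x))\<^sup>2)"

text \<open>The square of the L2 norm; roots are taken only in the final estimate on
  \<open>X\<close>.\<close>

definition sq_norm :: "(real \<Rightarrow> complex) \<Rightarrow> real" where
  "sq_norm u = (LINT x|lborel. (norm (u x))\<^sup>2)"

lemma sq_norm_nonneg: "0 \<le> sq_norm u"
  by (simp add: sq_norm_def)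

lemma sq_int_bound:
  assumes v: "sq_int v" and u: "u \<in> borel_measurable borel" and le: "\<And>x. norm (u x) \<le> c * norm (v x)"
  shows "sq_int u" "sq_norm u \<le> c\<^sup>2 * sq_norm v"
proof -
  have le': "(norm (u x))\<^sup>2 \<le> c\<^sup>2 * (norm (v x))\<^sup>2" for x
    using power_mono[OF le[of x], of 2] by (simp add: power_mult_distrib)
  have iv: "integrable lborel (\<lambda>x. c\<^sup>2 * (norm (v x))\<^sup>2)" using v by (simp add: sq_int_def)
  have iu: "integrable lborel (\<lambda>x. (norm (u x))\<^sup>2)"
    by (rule Bochner_Integration.integrable_bound[OF iv]) (use u le' in auto)
  then show "sq_int u" using u by (simp add: sq_int_def)
  have "sq_norm u \<le> (LINT x|lborel. c\<^sup>2 * (norm (v x))\<^sup>2)"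
    unfolding sq_norm_def by (rule integral_mono[OF iu iv le'])
  then show "sq_norm u \<le> c\<^sup>2 * sq_norm v" by (simp add: sq_norm_def)
qed

lemma sq_int_add:
  assumes u: "sq_int u" and v: "sq_int v"
  shows "sq_int (\<lambda>x. u x + v x)" "sq_norm (\<lambda>x. u x + v x) \<le> 2 * sq_norm u + 2 * sq_norm v"
proof -
  have le: "(norm (u x + v x))\<^sup>2 \<le> 2 * (norm (u x))\<^sup>2 + 2 * (norm (v x))\<^sup>2" for x
  proof -
    have "(norm (u x + v x))\<^sup>2 \<le> (norm (u x) + norm (v x))\<^sup>2"
      by (intro power_mono norm_triangle_ineq) auto
    also have "\<dots> \<le> 2 * (norm (u x))\<^sup>2 + 2 * (norm (v x))\<^sup>2"
      using sum_squares_bound[of "norm (u x)" "norm (v x)"] by (simp add: power2_sum)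
    finally show ?thesis .
  qed
  have m: "(\<lambda>x. u x + v x) \<in> borel_measurable borel"
    by (intro borel_measurable_add) (use u v in \<open>simp_all add: sq_int_def\<close>)
  have i: "integrable lborel (\<lambda>x. 2 * (norm (u x))\<^sup>2 + 2 * (norm (v x))\<^sup>2)" using u v by (simp add: sq_int_def)
  have iu: "integrable lborel (\<lambda>x. (norm (u x + v x))\<^sup>2)"
    by (rule Bochner_Integration.integrable_bound[OF i]) (use m le in auto)
  then show "sq_int (\<lambda>x. u x + v x)" using m by (simp add: sq_int_def)
  have "sq_norm (\<lambda>x. u x + v x) \<le> (LINT x|lborel. 2 * (norm (u x))\<^sup>2 + 2 * (norm (v x))\<^sup>2)"
    unfolding sq_norm_def by (rule integral_mono[OF iu i le])
  also have "\<dots> = 2 * sq_norm u + 2 * sq_norm v"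
    using u v by (simp add: sq_norm_def sq_int_def)
  finally show "sq_norm (\<lambda>x. u x + v x) \<le> 2 * sq_norm u + 2 * sq_norm v" .
qed

lemma sq_int_scale:
  assumes "sq_int u" shows "sq_int (\<lambda>x. a * u x)" "sq_norm (\<lambda>x. a * u x) \<le> (norm a)\<^sup>2 * sq_norm u"
  using sq_int_bound[OF assms, of "\<lambda>x. a * u x" "norm a"] assms by (auto simp: norm_mult sq_int_def)

lemma sq_int_shift:
  assumes "sq_int u" shows "sq_int (\<lambda>x. u (x - d))" "sq_norm (\<lambda>x. u (x - d)) = sq_norm u"
proof -
  have [measurable]: "u \<in> borel_measurable borel" using assms by (simp add: sq_int_def)
  show "sq_int (\<lambda>x. u (x - d))"
    using integrable_shift_lborel[of "\<lambda>x. (norm (u x))\<^sup>2" d] assms by (simp add: sq_int_def)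
  show "sq_norm (\<lambda>x. u (x - d)) = sq_norm u"
    unfolding sq_norm_def by (rule integral_shift_lborel[of "\<lambda>x. (norm (u x))\<^sup>2"])
qed

lemma sq_int_add_scaled:
  assumes "sq_int u" "sq_int v"
  shows "sq_int (\<lambda>x. a * u x + v x)"
  by (intro sq_int_add sq_int_scale assms)

lemma bdd_on_sq_int:
  assumes u: "u \<in> bdd_on {0..<T}" and c: "\<And>x. norm (u x) \<le> c" and T: "0 \<le> T"
  shows "sq_int u" "sq_norm u \<le> c\<^sup>2 * T"
proof -
  have i: "integrable lborel (\<lambda>x. c\<^sup>2 * indicator {0..T} x :: real)"
    by (intro integrable_mult_right) (simp add: integrable_indicator_iff emeasure_lborel_Icc_eq)
  have le: "(norm (u x))\<^sup>2 \<le> c\<^sup>2 * indicator {0..T} x" for x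
    using u power_mono[OF c[of x], of 2] by (cases "x \<in> {0..<T}") (auto simp: bdd_on_def indicator_def)
  have m: "u \<in> borel_measurable borel" using u by (simp add: bdd_on_def bdd_meas_def)
  have iu: "integrable lborel (\<lambda>x. (norm (u x))\<^sup>2)"
    by (rule Bochner_Integration.integrable_bound[OF i]) (use m le in auto)
  then show "sq_int u" using m by (simp add: sq_int_def)
  have "sq_norm u \<le> (LINT x|lborel. c\<^sup>2 * indicator {0..T} x)"
    unfolding sq_norm_def by (rule integral_mono[OF iu i le])
  then show "sq_norm u \<le> c\<^sup>2 * T" using T by simp
qed

text \<open>On the support \<open>norm (u x)\<close> is at most 1 plus its square, which gives
  integrability. The inequality is Cauchy-Schwarz against the indicator of the interval.\<close>

lemma sq_int_integrable:
  assumes u: "sq_int u" and supp: "\<And>x. x \<notin> {0..<T} \<Longrightarrow> u x = 0" and T: "0 < T"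
  shows "integrable lborel u" "(LINT x|lborel. norm (u x))\<^sup>2 \<le> T * sq_norm u"
proof -
  have m: "u \<in> borel_measurable borel" and i2: "integrable lborel (\<lambda>x. (norm (u x))\<^sup>2)"
    using u by (auto simp: sq_int_def)
  have ind: "integrable lborel (indicator {0..<T} :: real \<Rightarrow> real)"
    using T by (simp add: integrable_indicator_iff)
  have "norm (u x) \<le> indicator {0..<T} x + (norm (u x))\<^sup>2" for x
  proof (cases "x \<in> {0..<T}")
    case True
    have "2 * norm (u x) \<le> (norm (u x))\<^sup>2 + 1" using sum_squares_bound[of "norm (u x)" 1] by simp
    then have "norm (u x) \<le> 1 + (norm (u x))\<^sup>2" using norm_ge_zero[of "u x"] by linarith
    then show ?thesis using True by simp
  qed (simp add: supp)
  then show iu: "integrable lborel u"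
    by (intro Bochner_Integration.integrable_bound[OF Bochner_Integration.integrable_add[OF ind i2]]) (use m in auto)
  let ?I = "LINT x|lborel. norm (u x)"
  \<comment> \<open>The mean value of \<open>norm (u x)\<close> over the interval; nonnegativity of
    the variance is the Cauchy-Schwarz inequality.\<close>
  define m where "m = ?I / T"
  have "0 \<le> (LINT x|lborel. (norm (u x) - m * indicator {0..<T} x)\<^sup>2)" by simp
  also have "(\<lambda>x. (norm (u x) - m * indicator {0..<T} x)\<^sup>2)
      = (\<lambda>x. (norm (u x))\<^sup>2 - (2 * m * norm (u x) - m\<^sup>2 * indicator {0..<T} x))"
  proof
    show "(norm (u x) - m * indicator {0..<T} x)\<^sup>2 = (norm (u x))\<^sup>2 - (2 * m * norm (u x) - m\<^sup>2 * indicator {0..<T} x)" for x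
      using supp[of x] by (cases "x \<in> {0..<T}") (auto simp: power2_diff)
  qed
  also have "(LINT x|lborel. (norm (u x))\<^sup>2 - (2 * m * norm (u x) - m\<^sup>2 * indicator {0..<T} x))
      = sq_norm u - (2 * m * ?I - m\<^sup>2 * T)"
    using i2 iu ind T by (simp add: sq_norm_def)
  also have "\<dots> = sq_norm u - ?I\<^sup>2 / T"
    using T by (simp add: m_def power2_eq_square field_simps)
  finally show "?I\<^sup>2 \<le> T * sq_norm u" using T by (simp add: field_simps)
qed

context delay_system
begin

section \<open>L2 bounds and solvability of the complex system\<close>

lemma L_pos: "0 < L"
  using t2 t23 D by (simp add: L_def)

lemma sq_int_lo:
  assumes "sq_int u" shows "sq_int (lo u)" "sq_norm (lo u) \<le> sq_norm u"
  using sq_int_bound[OF assms, of "lo u" 1] assms measurable_parts(1)[of u]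
  by (auto simp: sq_int_def lo_def[abs_def])

lemma sq_int_hi:
  assumes "sq_int u" shows "sq_int (hi u)"
  using sq_int_bound(1)[OF sq_int_shift(1)[OF assms, of "-D"], of "hi u" 1] assms measurable_parts(2)[of u]
  by (auto simp: sq_int_def hi_def[abs_def])

lemma sq_int_sh:
  assumes "sq_int u"
  shows "sq_int (sh u)"
    "sq_norm (sh u) \<le> (4 * (norm a2)\<^sup>2 + 4 * (norm a3)\<^sup>2 + 2 * (norm a23)\<^sup>2) * sq_norm u"
proof -
  have s: "sq_int (\<lambda>x. c * u (x - d))" and n: "sq_norm (\<lambda>x. c * u (x - d)) \<le> (norm c)\<^sup>2 * sq_norm u" for c d
    using sq_int_scale[OF sq_int_shift(1)[OF assms, of d], of c] sq_int_shift(2)[OF assms, of d] by simp_all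
  show "sq_int (sh u)"
    unfolding sh_def[abs_def] by (intro sq_int_add s)
  have "sq_norm (sh u) \<le> 2 * (2 * sq_norm (\<lambda>x. a2 * u (x - t2)) + 2 * sq_norm (\<lambda>x. a3 * u (x - t3)))
      + 2 * sq_norm (\<lambda>x. a23 * u (x - (t2 + t3)))"
  proof -
    have arith: "p \<le> 2 * (2 * r + 2 * s) + 2 * q" if "p \<le> 2 * m + 2 * q" "m \<le> 2 * r + 2 * s" for p q m r s :: real
      using that by simp
    show ?thesis
      unfolding sh_def[abs_def]
      using sq_int_add(2)[OF sq_int_add(1)[OF s s] s] sq_int_add(2)[OF s s] by (rule arith)
  qed
  then show "sq_norm (sh u) \<le> (4 * (norm a2)\<^sup>2 + 4 * (norm a3)\<^sup>2 + 2 * (norm a23)\<^sup>2) * sq_norm u"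
    using n[of a2 t2] n[of a3 t3] n[of a23 "t2 + t3"] by (simp add: algebra_simps)
qed

lemma sq_int_rw:
  assumes "sq_int u" shows "sq_int (rw u)" "sq_norm (rw u) \<le> rc\<^sup>2 * sq_norm u"
  using sq_int_bound[OF assms, of "rw u" rc] assms measurable_parts(4)[of u] norm_rw_le
  by (auto simp: sq_int_def)

lemma sq_int_Q: "\<exists>q\<ge>0. \<forall>u. sq_int u \<longrightarrow> sq_int (Q u) \<and> sq_norm (Q u) \<le> q * sq_norm u"
proof (intro exI conjI allI impI)
  let ?s = "4 * (norm a2)\<^sup>2 + 4 * (norm a3)\<^sup>2 + 2 * (norm a23)\<^sup>2"
  show "0 \<le> rc\<^sup>2 * ?s" by simp
  fix u assume u: "sq_int u"
  note lo = sq_int_lo[OF u] and sh = sq_int_sh[OF sq_int_lo(1)[OF u]]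
  show "sq_int (Q u)" unfolding Q_def by (intro sq_int_rw sh)
  have "sq_norm (Q u) \<le> rc\<^sup>2 * sq_norm (sh (lo u))" unfolding Q_def by (intro sq_int_rw sh)
  also have "\<dots> \<le> rc\<^sup>2 * (?s * sq_norm u)"
    by (intro mult_left_mono order_trans[OF sh(2)] lo) auto
  finally show "sq_norm (Q u) \<le> rc\<^sup>2 * ?s * sq_norm u" by (simp add: mult.assoc)
qed

text \<open>\<open>J\<close> is a finite sum of powers of \<open>Q\<close>, each bounded in L2.
  Partial sums are handled by induction, with a constant that may depend on their length.\<close>

lemma sq_int_J: "\<exists>C\<ge>0. \<forall>w. sq_int w \<longrightarrow> sq_int (J w) \<and> sq_norm (J w) \<le> C * sq_norm w"
proof -
  obtain q where q: "q \<ge> 0" "\<And>u. sq_int u \<Longrightarrow> sq_int (Q u)" "\<And>u. sq_int u \<Longrightarrow> sq_norm (Q u) \<le> q * sq_norm u"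
    using sq_int_Q by blast
  have pow: "sq_int ((Q ^^ i) (rw w)) \<and> sq_norm ((Q ^^ i) (rw w)) \<le> q ^ i * (rc\<^sup>2 * sq_norm w)"
    if w: "sq_int w" for w i
  proof (induction i)
    case 0
    show ?case using sq_int_rw[OF w] by simp
  next
    case (Suc i)
    then show ?case using q(2) q(3)[of "(Q ^^ i) (rw w)"]
        mult_left_mono[of "sq_norm ((Q ^^ i) (rw w))" "q ^ i * (rc\<^sup>2 * sq_norm w)" q] q(1)
      by (auto simp: mult.assoc)
  qed
  have "\<exists>C\<ge>0. \<forall>w. sq_int w \<longrightarrow> sq_int (\<lambda>x. \<Sum>i<n. (Q ^^ i) (rw w) x)
      \<and> sq_norm (\<lambda>x. \<Sum>i<n. (Q ^^ i) (rw w) x) \<le> C * sq_norm w" for n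
  proof (induction n)
    case 0
    show ?case by (intro exI[of _ 0]) (auto simp: sq_int_def sq_norm_def)
  next
    case (Suc n)
    then obtain C where C: "C \<ge> 0" "\<And>w. sq_int w \<Longrightarrow> sq_int (\<lambda>x. \<Sum>i<n. (Q ^^ i) (rw w) x)"
      "\<And>w. sq_int w \<Longrightarrow> sq_norm (\<lambda>x. \<Sum>i<n. (Q ^^ i) (rw w) x) \<le> C * sq_norm w" by blast
    show ?case
    proof (intro exI[of _ "2 * C + 2 * (q ^ n * rc\<^sup>2)"] conjI allI impI)
      show "0 \<le> 2 * C + 2 * (q ^ n * rc\<^sup>2)" using C(1) q(1) by simp
      fix w assume w: "sq_int w"
      note s = sq_int_add[OF C(2)[OF w] conjunct1[OF pow[OF w, of n]]]
      show "sq_int (\<lambda>x. \<Sum>i<Suc n. (Q ^^ i) (rw w) x)" using s(1) by simp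
      show "sq_norm (\<lambda>x. \<Sum>i<Suc n. (Q ^^ i) (rw w) x) \<le> (2 * C + 2 * (q ^ n * rc\<^sup>2)) * sq_norm w"
        using s(2) C(3)[OF w] conjunct2[OF pow[OF w, of n]] by (simp add: algebra_simps)
    qed
  qed
  from this[of nit] show ?thesis by (simp add: J_def[abs_def])
qed

definition E :: "(real \<Rightarrow> complex) \<Rightarrow> real \<Rightarrow> complex" where
  "E u x = A u x + K u x"

lemma E_supp: "x \<notin> {0..<L} \<Longrightarrow> E u x = 0"
  by (simp add: E_def A_supp K_supp)

lemma E_lin:
  assumes "integrable lborel u" "integrable lborel v"
  shows "E (\<lambda>x. a * u x + v x) = (\<lambda>x. a * E u x + E v x)"
  unfolding fun_eq_iff E_def A_lin K_lin[OF assms] by (simp add: algebra_simps)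

lemma sq_int_A:
  assumes "sq_int u" shows "sq_int (A u)"
proof -
  have "sq_int (\<lambda>x. ((-1) * sh (lo u) x + lo u x) + b * hi u (x - D))"
    by (intro sq_int_add(1) sq_int_scale(1) sq_int_sh(1) sq_int_lo(1) sq_int_shift(1)[of "hi u"] sq_int_hi assms)
  then show ?thesis by (simp add: A_def[abs_def])
qed

lemma sq_int_K:
  assumes "integrable lborel u" shows "sq_int (K u)"
proof -
  obtain B where "\<And>x. norm (K u x) \<le> B" using K_bdd_meas[OF assms] bdd_measE by metis
  moreover have "K u \<in> bdd_on {0..<L}" using K_bdd_meas[OF assms] K_supp by (simp add: bdd_on_def)
  ultimately show ?thesis using bdd_on_sq_int(1)[of "K u" L B] L_pos by simp
qed

lemma sq_int_E:
  assumes u: "sq_int u" and supp: "\<And>x. x \<notin> {0..<L} \<Longrightarrow> u x = 0"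
  shows "sq_int (E u)"
  unfolding E_def[abs_def]
  by (intro sq_int_add(1) sq_int_A sq_int_K u sq_int_integrable(1)[OF u supp L_pos])

text \<open>\<open>bdd_fredholm\<close> bounds one solution for each right-hand side. Triviality of
  the kernel makes that solution the only one, so the bound becomes an estimate for every bounded
  \<open>z\<close>; \<open>max C 0\<close> makes the constant nonnegative.\<close>

lemma fredholm_bound:
  assumes nz: "\<And>s. sym0 s \<noteq> 0 \<or> sym1 s \<noteq> 0"
  shows "\<exists>C\<ge>0. (\<forall>w\<in>bdd_on {0..<L}. \<exists>z\<in>bdd_on {0..<L}. \<forall>x. z x + J (K z) x = w x) \<and>
    (\<forall>z\<in>bdd_on {0..<L}. \<forall>c. (\<forall>x. norm (z x + J (K z) x) \<le> c) \<longrightarrow> (\<forall>x. norm (z x) \<le> C * c))"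
proof -
  obtain C where C: "\<And>w c. w \<in> bdd_on {0..<L} \<Longrightarrow> (\<And>x. norm (w x) \<le> c) \<Longrightarrow>
    \<exists>u\<in>bdd_on {0..<L}. (\<forall>x. u x + J (K u) x = w x) \<and> (\<forall>x. norm (u x) \<le> C * c)"
    using bdd_fredholm[OF kernel_trivial[OF nz]] by blast
  show ?thesis
  proof (intro exI[of _ "max C 0"] conjI ballI allI impI)
    show "\<exists>z\<in>bdd_on {0..<L}. \<forall>x. z x + J (K z) x = w x" if w: "w \<in> bdd_on {0..<L}" for w
    proof -
      obtain B where "\<And>x. norm (w x) \<le> B" using w by (auto simp: bdd_on_def bdd_meas_def)
      from C[OF w this] show ?thesis by blast
    qed
    fix z c x assume z: "z \<in> bdd_on {0..<L}" and c: "\<forall>x. norm (z x + J (K z) x) \<le> c"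
    have "(\<lambda>x. z x + J (K z) x) \<in> bdd_on {0..<L}"
      by (intro bdd_on_add z J_bdd_on K_bdd_meas bdd_on_integrable)
    from C[OF this, of c] c obtain u where
      u: "u \<in> bdd_on {0..<L}" "\<And>x. u x + J (K u) x = z x + J (K z) x" "\<And>x. norm (u x) \<le> C * c" by blast
    define d where "d x = (-1) * u x + z x" for x
    have d: "d \<in> bdd_on {0..<L}" unfolding d_def[abs_def] by (intro bdd_on_lincomb u z)
    have Kd: "K d = (\<lambda>x. (-1) * K u x + K z x)"
      unfolding d_def[abs_def] by (intro K_lin bdd_on_integrable u z)
    have "d = J (\<lambda>x. (-1) * K d x)"
    proof
      fix x
      have "J (K d) x = (-1) * J (K u) x + J (K z) x" unfolding Kd J_lin ..
      moreover have "z x = u x + J (K u) x - J (K z) x" using u(2)[of x] by (simp add: eq_diff_eq)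
      ultimately show "d x = J (\<lambda>x. (-1) * K d x) x"
        unfolding J_scale by (simp add: d_def)
    qed
    then have "A d x = (-1) * K d x" if "x \<in> {0..<L}" for x
      using A_J[OF that, of "\<lambda>x. (-1) * K d x"] by metis
    then have "A d x + K d x = 0" for x
      using A_supp[of x d] K_supp[of x d] by (cases "x \<in> {0..<L}") auto
    then have "d = (\<lambda>_. 0)" by (intro kernel_trivial[OF nz d])
    then have "z x = u x" by (simp add: d_def fun_eq_iff)
    moreover have "0 \<le> c" using order_trans[OF norm_ge_zero c[rule_format, of 0]] .
    ultimately show "norm (z x) \<le> max C 0 * c"
      using u(3)[of x] mult_right_mono[of C "max C 0" c] by simp
  qed simp
qed

theorem l2_invertible:
  assumes nz: "\<And>s. sym0 s \<noteq> 0 \<or> sym1 s \<noteq> 0"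
  shows l2_bound: "\<exists>C. \<forall>u. sq_int u \<longrightarrow> (\<forall>x. x \<notin> {0..<L} \<longrightarrow> u x = 0) \<longrightarrow> sq_norm u \<le> C * sq_norm (E u)"
    and l2_surj: "sq_int y \<Longrightarrow> (\<And>x. x \<notin> {0..<L} \<Longrightarrow> y x = 0) \<Longrightarrow>
      \<exists>u. sq_int u \<and> (\<forall>x. x \<notin> {0..<L} \<longrightarrow> u x = 0) \<and> E u = y"
proof -
  obtain CJ where CJ: "CJ \<ge> 0" "\<And>w. sq_int w \<Longrightarrow> sq_int (J w)" "\<And>w. sq_int w \<Longrightarrow> sq_norm (J w) \<le> CJ * sq_norm w"
    using sq_int_J by blast
  obtain C where C: "C \<ge> 0" "\<And>w. w \<in> bdd_on {0..<L} \<Longrightarrow> \<exists>z\<in>bdd_on {0..<L}. \<forall>x. z x + J (K z) x = w x"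
    "\<And>z c x. z \<in> bdd_on {0..<L} \<Longrightarrow> (\<And>x. norm (z x + J (K z) x) \<le> c) \<Longrightarrow> norm (z x) \<le> C * c"
    using fredholm_bound[OF nz] by blast
  obtain kc where kc: "kc \<ge> 0" "\<And>u x. integrable lborel u \<Longrightarrow> norm (K u x) \<le> kc * (LINT x|lborel. norm (u x))"
    using K_bound by blast
  show "\<exists>C. \<forall>u. sq_int u \<longrightarrow> (\<forall>x. x \<notin> {0..<L} \<longrightarrow> u x = 0) \<longrightarrow> sq_norm u \<le> C * sq_norm (E u)"
  proof (intro exI allI impI)
    fix u assume u: "sq_int u" and supp: "\<forall>x. x \<notin> {0..<L} \<longrightarrow> u x = 0"
    have ui: "integrable lborel u" by (rule sq_int_integrable(1)[OF u _ L_pos]) (use supp in auto)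
    have y: "sq_int (E u)" by (rule sq_int_E[OF u]) (use supp in auto)
    define v where "v = J (E u)"
    have v: "sq_int v" and nv: "sq_norm v \<le> CJ * sq_norm (E u)"
      unfolding v_def by (intro CJ y)+
    have v_supp: "v x = 0" if "x \<notin> {0..<L}" for x using J_supp[OF that] by (simp add: v_def)
    have vi: "integrable lborel v" and vI: "(LINT x|lborel. norm (v x))\<^sup>2 \<le> L * sq_norm v"
      using sq_int_integrable[OF v v_supp L_pos] by auto
    \<comment> \<open>\<open>z = - J (K u)\<close> is bounded even if \<open>u\<close> is not, and
      it solves \<open>z + J (K z) = - J (K v)\<close>. The right-hand side is controlled by the L1
      norm of \<open>v\<close>, hence by its L2 norm.\<close>
    define z where "z x = (-1) * v x + u x" for x
    have "u = J (\<lambda>x. E u x - K u x)"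
      by (rule J_A) (use supp in \<open>auto simp: E_def\<close>)
    then have uJ: "u x = v x - J (K u) x" for x unfolding J_diff v_def by metis
    have zJ: "z = (\<lambda>x. (-1) * J (K u) x)"
    proof
      show "z x = (-1) * J (K u) x" for x using uJ[of x] by (simp add: z_def)
    qed
    have zb: "z \<in> bdd_on {0..<L}"
      unfolding zJ by (intro bdd_on_scale J_bdd_on K_bdd_meas ui)
    have Kz: "K z = (\<lambda>x. (-1) * K v x + K u x)"
      unfolding z_def[abs_def] by (rule K_lin[OF vi ui])
    let ?I = "LINT x|lborel. norm (v x)"
    have "norm (z x + J (K z) x) \<le> jc * (kc * ?I)" for x
    proof -
      have "z x + J (K z) x = - J (K v) x" unfolding Kz J_lin using fun_cong[OF zJ, of x] by simp
      then show ?thesis using J_bound[of "K v" "kc * ?I" x] kc(2)[OF vi] by simp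
    qed
    note zx = C(3)[OF zb this]
    have "sq_norm z \<le> (C * (jc * (kc * ?I)))\<^sup>2 * L"
      by (rule bdd_on_sq_int(2)[OF zb zx]) (use L_pos in simp)
    also have "\<dots> = (C * jc * kc)\<^sup>2 * L * ?I\<^sup>2" by (simp add: power_mult_distrib)
    also have "\<dots> \<le> (C * jc * kc)\<^sup>2 * L * (L * sq_norm v)"
      by (intro mult_left_mono vI) (use L_pos in auto)
    finally have nz: "sq_norm z \<le> (C * jc * kc)\<^sup>2 * L\<^sup>2 * sq_norm v" by (simp add: power2_eq_square mult.assoc)
    have "u = (\<lambda>x. v x + z x)" by (simp add: z_def fun_eq_iff)
    then have "sq_norm u \<le> 2 * sq_norm v + 2 * sq_norm z"
      using sq_int_add(2)[OF v, of z] bdd_on_sq_int(1)[OF zb zx] L_pos by simp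
    also have "\<dots> \<le> (2 + 2 * ((C * jc * kc)\<^sup>2 * L\<^sup>2)) * sq_norm v" using nz by (simp add: algebra_simps)
    also have "\<dots> \<le> (2 + 2 * ((C * jc * kc)\<^sup>2 * L\<^sup>2)) * (CJ * sq_norm (E u))"
      by (intro mult_left_mono nv) auto
    finally show "sq_norm u \<le> (2 + 2 * ((C * jc * kc)\<^sup>2 * L\<^sup>2)) * CJ * sq_norm (E u)" by (simp add: mult.assoc)
  qed
  assume y: "sq_int y" and y_supp: "\<And>x. x \<notin> {0..<L} \<Longrightarrow> y x = 0"
  show "\<exists>u. sq_int u \<and> (\<forall>x. x \<notin> {0..<L} \<longrightarrow> u x = 0) \<and> E u = y"
  proof -
    define v where "v = J y"
    have v: "sq_int v" unfolding v_def by (intro CJ y)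
    have v_supp: "v x = 0" if "x \<notin> {0..<L}" for x using J_supp[OF that] by (simp add: v_def)
    have vi: "integrable lborel v" by (rule sq_int_integrable(1)[OF v v_supp L_pos])
    have "(\<lambda>x. (-1) * J (K v) x) \<in> bdd_on {0..<L}"
      by (intro bdd_on_scale J_bdd_on K_bdd_meas vi)
    from C(2)[OF this] obtain z where z: "z \<in> bdd_on {0..<L}" "\<And>x. z x + J (K z) x = (-1) * J (K v) x" by blast
    \<comment> \<open>The factor 1 brings the sum into the form \<open>a * u + v\<close> of the
      linearity lemmas. Adding \<open>v\<close> to \<open>z\<close> restores the inhomogeneity
      \<open>J y\<close>.\<close>
    define u where "u x = 1 * v x + z x" for x
    have zi: "integrable lborel z" by (rule bdd_on_integrable[OF z(1)])
    obtain B where "\<And>x. norm (z x) \<le> B" using z(1) by (auto simp: bdd_on_def bdd_meas_def)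
    then have zs: "sq_int z" using bdd_on_sq_int(1)[OF z(1), of B] L_pos by simp
    have us: "sq_int u" unfolding u_def[abs_def] by (intro sq_int_add_scaled v zs)
    have u_supp: "u x = 0" if "x \<notin> {0..<L}" for x
      using v_supp[OF that] z(1) that by (simp add: u_def bdd_on_def)
    have "E u x = y x" for x
    proof (cases "x \<in> {0..<L}")
      case True
      have Ku: "K u = (\<lambda>x. 1 * K v x + K z x)" unfolding u_def[abs_def] by (rule K_lin[OF vi zi])
      have "u = J (\<lambda>x. (-1) * K u x + y x)"
      proof
        fix x
        have "z x = - J (K v) x - J (K z) x" using z(2)[of x] by (simp add: eq_diff_eq)
        then show "u x = J (\<lambda>x. (-1) * K u x + y x) x"
          unfolding J_lin Ku by (simp add: u_def v_def)
      qed
      then have "A u x = (-1) * K u x + y x"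
        using A_J[OF True, of "\<lambda>x. (-1) * K u x + y x"] by metis
      then show ?thesis by (simp add: E_def)
    next
      case False
      then show ?thesis by (simp add: E_supp y_supp)
    qed
    then show ?thesis using us u_supp by blast
  qed
qed

end

section \<open>Real data and the operator\<close>

text \<open>At an exceptional point the one-sided limits bound \<open>h\<close> on either side, and
  the value at the point itself joins the maximum. At an end of the interval one side is
  empty.\<close>

lemma piecewise_continuous_locally_bounded:
  assumes "piecewise_continuous_on a b h" and x: "x \<in> {a..b}"
  shows "\<exists>d>0. \<exists>B. \<forall>y\<in>{a..b}. \<bar>y - x\<bar> < d \<longrightarrow> \<bar>h y\<bar> \<le> B"
proof -
  from assms obtain S where S: "\<And>x. x \<in> {a..b} - S \<Longrightarrow> continuous (at x within {a..b}) h"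
    "\<And>x. x \<in> S \<inter> {a<..b} \<Longrightarrow> \<exists>l. (h \<longlongrightarrow> l) (at_left x)"
    "\<And>x. x \<in> S \<inter> {a..<b} \<Longrightarrow> \<exists>l. (h \<longlongrightarrow> l) (at_right x)"
    unfolding piecewise_continuous_on_def by blast
  show ?thesis
  proof (cases "x \<in> S")
    case False
    then obtain d where d: "d > 0" "\<And>y. y \<in> {a..b} \<Longrightarrow> dist y x < d \<Longrightarrow> dist (h y) (h x) < 1"
      using S(1)[of x] x unfolding continuous_within_eps_delta by (metis DiffI zero_less_one)
    have "\<bar>h y\<bar> \<le> \<bar>h x\<bar> + 1" if "y \<in> {a..b}" "\<bar>y - x\<bar> < d" for y
      using d(2)[OF that(1)] that(2) by (simp add: dist_real_def)
    then show ?thesis using d(1) by blast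
  next
    case True
    have left: "\<exists>c<x. \<exists>B. \<forall>y\<in>{a..b}. c < y \<and> y < x \<longrightarrow> \<bar>h y\<bar> \<le> B"
    proof (cases "x = a")
      case True
      then show ?thesis by (intro exI[of _ "x - 1"]) auto
    next
      case False
      then obtain l where "(h \<longlongrightarrow> l) (at_left x)" using S(2)[of x] \<open>x \<in> S\<close> x by auto
      from tendstoD[OF this zero_less_one] obtain c where c: "c < x" "\<And>y. c < y \<Longrightarrow> y < x \<Longrightarrow> dist (h y) l < 1"
        unfolding eventually_at_left_field by blast
      have "\<bar>h y\<bar> \<le> \<bar>l\<bar> + 1" if "c < y" "y < x" for y
        using c(2)[OF that] by (simp add: dist_real_def)
      then show ?thesis using c(1) by blast
    qed
    have right: "\<exists>c>x. \<exists>B. \<forall>y\<in>{a..b}. x < y \<and> y < c \<longrightarrow> \<bar>h y\<bar> \<le> B"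
    proof (cases "x = b")
      case True
      then show ?thesis by (intro exI[of _ "x + 1"]) auto
    next
      case False
      then obtain l where "(h \<longlongrightarrow> l) (at_right x)" using S(3)[of x] \<open>x \<in> S\<close> x by auto
      from tendstoD[OF this zero_less_one] obtain c where c: "c > x" "\<And>y. x < y \<Longrightarrow> y < c \<Longrightarrow> dist (h y) l < 1"
        unfolding eventually_at_right_field by blast
      have "\<bar>h y\<bar> \<le> \<bar>l\<bar> + 1" if "x < y" "y < c" for y
        using c(2)[OF that] by (simp add: dist_real_def)
      then show ?thesis using c(1) by blast
    qed
    obtain c B c' B' where c: "c < x" "\<And>y. y \<in> {a..b} \<Longrightarrow> c < y \<Longrightarrow> y < x \<Longrightarrow> \<bar>h y\<bar> \<le> B"
      "x < c'" "\<And>y. y \<in> {a..b} \<Longrightarrow> x < y \<Longrightarrow> y < c' \<Longrightarrow> \<bar>h y\<bar> \<le> B'"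
      using left right by metis
    have "\<bar>h y\<bar> \<le> max (max B B') \<bar>h x\<bar>"
      if y: "y \<in> {a..b}" "\<bar>y - x\<bar> < min (x - c) (c' - x)" for y
    proof -
      consider "y = x" | "c < y" "y < x" | "x < y" "y < c'" using y(2) by linarith
      then show ?thesis
        by cases (use c(2)[OF y(1)] c(4)[OF y(1)] in \<open>auto simp: le_max_iff_disj\<close>)
    qed
    moreover have "min (x - c) (c' - x) > 0" using c by simp
    ultimately show ?thesis by blast
  qed
qed

text \<open>Compactness: finitely many balls with local bounds cover the interval, and the sum of
  the absolute bounds dominates each of them.\<close>

lemma piecewise_continuous_bounded:
  assumes "piecewise_continuous_on a b h"
  shows "\<exists>B. \<forall>x\<in>{a..b}. \<bar>h x\<bar> \<le> B"
proof -
  obtain d B where d: "\<And>x. x \<in> {a..b} \<Longrightarrow> d x > 0"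
    "\<And>x y. x \<in> {a..b} \<Longrightarrow> y \<in> {a..b} \<Longrightarrow> \<bar>y - x\<bar> < d x \<Longrightarrow> \<bar>h y\<bar> \<le> B x"
    using piecewise_continuous_locally_bounded[OF assms] by metis
  have "{a..b} \<subseteq> (\<Union>x\<in>{a..b}. ball x (d x))"
    by (intro subsetI UN_I[where a="_ :: real"]) (use d(1) in \<open>auto intro: centre_in_ball[THEN iffD2]\<close>)
  then obtain F where F: "F \<subseteq> {a..b}" "finite F" "{a..b} \<subseteq> (\<Union>x\<in>F. ball x (d x))"
    using compactE_image[OF compact_Icc, of "{a..b}" "\<lambda>x. ball x (d x)" a b] by auto
  have "\<bar>h y\<bar> \<le> (\<Sum>x\<in>F. \<bar>B x\<bar>)" if y: "y \<in> {a..b}" for y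
  proof -
    obtain x where x: "x \<in> F" "y \<in> ball x (d x)" using F(3) y by blast
    then have "\<bar>h y\<bar> \<le> B x" using d(2)[of x y] F(1) y by (auto simp: dist_real_def abs_minus_commute)
    also have "\<dots> \<le> \<bar>B x\<bar>" by simp
    also have "\<dots> \<le> (\<Sum>x\<in>F. \<bar>B x\<bar>)" using x F(2) by (intro member_le_sum) auto
    finally show ?thesis .
  qed
  then show ?thesis by blast
qed

definition cutoff :: "real \<Rightarrow> (real \<Rightarrow> real) \<Rightarrow> real \<Rightarrow> real" where
  "cutoff T h x = (if 0 \<le> x \<and> x \<le> T then h x else 0)"

context
  fixes T :: real and h :: "real \<Rightarrow> real"
  assumes T: "0 < T" and h: "piecewise_continuous_on 0 T h"
begin

text \<open>Extension by zero may create jumps at 0 and \<open>T\<close>, so these join the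
  exceptional set.\<close>

lemma cutoff_continuous: "\<exists>S. finite S \<and> (\<forall>x. x \<notin> S \<longrightarrow> isCont (cutoff T h) x)"
proof -
  from h obtain S where S: "finite S" "\<And>x. x \<in> {0..T} - S \<Longrightarrow> continuous (at x within {0..T}) h"
    unfolding piecewise_continuous_on_def by blast
  have "isCont (cutoff T h) x" if x: "x \<notin> S \<union> {0, T}" for x
  proof (cases "x \<in> {0..T}")
    case True
    then have "isCont h x" using S(2)[of x] x at_within_Icc_at[of 0 x T] by auto
    moreover have "eventually (\<lambda>y. cutoff T h y = h y) (nhds x)"
      using True x by (intro eventually_nhds_in_open[THEN eventually_mono, of "{0<..<T}"]) (auto simp: cutoff_def)
    ultimately show ?thesis by (simp add: isCont_cong)
  next
    case False
    have "eventually (\<lambda>y. cutoff T h y = 0) (nhds x)"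
      using False by (intro eventually_nhds_in_open[THEN eventually_mono, of "- {0..T}"]) (auto simp: cutoff_def)
    then show ?thesis by (simp add: isCont_cong)
  qed
  then show ?thesis using S(1) by (intro exI[of _ "S \<union> {0, T}"]) auto
qed

lemma cutoff_bdd_meas: "bdd_meas (\<lambda>x. complex_of_real (cutoff T h x))"
proof -
  obtain S where S: "finite S" "\<And>x. x \<notin> S \<Longrightarrow> isCont (cutoff T h) x" using cutoff_continuous by blast
  have "cutoff T h \<in> borel_measurable borel"
    by (rule borel_measurable_continuous_countable_exceptions[of S])
       (use S in \<open>auto intro: countable_finite continuous_at_imp_continuous_on\<close>)
  moreover obtain B where "\<And>x. x \<in> {0..T} \<Longrightarrow> \<bar>h x\<bar> \<le> B" using piecewise_continuous_bounded[OF h] by blast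
  ultimately show ?thesis
    by (intro bdd_measI[of _ "max B 0"] borel_measurable_of_real) (simp, simp add: cutoff_def le_max_iff_disj)
qed

text \<open>Dominated convergence along sequences: the integrand tends to 0 off the finite set of
  discontinuities. Dropping the first \<open>n\<close> terms makes every shift smaller than 1, so
  \<open>[-1, T + 1]\<close> carries the majorant.\<close>

lemma cutoff_translation:
  "((\<lambda>d. LINT x|lborel. norm (complex_of_real (cutoff T h (x + d)) - complex_of_real (cutoff T h x))) \<longlongrightarrow> 0) (at 0)"
proof -
  obtain S where S: "finite S" "\<And>x. x \<notin> S \<Longrightarrow> isCont (cutoff T h) x" using cutoff_continuous by blast
  obtain B where B: "B \<ge> 0" "\<And>x. norm (complex_of_real (cutoff T h x)) \<le> B"
    using cutoff_bdd_meas bdd_measE by metis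
  have [measurable]: "(\<lambda>x. complex_of_real (cutoff T h x)) \<in> borel_measurable borel"
    using cutoff_bdd_meas by (simp add: bdd_meas_def)
  show ?thesis
    unfolding tendsto_at_iff_sequentially comp_def
  proof (intro allI impI)
    fix X :: "nat \<Rightarrow> real" assume X: "X \<longlonglongrightarrow> 0"
    have "eventually (\<lambda>i. \<bar>X i\<bar> < 1) sequentially"
      using order_tendstoD(2)[OF tendsto_rabs[OF X], of 1] by simp
    then obtain n where n: "\<And>i. i \<ge> n \<Longrightarrow> \<bar>X i\<bar> < 1" unfolding eventually_sequentially by blast
    let ?f = "\<lambda>i x. norm (complex_of_real (cutoff T h (x + X i)) - complex_of_real (cutoff T h x))"
    have "(\<lambda>i. LINT x|lborel. ?f (i + n) x) \<longlonglongrightarrow> integral\<^sup>L lborel (\<lambda>_ :: real. 0 :: real)"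
    proof (rule integral_dominated_convergence[where w="\<lambda>x. 2 * B * indicator {-1..T + 1} x"])
      show "integrable lborel (\<lambda>x. 2 * B * indicator {-1..T + 1} x :: real)"
        by (intro integrable_mult_right) (simp add: integrable_indicator_iff emeasure_lborel_Icc_eq)
      show "AE x in lborel. (\<lambda>i. ?f (i + n) x) \<longlonglongrightarrow> 0"
      proof -
        have "AE x in lborel. x \<notin> S"
          using S(1) by (intro AE_not_in countable_imp_null_set_lborel countable_finite)
        then show ?thesis
        proof eventually_elim
          case (elim x)
          have "(\<lambda>i. x + X (i + n)) \<longlonglongrightarrow> x + 0"
            by (intro tendsto_intros LIMSEQ_ignore_initial_segment X)
          then have "(\<lambda>i. cutoff T h (x + X (i + n))) \<longlonglongrightarrow> cutoff T h x"
            using S(2)[OF elim] by (intro isCont_tendsto_compose[of x "cutoff T h"]) auto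
          then have "(\<lambda>i. ?f (i + n) x) \<longlonglongrightarrow> norm (complex_of_real (cutoff T h x) - complex_of_real (cutoff T h x))"
            by (intro tendsto_intros)
          then show ?case by simp
        qed
      qed
      show "AE x in lborel. norm (?f (i + n) x) \<le> 2 * B * indicator {-1..T + 1} x" for i
      proof (rule AE_I2)
        fix x :: real
        have "?f (i + n) x \<le> B + B" using norm_triangle_ineq4 B(2) by (meson add_mono order_trans)
        moreover have "?f (i + n) x = 0" if "x \<notin> {-1..T + 1}"
          using n[of "i + n"] that by (auto simp: cutoff_def)
        ultimately show "norm (?f (i + n) x) \<le> 2 * B * indicator {-1..T + 1} x"
          by (cases "x \<in> {-1..T + 1}") auto
      qed
    qed auto
    then have "(\<lambda>i. LINT x|lborel. ?f (i + n) x) \<longlonglongrightarrow> 0" by simp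
    then show "(\<lambda>i. LINT x|lborel. ?f i x) \<longlonglongrightarrow> 0" by (rule LIMSEQ_offset)
  qed
qed

end

lemma AE_shift_lborel:
  assumes "AE x in lborel. P (x :: real)" shows "AE x in lborel. P (x + c)"
proof -
  have "AE x in distr lborel borel ((+) c). P x" unfolding lborel_distr_plus by (rule assms)
  then have "AE x in lborel. P (c + x)" by (rule AE_distrD[rotated]) simp
  then show ?thesis by (simp add: add.commute)
qed

definition pc :: "real \<Rightarrow> real \<Rightarrow> (real \<Rightarrow> real) \<Rightarrow> real \<Rightarrow> real" where
  "pc a b h x = (if a \<le> x \<and> x < b then h x else 0)"

lemma L2_on_pc:
  assumes "L2_on {a<..<b} h"
  shows "sq_int (\<lambda>x. of_real (pc a b h x))" "sq_norm (\<lambda>x. of_real (pc a b h x)) = (L2_norm_on {a<..<b} h)\<^sup>2"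
proof -
  have m: "(\<lambda>x. indicator {a<..<b} x *\<^sub>R h x) \<in> borel_measurable lborel"
    and i: "integrable lborel (\<lambda>x. indicator {a<..<b} x *\<^sub>R (h x)\<^sup>2)"
    using assms by (auto simp: L2_on_def set_borel_measurable_def set_integrable_def)
  have e: "pc a b h x = indicator {a<..<b} x *\<^sub>R h x" "(pc a b h x)\<^sup>2 = indicator {a<..<b} x *\<^sub>R (h x)\<^sup>2"
    if "x \<notin> {a}" for x using that by (auto simp: pc_def)
  have "pc a b h \<in> borel_measurable lborel"
    by (rule measurable_discrete_difference[OF m, of "{a}"]) (use e in auto)
  moreover have int: "integrable lborel (\<lambda>x. (pc a b h x)\<^sup>2)"
    by (subst integrable_discrete_difference[where X="{a}" and g="\<lambda>x. indicator {a<..<b} x *\<^sub>R (h x)\<^sup>2"])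
       (use e i in auto)
  ultimately show "sq_int (\<lambda>x. of_real (pc a b h x))" by (simp add: sq_int_def)
  have "0 \<le> (LINT x|lborel. indicator {a<..<b} x *\<^sub>R (h x)\<^sup>2)" by simp
  then have "(L2_norm_on {a<..<b} h)\<^sup>2 = (LINT x|lborel. indicator {a<..<b} x *\<^sub>R (h x)\<^sup>2)"
    by (simp add: L2_norm_on_def set_lebesgue_integral_def)
  also have "\<dots> = (LINT x|lborel. (pc a b h x)\<^sup>2)"
    by (rule integral_discrete_difference[where X="{a}"]) (use e in auto)
  finally show "sq_norm (\<lambda>x. of_real (pc a b h x)) = (L2_norm_on {a<..<b} h)\<^sup>2"
    by (simp add: sq_norm_def)
qed

text \<open>The shift \<open>d\<close> serves the components of \<open>f\<close>, stored at distance
  \<open>D\<close>; the finite set \<open>F\<close> absorbs break points where differently closed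
  intervals disagree.\<close>

lemma L2_onI:
  assumes v: "sq_int (\<lambda>x. of_real (v x))" and F: "finite F"
    and eq: "\<And>x. x \<in> {a<..<b} \<Longrightarrow> x \<notin> F \<Longrightarrow> h x = v (x + d)"
  shows "L2_on {a<..<b} h"
proof -
  have v': "v \<in> borel_measurable borel" "integrable lborel (\<lambda>x. (v x)\<^sup>2)"
    using v measurable_compose[OF _ borel_measurable_Re, of "\<lambda>x. of_real (v x)" borel] by (auto simp: sq_int_def)
  note [measurable] = v'(1)
  have e: "indicator {a<..<b} x *\<^sub>R h x = indicator {a<..<b} x *\<^sub>R v (x + d)"
      "indicator {a<..<b} x *\<^sub>R (h x)\<^sup>2 = indicator {a<..<b} x *\<^sub>R (v (x + d))\<^sup>2" if "x \<notin> F" for x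
    using eq[of x] that by (auto simp: indicator_def)
  have "(\<lambda>x. indicator {a<..<b} x *\<^sub>R h x) \<in> borel_measurable lborel"
  proof (rule measurable_discrete_difference[of "\<lambda>x. indicator {a<..<b} x *\<^sub>R v (x + d)" _ _ F])
    show "countable F" using F by (rule countable_finite)
    show "indicator {a<..<b} x *\<^sub>R v (x + d) = indicator {a<..<b} x *\<^sub>R h x" if "x \<notin> F" for x
      using e(1)[OF that] by (rule sym)
  qed auto
  moreover have "integrable lborel (\<lambda>x. indicator {a<..<b} x *\<^sub>R (h x)\<^sup>2)"
  proof (subst integrable_discrete_difference[where X=F and g="\<lambda>x. indicator {a<..<b} x *\<^sub>R (v (x + d))\<^sup>2"])
    show "integrable lborel (\<lambda>x. indicator {a<..<b} x *\<^sub>R (v (x + d))\<^sup>2)"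
      using integrable_shift_lborel[OF v'(2), of "-d"] by (intro integrable_mult_indicator) auto
  qed (use e F countable_finite in auto)
  ultimately show ?thesis by (simp add: L2_on_def set_borel_measurable_def set_integrable_def)
qed

lemma ae_eq_on_iff_pc: "ae_eq_on {a<..<b} h k \<longleftrightarrow> (AE x in lborel. pc a b h x = pc a b k x)"
proof
  assume "ae_eq_on {a<..<b} h k"
  then show "AE x in lborel. pc a b h x = pc a b k x"
    unfolding ae_eq_on_def using AE_lborel_singleton[of a] by eventually_elim (auto simp: pc_def)
next
  assume "AE x in lborel. pc a b h x = pc a b k x"
  then show "ae_eq_on {a<..<b} h k"
    unfolding ae_eq_on_def by eventually_elim (auto simp: pc_def)
qed


locale real_delay_system =
  fixes a2 a3 a23 b t2 t3 D :: real and N M :: "real \<Rightarrow> real"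
  assumes b: "b \<noteq> 0" and t2: "0 < t2" and t23: "t2 \<le> t3" and D: "t2 + t3 < D"
    and N: "piecewise_continuous_on 0 (t2 + t3) N" and M: "piecewise_continuous_on 0 D M"
    and nz: "\<forall>s::complex. F0 a2 a3 a23 t2 t3 N s \<noteq> 0 \<or> F1 b D M s \<noteq> 0"
begin

abbreviation "t \<equiv> t2 + t3"

abbreviation Nc :: "real \<Rightarrow> real" where "Nc \<equiv> cutoff t N"
abbreviation Mc :: "real \<Rightarrow> real" where "Mc \<equiv> cutoff D M"

lemma pos: "0 < t" "0 < D"
  using t2 t23 D by auto

sublocale cx: delay_system "of_real a2" "of_real a3" "of_real a23" "of_real b" t2 t3 D
  "\<lambda>x. of_real (Nc x)" "\<lambda>x. of_real (Mc x)"
  using b t2 t23 D cutoff_bdd_meas[OF pos(1) N] cutoff_bdd_meas[OF pos(2) M]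
    cutoff_translation[OF pos(1) N] cutoff_translation[OF pos(2) M]
  by unfold_locales (auto simp: cutoff_def)

lemma L_eq: "cx.L = D + t2 + t3"
  by (simp add: cx.L_def)

lemma sym_nonzero: "cx.sym0 s \<noteq> 0 \<or> cx.sym1 s \<noteq> 0"
proof -
  have "complex_of_real (cutoff T h x) * exp (- of_real x * s)
      = indicator {0..T} x *\<^sub>R (of_real (h x) * exp (- of_real x * s))" for T h x
    by (auto simp: cutoff_def indicator_def)
  then have "cx.sym0 s = F0 a2 a3 a23 t2 t3 N s" "cx.sym1 s = F1 b D M s"
    by (simp_all only: cx.sym0_def cx.sym1_def F0_def F1_def set_lebesgue_integral_def)
  then show ?thesis using nz by metis
qed

definition lor :: "(real \<Rightarrow> real) \<Rightarrow> real \<Rightarrow> real" where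
  "lor c x = (if 0 \<le> x \<and> x < D then c x else 0)"

definition hir :: "(real \<Rightarrow> real) \<Rightarrow> real \<Rightarrow> real" where
  "hir c x = (if 0 \<le> x \<and> x < t then c (x + D) else 0)"

definition Er :: "(real \<Rightarrow> real) \<Rightarrow> real \<Rightarrow> real" where
  "Er c x = lor c x - (a2 * lor c (x - t2) + a3 * lor c (x - t3) + a23 * lor c (x - t)) + b * hir c (x - D)
    + ((LINT y|lborel. hir c y * Mc (x - y)) - (LINT y|lborel. lor c y * Nc (x - y)))"

abbreviation cplx :: "(real \<Rightarrow> real) \<Rightarrow> real \<Rightarrow> complex" where "cplx c \<equiv> \<lambda>x. of_real (c x)"

lemma lo_cplx: "cx.lo (cplx c) = cplx (lor c)" and hi_cplx: "cx.hi (cplx c) = cplx (hir c)"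
  by (auto simp: cx.lo_def lor_def cx.hi_def hir_def)

lemma conv_cplx: "conv (cplx f) (cplx g) x = of_real (LINT y|lborel. f y * g (x - y))"
  unfolding conv_def of_real_mult[symmetric] by (rule integral_complex_of_real)

lemma E_cplx: "cx.E (cplx c) = cplx (Er c)"
proof
  fix x
  show "cx.E (cplx c) x = of_real (Er c x)"
    unfolding cx.E_def cx.A_def cx.K_def cx.sh_def lo_cplx hi_cplx
      conv_commute[of "cplx Mc"] conv_commute[of "cplx Nc"] conv_cplx
    by (simp add: Er_def)
qed

text \<open>The components are classes on open intervals; half-open pieces fix the values at the break points so that
  \<open>cat\<close> inverts \<open>uncat\<close> exactly.\<close>

definition cat :: "Xelt \<Rightarrow> real \<Rightarrow> real" where
  "cat z x = (case z of (g, f2, f3, f23) \<Rightarrow>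
     pc 0 D g x + pc 0 t2 f2 (x - D) + pc t2 t3 f3 (x - D) + pc t3 t f23 (x - D))"

definition uncat :: "(real \<Rightarrow> real) \<Rightarrow> Xelt" where
  "uncat c = (c, \<lambda>x. c (x + D), \<lambda>x. c (x + D), \<lambda>x. c (x + D))"

lemma cat_supp: "x \<notin> {0..<cx.L} \<Longrightarrow> cat z x = 0"
  using t2 t23 D by (auto simp: cat_def pc_def L_eq split: prod.splits)

lemma cat_lo: "0 \<le> x \<Longrightarrow> x < D \<Longrightarrow> cat (g, f2, f3, f23) x = g x"
  using t2 t23 D by (auto simp: cat_def pc_def)

lemma cat_f2: "0 \<le> x \<Longrightarrow> x < t2 \<Longrightarrow> cat (g, f2, f3, f23) (x + D) = f2 x"
  and cat_f3: "t2 \<le> x \<Longrightarrow> x < t3 \<Longrightarrow> cat (g, f2, f3, f23) (x + D) = f3 x"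
  and cat_f23: "t3 \<le> x \<Longrightarrow> x < t \<Longrightarrow> cat (g, f2, f3, f23) (x + D) = f23 x"
  using t2 t23 D by (auto simp: cat_def pc_def)

lemma cat_uncat:
  assumes "\<And>x. x \<notin> {0..<cx.L} \<Longrightarrow> c x = 0"
  shows "cat (uncat c) = c"
proof
  fix x
  consider "x < 0" | "0 \<le> x" "x < D" | "0 \<le> x - D" "x - D < t2" | "t2 \<le> x - D" "x - D < t3"
    | "t3 \<le> x - D" "x - D < t" | "cx.L \<le> x"
    unfolding L_eq by linarith
  then show "cat (uncat c) x = c x"
    using assms[of x] t2 t23 D by cases (auto simp: cat_def uncat_def pc_def L_eq)
qed

text \<open>The four pieces have disjoint half-open supports, so squares add without cross terms and
  \<open>cat\<close> is an isometry.\<close>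

lemma sq_int_cat:
  assumes "inX t2 t3 D z"
  shows "sq_int (cplx (cat z))" "sq_norm (cplx (cat z)) = (normX t2 t3 D z)\<^sup>2"
proof -
  obtain g f2 f3 f23 where z: "z = (g, f2, f3, f23)" by (cases z) auto
  have l: "L2_on {0<..<D} g" "L2_on {0<..<t2} f2" "L2_on {t2<..<t3} f3" "L2_on {t3<..<t} f23"
    using assms by (auto simp: inX_def z)
  note p = L2_on_pc[OF l(1)] L2_on_pc[OF l(2)] L2_on_pc[OF l(3)] L2_on_pc[OF l(4)]
  note s = sq_int_shift[OF p(3), of D] sq_int_shift[OF p(5), of D] sq_int_shift[OF p(7), of D]
  have eq: "cplx (cat z) = (\<lambda>x. cplx (pc 0 D g) x + cplx (pc 0 t2 f2) (x - D)
      + cplx (pc t2 t3 f3) (x - D) + cplx (pc t3 t f23) (x - D))"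
    by (simp add: cat_def z)
  show "sq_int (cplx (cat z))"
    unfolding eq by (intro sq_int_add(1) p s)
  have "(norm (cplx (cat z) x))\<^sup>2 = (norm (cplx (pc 0 D g) x))\<^sup>2 + (norm (cplx (pc 0 t2 f2) (x - D)))\<^sup>2
      + (norm (cplx (pc t2 t3 f3) (x - D)))\<^sup>2 + (norm (cplx (pc t3 t f23) (x - D)))\<^sup>2" for x
    using t2 t23 by (auto simp: cat_def z pc_def)
  then have "sq_norm (cplx (cat z)) = sq_norm (cplx (pc 0 D g)) + sq_norm (\<lambda>x. cplx (pc 0 t2 f2) (x - D))
      + sq_norm (\<lambda>x. cplx (pc t2 t3 f3) (x - D)) + sq_norm (\<lambda>x. cplx (pc t3 t f23) (x - D))"
    using p(1) s(1,3,5) unfolding sq_norm_def sq_int_def by simp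
  also have "\<dots> = (L2_norm_on {0<..<D} g)\<^sup>2 + (L2_norm_on {0<..<t2} f2)\<^sup>2
      + (L2_norm_on {t2<..<t3} f3)\<^sup>2 + (L2_norm_on {t3<..<t} f23)\<^sup>2"
    unfolding s p ..
  finally show "sq_norm (cplx (cat z)) = (normX t2 t3 D z)\<^sup>2"
    by (simp add: normX_def z)
qed

lemma eqX_iff_cat: "eqX t2 t3 D y z \<longleftrightarrow> (AE x in lborel. cat y x = cat z x)"
proof -
  obtain g f2 f3 f23 g' f2' f3' f23' where yz: "y = (g, f2, f3, f23)" "z = (g', f2', f3', f23')"
    by (cases y, cases z) auto
  have eqX: "eqX t2 t3 D y z \<longleftrightarrow> (AE x in lborel. pc 0 D g x = pc 0 D g' x) \<and>
      (AE x in lborel. pc 0 t2 f2 x = pc 0 t2 f2' x) \<and> (AE x in lborel. pc t2 t3 f3 x = pc t2 t3 f3' x) \<and>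
      (AE x in lborel. pc t3 t f23 x = pc t3 t f23' x)"
    by (simp add: eqX_def yz ae_eq_on_iff_pc)
  show ?thesis
  proof
    assume "eqX t2 t3 D y z"
    then have p: "AE x in lborel. pc 0 D g x = pc 0 D g' x" "AE x in lborel. pc 0 t2 f2 x = pc 0 t2 f2' x"
      "AE x in lborel. pc t2 t3 f3 x = pc t2 t3 f3' x" "AE x in lborel. pc t3 t f23 x = pc t3 t f23' x"
      unfolding eqX by blast+
    from p(1) AE_shift_lborel[OF p(2), of "-D"] AE_shift_lborel[OF p(3), of "-D"] AE_shift_lborel[OF p(4), of "-D"]
    show "AE x in lborel. cat y x = cat z x"
      by eventually_elim (simp add: cat_def yz)
  next
    assume ae: "AE x in lborel. cat y x = cat z x"
    have ae': "AE x in lborel. cat y (x + D) = cat z (x + D)" by (rule AE_shift_lborel[OF ae])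
    have "AE x in lborel. pc 0 D g x = pc 0 D g' x"
      using ae by eventually_elim (auto simp: pc_def yz cat_lo)
    moreover have "AE x in lborel. pc 0 t2 f2 x = pc 0 t2 f2' x"
      using ae' by eventually_elim (auto simp: pc_def yz cat_f2)
    moreover have "AE x in lborel. pc t2 t3 f3 x = pc t2 t3 f3' x"
      using ae' by eventually_elim (auto simp: pc_def yz cat_f3)
    moreover have "AE x in lborel. pc t3 t f23 x = pc t3 t f23' x"
      using ae' by eventually_elim (auto simp: pc_def yz cat_f23)
    ultimately show "eqX t2 t3 D y z" unfolding eqX by blast
  qed
qed

text \<open>\<open>glue_f\<close> includes the right end \<open>t\<close>, while \<open>hir\<close>
  stops before it; this single point is excluded.\<close>

lemma hir_cat:
  assumes "x \<noteq> t"
  shows "hir (cat (g, f2, f3, f23)) x = (if 0 \<le> x \<and> x \<le> t then glue_f t2 t3 f2 f3 f23 x else 0)"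
proof -
  consider "x < 0" | "0 \<le> x" "x < t2" | "t2 \<le> x" "x < t3" | "t3 \<le> x" "x < t" | "t < x"
    using assms by linarith
  then show ?thesis
    using t2 t23 D by cases (auto simp: hir_def cat_f2 cat_f3 cat_f23 glue_f_def indicator_def)
qed

lemma lor_cat: "lor (cat (g, f2, f3, f23)) x = (if 0 \<le> x \<and> x < D then g x else 0)"
  by (simp add: lor_def cat_lo)

lemma set_integral_eq_off_finite:
  fixes p q :: "real \<Rightarrow> real"
  assumes "finite X" "\<And>x. x \<notin> X \<Longrightarrow> indicator S x * p x = q x"
  shows "(LINT x:S|lborel. p x) = (LINT x|lborel. q x)"
  unfolding set_lebesgue_integral_def
  by (rule integral_discrete_difference[where X=X]) (use assms in \<open>auto intro: countable_finite\<close>)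

lemma integrable_hir_lor:
  assumes "integrable lborel (cplx c)"
  shows "integrable lborel (\<lambda>y. hir c y * Mc (x - y))" "integrable lborel (\<lambda>y. lor c y * Nc (x - y))"
proof -
  have "integrable lborel (\<lambda>y. complex_of_real (hir c y * Mc (x - y)))"
    using conv_integrable_bdd[OF cx.integrable_hi[OF assms] cx.M, of x] by (simp add: hi_cplx)
  from integrable_Re[OF this] show "integrable lborel (\<lambda>y. hir c y * Mc (x - y))" by simp
  have "integrable lborel (\<lambda>y. complex_of_real (lor c y * Nc (x - y)))"
    using conv_integrable_bdd[OF cx.integrable_lo[OF assms] cx.N, of x] by (simp add: lo_cplx)
  from integrable_Re[OF this] show "integrable lborel (\<lambda>y. lor c y * Nc (x - y))" by simp
qed

text \<open>The integration limits of the operator describe where the supports of the convolved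
  functions overlap, so the truncated integrals agree with full convolutions up to end points. For
  \<open>I1\<close> the three delays are excluded: there the indicator is still 0 while
  \<open>lor\<close> already picks up the value of \<open>g\<close> at 0.\<close>

lemma opT_eq:
  assumes z: "inX t2 t3 D (g, f2, f3, f23)"
    and T: "opT a2 a3 a23 b t2 t3 D N M (g, f2, f3, f23) = (I1, I2, I3, I23)"
  shows "x \<in> {0<..<D} \<Longrightarrow> x \<notin> {t2, t3, t} \<Longrightarrow> I1 x = Er (cat (g, f2, f3, f23)) x"
    and "x \<in> {0<..<t2} \<Longrightarrow> I2 x = Er (cat (g, f2, f3, f23)) (x + D)"
    and "x \<in> {t2<..<t3} \<Longrightarrow> I3 x = Er (cat (g, f2, f3, f23)) (x + D)"
    and "x \<in> {t3<..<t} \<Longrightarrow> I23 x = Er (cat (g, f2, f3, f23)) (x + D)"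
proof -
  let ?c = "cat (g, f2, f3, f23)" and ?f = "glue_f t2 t3 f2 f3 f23"
  define KM where "KM x = (LINT y|lborel. hir ?c y * Mc (x - y))" for x
  define KN where "KN x = (LINT y|lborel. lor ?c y * Nc (x - y))" for x
  have ci: "integrable lborel (cplx ?c)"
    by (rule sq_int_integrable(1)[OF sq_int_cat(1)[OF z] _ cx.L_pos]) (use cat_supp in auto)
  have hir: "hir ?c y = (if 0 \<le> y \<and> y \<le> t then ?f y else 0)" if "y \<noteq> t" for y
    using that by (rule hir_cat)
  note lor = lor_cat[of g f2 f3 f23]
  define R where "R x = (LINT y:{x..t}|lborel. ?f y * M (x + D - y))
      - (LINT y:{x + D - t..D}|lborel. g y * N (x + D - y))" for x
  \<comment> \<open>At \<open>x + D\<close> the kernel argument \<open>x + D - y\<close> lies in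
    \<open>[0, D]\<close> only for \<open>y \<ge> x\<close>, and in \<open>[0, t]\<close> only for
    \<open>y \<ge> x + D - t\<close>: these are the lower limits of the tail term.\<close>
  have R: "R x = KM (x + D) - KN (x + D)" if x: "0 < x" "x < t" for x
  proof -
    have "(LINT y:{x..t}|lborel. ?f y * M (x + D - y)) = KM (x + D)"
      unfolding KM_def
      by (rule set_integral_eq_off_finite[of "{t}"])
         (use x D in \<open>auto simp: hir cutoff_def indicator_def\<close>)
    moreover have "(LINT y:{x + D - t..D}|lborel. g y * N (x + D - y)) = KN (x + D)"
      unfolding KN_def
      by (rule set_integral_eq_off_finite[of "{D}"])
         (use x D in \<open>auto simp: lor cutoff_def indicator_def\<close>)
    ultimately show ?thesis by (simp add: R_def)
  qed
  have T': "I1 = (\<lambda>x. g x - (a2 * g (x - t2) * indicator {t2<..D} x + a3 * g (x - t3) * indicator {t3<..D} x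
        + a23 * g (x - t) * indicator {t<..D} x)
      + indicator {0..t} x * (LINT y:{0..x}|lborel. ?f y * M (x - y) - g y * N (x - y))
      + indicator {t<..D} x * ((LINT y:{0..t}|lborel. ?f y * M (x - y))
          - (LINT y:{x - t..x}|lborel. g y * N (x - y))))"
    "I2 = (\<lambda>x. b * f2 x - (a2 * g (x + D - t2) + a3 * g (x + D - t3) + a23 * g (x + D - t)) + R x)"
    "I3 = (\<lambda>x. b * f3 x - (a3 * g (x + D - t3) + a23 * g (x + D - t)) + R x)"
    "I23 = (\<lambda>x. b * f23 x - a23 * g (x + D - t) + R x)"
    using T unfolding opT_def Let_def R_def by simp_all
  have Er: "Er ?c x = lor ?c x - (a2 * lor ?c (x - t2) + a3 * lor ?c (x - t3) + a23 * lor ?c (x - t))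
      + b * hir ?c (x - D) + (KM x - KN x)" for x
    by (simp add: Er_def KM_def KN_def)
  show "I1 x = Er ?c x" if x: "x \<in> {0<..<D}" "x \<notin> {t2, t3, t}"
  proof -
    have sh: "g (x - d) * indicator {d<..D} x = lor ?c (x - d)" if "d \<in> {t2, t3, t}" for d
      using x that t2 t23 by (auto simp: lor indicator_def)
    have hi0: "hir ?c (x - D) = 0" using x by (simp add: hir_def)
    have int: "indicator {0..t} x * (LINT y:{0..x}|lborel. ?f y * M (x - y) - g y * N (x - y))
      + indicator {t<..D} x * ((LINT y:{0..t}|lborel. ?f y * M (x - y))
          - (LINT y:{x - t..x}|lborel. g y * N (x - y))) = KM x - KN x"
    proof (cases "x < t")
      case True
      \<comment> \<open>Below \<open>t\<close> the operator integrates the difference as one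
        integrand, so separating the two convolutions needs their integrability.\<close>
      have "(LINT y:{0..x}|lborel. ?f y * M (x - y) - g y * N (x - y))
          = (LINT y|lborel. hir ?c y * Mc (x - y) - lor ?c y * Nc (x - y))"
        by (rule set_integral_eq_off_finite[of "{t}"])
           (use x True in \<open>auto simp: hir lor cutoff_def indicator_def\<close>)
      also have "\<dots> = KM x - KN x"
        using integrable_hir_lor[OF ci, of x] by (simp add: KM_def KN_def)
      finally show ?thesis using True x by simp
    next
      case False
      have "(LINT y:{0..t}|lborel. ?f y * M (x - y)) = KM x"
        unfolding KM_def
        by (rule set_integral_eq_off_finite[of "{t}"])
           (use x False in \<open>auto simp: hir cutoff_def indicator_def\<close>)
      moreover have "(LINT y:{x - t..x}|lborel. g y * N (x - y)) = KN x"
        unfolding KN_def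
        by (rule set_integral_eq_off_finite[of "{D}"])
           (use x False in \<open>auto simp: lor cutoff_def indicator_def\<close>)
      ultimately show ?thesis using False x by simp
    qed
    have "I1 x = lor ?c x - (a2 * (g (x - t2) * indicator {t2<..D} x) + a3 * (g (x - t3) * indicator {t3<..D} x)
        + a23 * (g (x - t) * indicator {t<..D} x)) + (KM x - KN x)"
      unfolding T' int[symmetric] using x by (simp add: lor)
    then show ?thesis unfolding Er hi0 by (simp add: sh)
  qed
  have lo0: "lor ?c (x + D) = 0" "hir ?c (x + D - D) = hir ?c x" if "0 < x" for x
    using that by (simp_all add: lor)
  show "I2 x = Er ?c (x + D)" if x: "x \<in> {0<..<t2}"
    unfolding T' Er using x t2 t23 D R[of x] lo0[of x] by (simp add: lor hir_def cat_f2)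
  show "I3 x = Er ?c (x + D)" if x: "x \<in> {t2<..<t3}"
    unfolding T' Er using x t2 t23 D R[of x] lo0[of x] by (simp add: lor hir_def cat_f3)
  show "I23 x = Er ?c (x + D)" if x: "x \<in> {t3<..<t}"
    unfolding T' Er using x t2 t23 D R[of x] lo0[of x] by (simp add: lor hir_def cat_f23)
qed

section \<open>Transfer to the space X\<close>

abbreviation "T \<equiv> opT a2 a3 a23 b t2 t3 D N M"

lemma sq_int_E_cat:
  assumes z: "inX t2 t3 D z"
  shows "sq_int (cplx (Er (cat z)))"
proof -
  have "sq_int (cx.E (cplx (cat z)))"
    by (rule cx.sq_int_E[OF sq_int_cat(1)[OF z]]) (simp add: cat_supp)
  then show ?thesis by (simp add: E_cplx)
qed

lemma inX_T:
  assumes z: "inX t2 t3 D z"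
  shows "inX t2 t3 D (T z)"
proof -
  obtain g f2 f3 f23 where zz: "z = (g, f2, f3, f23)" by (cases z) auto
  obtain I1 I2 I3 I23 where TT: "T z = (I1, I2, I3, I23)" by (cases "T z") auto
  note e = opT_eq[OF z[unfolded zz] TT[unfolded zz], folded zz] and s = sq_int_E_cat[OF z]
  have "L2_on {0<..<D} I1" by (rule L2_onI[OF s, of "{t2, t3, t}" _ _ _ 0]) (use e(1) in auto)
  moreover have "L2_on {0<..<t2} I2" by (rule L2_onI[OF s, of "{}" _ _ _ D]) (use e(2) in auto)
  moreover have "L2_on {t2<..<t3} I3" by (rule L2_onI[OF s, of "{}" _ _ _ D]) (use e(3) in auto)
  moreover have "L2_on {t3<..<t} I23" by (rule L2_onI[OF s, of "{}" _ _ _ D]) (use e(4) in auto)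
  ultimately show ?thesis by (simp add: inX_def TT)
qed

text \<open>\<open>cat\<close> intertwines \<open>T\<close> with \<open>Er\<close>. The finite set
  \<open>?S\<close> collects the break points of \<open>I1\<close> and the seams between
  components.\<close>

lemma cat_T:
  assumes z: "inX t2 t3 D z"
  shows "AE x in lborel. cat (T z) x = Er (cat z) x"
proof -
  obtain g f2 f3 f23 where zz: "z = (g, f2, f3, f23)" by (cases z) auto
  obtain I1 I2 I3 I23 where TT: "T z = (I1, I2, I3, I23)" by (cases "T z") auto
  note e = opT_eq[OF z[unfolded zz] TT[unfolded zz], folded zz]
  let ?S = "{0, t2, t3, t, D, D + t2, D + t3}"
  have "AE x in lborel. x \<notin> ?S"
    by (intro AE_not_in countable_imp_null_set_lborel) auto
  then show ?thesis
  proof eventually_elim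
    case (elim x)
    consider "x \<notin> {0..<cx.L}" | "0 < x" "x < D" | "0 < x - D" "x - D < t2" | "t2 < x - D" "x - D < t3"
      | "t3 < x - D" "x - D < t"
      using elim unfolding L_eq by auto linarith
    then show ?case
    proof cases
      case 1
      have "complex_of_real (Er (cat z) x) = 0" using cx.E_supp[OF 1, of "cplx (cat z)"] by (simp add: E_cplx)
      then show ?thesis using cat_supp[OF 1] by simp
    next
      case 2
      then show ?thesis using e(1)[of x] elim by (simp add: TT cat_lo)
    next
      case 3
      then show ?thesis using e(2)[of "x - D"] cat_f2[of "x - D" I1 I2 I3 I23] by (simp add: TT)
    next
      case 4
      then show ?thesis using e(3)[of "x - D"] cat_f3[of "x - D" I2 I3 I1 I23] cat_f3[of "x - D" I1 I2 I3 I23] by (simp add: TT)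
    next
      case 5
      then show ?thesis using e(4)[of "x - D"] cat_f23[of "x - D" I1 I2 I3 I23] by (simp add: TT)
    qed
  qed
qed

lemma sq_norm_cong_AE:
  assumes "sq_int u" "sq_int v" "AE x in lborel. u x = v x"
  shows "sq_norm u = sq_norm v"
  unfolding sq_norm_def
  by (rule integral_cong_AE) (use assms in \<open>auto simp: sq_int_def elim: eventually_mono\<close>)

lemma sq_norm_zero_AE:
  assumes "sq_int u" "sq_norm u = 0"
  shows "AE x in lborel. u x = 0"
  using assms integral_nonneg_eq_0_iff_AE[of lborel "\<lambda>x. (norm (u x))\<^sup>2"]
  by (simp add: sq_norm_def sq_int_def)

text \<open>The L2 estimate transfers because \<open>cat\<close> is an isometry that intertwines the
  operators almost everywhere. The absolute value of \<open>C\<close> appears since its sign is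
  unknown.\<close>

lemma bounded_below: "\<exists>C. \<forall>z. inX t2 t3 D z \<longrightarrow> normX t2 t3 D z \<le> C * normX t2 t3 D (T z)"
proof -
  obtain C where C: "\<And>u. sq_int u \<Longrightarrow> (\<And>x. x \<notin> {0..<cx.L} \<Longrightarrow> u x = 0) \<Longrightarrow> sq_norm u \<le> C * sq_norm (cx.E u)"
    using cx.l2_bound[OF sym_nonzero] by blast
  show ?thesis
  proof (intro exI[of _ "sqrt \<bar>C\<bar>"] allI impI)
    fix z assume z: "inX t2 t3 D z"
    have n: "sq_norm (cplx (Er (cat z))) = (normX t2 t3 D (T z))\<^sup>2"
      unfolding sq_int_cat(2)[OF inX_T[OF z], symmetric]
      by (rule sq_norm_cong_AE[OF sq_int_E_cat[OF z] sq_int_cat(1)[OF inX_T[OF z]]])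
         (use cat_T[OF z] in \<open>auto elim: eventually_mono\<close>)
    have "(normX t2 t3 D z)\<^sup>2 \<le> C * sq_norm (cplx (Er (cat z)))"
      using C[OF sq_int_cat(1)[OF z]] cat_supp by (simp add: sq_int_cat(2)[OF z] E_cplx)
    also have "\<dots> \<le> \<bar>C\<bar> * (normX t2 t3 D (T z))\<^sup>2" unfolding n by (intro mult_right_mono) auto
    finally have "sqrt ((normX t2 t3 D z)\<^sup>2) \<le> sqrt (\<bar>C\<bar> * (normX t2 t3 D (T z))\<^sup>2)"
      by (rule real_sqrt_le_mono)
    moreover have "0 \<le> normX t2 t3 D z" "0 \<le> normX t2 t3 D (T z)"
      by (auto simp: normX_def split: prod.splits)
    ultimately show "normX t2 t3 D z \<le> sqrt \<bar>C\<bar> * normX t2 t3 D (T z)"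
      by (simp add: real_sqrt_mult)
  qed
qed

text \<open>The difference is formed after \<open>cat\<close>, where functions can be subtracted and
  \<open>E\<close> is linear; the lower bound then makes it vanish almost everywhere.\<close>

lemma injective:
  assumes y: "inX t2 t3 D y" and z: "inX t2 t3 D z" and eq: "eqX t2 t3 D (T y) (T z)"
  shows "eqX t2 t3 D y z"
proof -
  obtain C where C: "\<And>u. sq_int u \<Longrightarrow> (\<And>x. x \<notin> {0..<cx.L} \<Longrightarrow> u x = 0) \<Longrightarrow> sq_norm u \<le> C * sq_norm (cx.E u)"
    using cx.l2_bound[OF sym_nonzero] by blast
  note sy = sq_int_cat(1)[OF y] and sz = sq_int_cat(1)[OF z]
  define u where "u = (\<lambda>x. (-1) * cplx (cat z) x + cplx (cat y) x)"
  have u: "sq_int u" unfolding u_def by (rule sq_int_add_scaled[OF sz sy])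
  have supp: "u x = 0" if "x \<notin> {0..<cx.L}" for x using cat_supp[OF that] by (simp add: u_def)
  have int: "integrable lborel (cplx (cat y))" "integrable lborel (cplx (cat z))"
    by (rule sq_int_integrable(1)[OF sy _ cx.L_pos], simp add: cat_supp)
       (rule sq_int_integrable(1)[OF sz _ cx.L_pos], simp add: cat_supp)
  have E: "cx.E u = (\<lambda>x. (-1) * cplx (Er (cat z)) x + cplx (Er (cat y)) x)"
    unfolding u_def cx.E_lin[OF int(2,1)] E_cplx ..
  have "AE x in lborel. cat (T y) x = cat (T z) x" using eq by (simp add: eqX_iff_cat)
  with cat_T[OF y] cat_T[OF z] have "AE x in lborel. cx.E u x = 0"
    by eventually_elim (simp add: E)
  then have "sq_norm (cx.E u) = 0"
    using sq_norm_cong_AE[OF cx.sq_int_E[OF u supp], of "\<lambda>_. 0"] by (simp add: sq_int_def sq_norm_def)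
  then have "sq_norm u = 0" using C[OF u supp] sq_norm_nonneg[of u] by simp
  from sq_norm_zero_AE[OF u this] show ?thesis
    unfolding eqX_iff_cat by (rule eventually_mono) (simp add: u_def)
qed

text \<open>Coefficients and kernels are real, so conjugation preserves solutions for real data;
  this is how a complex solution gives a real one.\<close>

lemma E_cnj: "cx.E (\<lambda>x. cnj (u x)) = (\<lambda>x. cnj (cx.E u x))"
proof
  fix x
  have lo: "cx.lo (\<lambda>x. cnj (u x)) = (\<lambda>x. cnj (cx.lo u x))" and hi: "cx.hi (\<lambda>x. cnj (u x)) = (\<lambda>x. cnj (cx.hi u x))"
    by (auto simp: cx.lo_def cx.hi_def)
  have c: "conv (cplx k) (\<lambda>x. cnj (f x)) x = cnj (conv (cplx k) f x)" for k f x
    using Bochner_Integration.integral_cnj[of lborel "\<lambda>y. of_real (k y) * f (x - y)"]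
    unfolding conv_def by simp
  show "cx.E (\<lambda>x. cnj (u x)) x = cnj (cx.E u x)"
    unfolding cx.E_def cx.A_def cx.K_def cx.sh_def lo hi c by simp
qed

lemma surjective:
  assumes y: "inX t2 t3 D y"
  shows "\<exists>z. inX t2 t3 D z \<and> eqX t2 t3 D (T z) y"
proof -
  obtain u where u: "sq_int u" "\<And>x. x \<notin> {0..<cx.L} \<Longrightarrow> u x = 0" "cx.E u = cplx (cat y)"
    using cx.l2_surj[OF sym_nonzero sq_int_cat(1)[OF y]] cat_supp by auto
  have ui: "integrable lborel u" by (rule sq_int_integrable(1)[OF u(1,2) cx.L_pos])
  define c where "c x = Re (u x)" for x
  \<comment> \<open>The real part is written as a half-sum with the conjugate because
    \<open>E\<close> is complex linear.\<close>
  have cu: "cplx c = (\<lambda>x. (1/2) * u x + (1/2) * cnj (u x))"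
    by (auto simp: c_def complex_eq_iff)
  have um: "u \<in> borel_measurable borel" using u(1) by (simp add: sq_int_def)
  have cs: "sq_int (cplx c)"
  proof (rule sq_int_bound(1)[OF u(1)])
    show "cplx c \<in> borel_measurable borel" unfolding c_def[abs_def] using um by measurable
    show "norm (cplx c x) \<le> 1 * norm (u x)" for x by (simp add: c_def abs_Re_le_cmod)
  qed
  have c0: "c x = 0" if "x \<notin> {0..<cx.L}" for x using u(2)[OF that] by (simp add: c_def)
  have Ec: "Er c x = cat y x" for x
  proof -
    have i: "integrable lborel (\<lambda>x. (1/2) * cnj (u x))" using ui by simp
    \<comment> \<open>The instance of \<open>cx.E_lin\<close> with factor -1 and zero functions
      shows that \<open>E\<close> maps 0 to 0; the other one then gives homogeneity.\<close>
    have "cx.E (\<lambda>x. (1/2) * cnj (u x)) = (\<lambda>x. (1/2) * cnj (cx.E u x))"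
      using cx.E_lin[of "\<lambda>x. cnj (u x)" "\<lambda>_. 0" "1/2"] cx.E_lin[of "\<lambda>_. 0" "\<lambda>_. 0" "-1"] ui by (simp add: E_cnj)
    then have "cx.E (cplx c) x = (1/2) * cx.E u x + (1/2) * cnj (cx.E u x)"
      unfolding cu cx.E_lin[OF ui i] by simp
    then have "complex_of_real (Er c x) = of_real (cat y x)" unfolding u(3) E_cplx by simp
    then show ?thesis by simp
  qed
  have cat: "cat (uncat c) = c" by (rule cat_uncat) (rule c0)
  have "L2_on {p<..<q} (\<lambda>x. c (x + d))" for p q d
    by (rule L2_onI[OF cs, of "{}" _ _ _ d]) auto
  from this[of _ _ 0] this have z: "inX t2 t3 D (uncat c)" by (simp add: inX_def uncat_def)
  moreover have "eqX t2 t3 D (T (uncat c)) y"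
    unfolding eqX_iff_cat using cat_T[OF z] by (simp add: cat Ec)
  ultimately show ?thesis by blast
qed

lemma eqX_sym: "eqX t2 t3 D y z \<Longrightarrow> eqX t2 t3 D z y"
  by (auto simp: eqX_iff_cat elim: eventually_mono)

lemma eqX_trans: "eqX t2 t3 D x y \<Longrightarrow> eqX t2 t3 D y z \<Longrightarrow> eqX t2 t3 D x z"
  unfolding eqX_iff_cat by (rule eventually_elim2) auto

lemma invertible: "invertible_on_X t2 t3 D T"
  unfolding invertible_on_X_def
proof (intro conjI allI impI)
  show "inX t2 t3 D (T z)" if "inX t2 t3 D z" for z using that by (rule inX_T)
  show "\<exists>z. inX t2 t3 D z \<and> eqX t2 t3 D (T z) y" if "inX t2 t3 D y" for y using that by (rule surjective)
  show "eqX t2 t3 D y z" if "inX t2 t3 D y" "inX t2 t3 D z" "eqX t2 t3 D (T y) (T z)" for y z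
    using that by (rule injective)
  show "\<exists>C. \<forall>z. inX t2 t3 D z \<longrightarrow> normX t2 t3 D z \<le> C * normX t2 t3 D (T z)" by (rule bounded_below)
qed

text \<open>Bounded with bounded support, hence square integrable; on \<open>(0, D)\<close> the
  right-hand side agrees with \<open>- Nc\<close>.\<close>

lemma inX_rhs: "inX t2 t3 D (\<lambda>x. - N x * indicator {0..t} x, \<lambda>_. 0, \<lambda>_. 0, \<lambda>_. 0)"
proof -
  obtain B where "\<And>x. norm (cplx Nc x) \<le> B" using cx.N bdd_measE by metis
  moreover have "cplx Nc \<in> bdd_on {0..<D}"
    using cx.N cx.N_supp D by (auto simp: bdd_on_def)
  ultimately have "sq_int (\<lambda>x. (-1) * cplx Nc x)"
    using pos by (intro sq_int_scale bdd_on_sq_int(1)[of _ D B]) auto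
  then have s: "sq_int (cplx (\<lambda>x. - Nc x))" by simp
  have "L2_on {0<..<D} (\<lambda>x. - N x * indicator {0..t} x)"
    by (rule L2_onI[OF s, of "{}" _ _ _ 0]) (auto simp: cutoff_def indicator_def)
  then show ?thesis by (simp add: inX_def L2_on_def set_borel_measurable_def set_integrable_def)
qed

end

theorem theorem1:
  fixes a2 a3 a23 b t2 t3 D :: real and N M :: "real \<Rightarrow> real"
  assumes "b \<noteq> 0"
    and "0 < t2" and "t2 \<le> t3" and "t2 + t3 < D"
    and "piecewise_continuous_on 0 (t2 + t3) N"
    and "piecewise_continuous_on 0 D M"
    and "\<forall>s::complex. F0 a2 a3 a23 t2 t3 N s \<noteq> 0 \<or> F1 b D M s \<noteq> 0"
  shows "invertible_on_X t2 t3 D (opT a2 a3 a23 b t2 t3 D N M) \<and>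
         (\<exists>x. inX t2 t3 D x \<and>
              eqX t2 t3 D (opT a2 a3 a23 b t2 t3 D N M x)
                 (\<lambda>\<nu>. - N \<nu> * indicator {0..t2+t3} \<nu>, \<lambda>_. 0, \<lambda>_. 0, \<lambda>_. 0) \<and>
              (\<forall>x'. inX t2 t3 D x' \<and>
                   eqX t2 t3 D (opT a2 a3 a23 b t2 t3 D N M x')
                     (\<lambda>\<nu>. - N \<nu> * indicator {0..t2+t3} \<nu>, \<lambda>_. 0, \<lambda>_. 0, \<lambda>_. 0)
                   \<longrightarrow> eqX t2 t3 D x' x))"
proof -
  interpret real_delay_system a2 a3 a23 b t2 t3 D N M
    using assms by unfold_locales
  let ?y = "(\<lambda>x. - N x * indicator {0..t2 + t3} x, \<lambda>_. 0, \<lambda>_. 0, \<lambda>_. 0)"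
  obtain x where x: "inX t2 t3 D x" "eqX t2 t3 D (T x) ?y" using surjective[OF inX_rhs] by blast
  have "eqX t2 t3 D x' x" if "inX t2 t3 D x'" "eqX t2 t3 D (T x') ?y" for x'
    by (rule injective[OF that(1) x(1) eqX_trans[OF that(2) eqX_sym[OF x(2)]]])
  with x have "\<exists>x. inX t2 t3 D x \<and> eqX t2 t3 D (T x) ?y \<and>
      (\<forall>x'. inX t2 t3 D x' \<and> eqX t2 t3 D (T x') ?y \<longrightarrow> eqX t2 t3 D x' x)"
    by (intro exI[of _ x]) simp
  with invertible show ?thesis by (rule conjI)
qed

end
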